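(* Let $\mathfrak{g}=\mathfrak{h}\oplus\mathbb{R}z$ be a seven-dimensional real unimodular Lie algebra with non-trivial center that is the central extension of a six-dimensional unimodular Lie algebra $(\mathfrak{h},\omega_0)$, where $\omega_0$ is a closed 2-form on $\mathfrak{h}$. Let $\varphi$ be a semi-algebraic soliton on $\mathfrak{g}$ satisfying $\Delta_\varphi\varphi=\lambda\varphi+D^*\varphi$ for some $\lambda\in\mathbb{R}$ and some derivation $D\in\mathrm{Der}(\mathfrak{g})$ such that $Dz=c\,z$ for some $c\in\mathbb{R}$. Let $\tau$ be the intrinsic torsion form of $\varphi$, and let $w_1,w_2^-$ be the intrinsic torsion forms of the $\mathrm{SU}(3)$-structure $(\omega,\psi_+)$ induced by $\varphi$ on $\mathfrak{h}$, with induced metric $g$. Then the constant $\lambda$ is given by \[ \lambda = -3\,c-\frac12\left(|w_2^-|_g^2 +6\,|w_1|_g^2\right) = -3\,c -\frac12\,|\tau|_\varphi^2. \]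
   Context: All Lie algebras are real and finite-dimensional; $d$ denotes the Chevalley-Eilenberg differential, with $d\alpha(x,y)=-\alpha([x,y])$ for 1-forms $\alpha$. Central extension: given a Lie algebra $(\mathfrak{h},[\cdot,\cdot]_{\mathfrak{h}})$ and a closed 2-form $\omega_0\in\Lambda^2\mathfrak{h}^*$ (possibly zero or degenerate), the central extension of $(\mathfrak{h},\omega_0)$ is $\mathfrak{g}=\mathfrak{h}\oplus\mathbb{R}z$ with bracket $[z,\mathfrak{h}]=0$, $[x,y]=-\omega_0(x,y)z+[x,y]_{\mathfrak{h}}$ for $x,y\in\mathfrak{h}$; $\theta\in\mathfrak{g}^*$ is defined by $\theta(z)=1$, $\theta|_{\mathfrak{h}}=0$, so $d\theta=\omega_0$. Forms on $\mathfrak{h}$ are regarded as forms on $\mathfrak{g}$ vanishing on contraction with $z$. A 3-form $\varphi$ on a seven-dimensional vector space is definite if $\iota_w\varphi$ has rank six for each non-zero $w$. A $\mathrm{G}_2$-structure on a seven-dimensional Lie algebra $\mathfrak{g}$ is a definite $\varphi\in\Lambda^3\mathfrak{g}^*$; it is closed if $d\varphi=0$. With $b_\varphi(v,w)=\frac16\,\iota_v\varphi\wedge\iota_w\varphi\wedge\varphi$, it induces the inner product $g_\varphi=\det(b_\varphi)^{-1/9}b_\varphi$, the volume form $\mathrm{vol}_{g_\varphi}=\det(b_\varphi)^{1/9}$, the norm $|\cdot|_\varphi$ on forms ($\beta\wedge *_\varphi\beta=|\beta|^2_\varphi\,\mathrm{vol}_{g_\varphi}$) and the Hodge operator $*_\varphi$.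 The intrinsic torsion form of a closed $\varphi$ is the unique $\tau\in\Lambda^2\mathfrak{g}^*$ with $\tau\wedge\varphi=-*_\varphi\tau$ and $d*_\varphi\varphi=\tau\wedge\varphi$; the Hodge Laplacian is $\Delta_\varphi\varphi=d\tau$. A closed $\varphi$ is a semi-algebraic soliton if $\Delta_\varphi\varphi=\lambda\varphi+D^*\varphi$ for some $\lambda\in\mathbb{R}$, $D\in\mathrm{Der}(\mathfrak{g})$, where $A^*\beta(x_1,\ldots,x_k)=\sum_i\beta(x_1,\ldots,Ax_i,\ldots,x_k)$. $\mathrm{SU}(3)$-structures: a 3-form $\rho$ on an oriented six-dimensional space $(V,\Omega)$ is definite if $\iota_v\rho$ has rank four for all $v\neq0$; it induces the complex structure $J=(-P)^{-1/2}S_\rho$, where $\iota_v\rho\wedge\rho\wedge\eta=\eta(S_\rho(v))\Omega$ for all $\eta\in V^*$ and $S_\rho^2=P\,\mathrm{Id}$, $P<0$. An $\mathrm{SU}(3)$-structure is a pair $(\omega,\psi_+)$ of a non-degenerate 2-form and a definite 3-form with $\omega\wedge\psi_+=0$, $3\,\psi_+\wedge J\psi_+=2\,\omega^3$ and $g=\omega(\cdot,J\cdot)$ positive-definite, where $J$ is induced by $\psi_+$ and the orientation $\omega^3$; $\psi_-=J\psi_+$. Here $J$ acts on $k$-forms by $J\beta=\beta(J\cdot,\ldots,J\cdot)$. Induced $\mathrm{SU}(3)$-structure on $\mathfrak{h}$: for a closed $\mathrm{G}_2$-structure $\varphi$ on $\mathfrak{g}=\mathfrak{h}\oplus\mathbb{R}z$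 set $u=g_\varphi(z,z)^{1/2}$ and $\eta=u^{-2}g_\varphi(z,\cdot)=\eta_{\mathfrak{h}}+\theta$ with $\eta_{\mathfrak{h}}\in\mathfrak{h}^*$. Then $\varphi=u\,\omega\wedge\eta+\psi_+$ for a unique $\mathrm{SU}(3)$-structure $(\omega,\psi_+)$ on $\mathfrak{h}$, inducing the metric $g$ with $g_\varphi=g+u^2\eta\otimes\eta$; moreover $d\omega=0$. Its intrinsic torsion forms are the unique $w_1\in\mathfrak{h}^*$ and $w_2^\pm\in\Lambda^2_8\mathfrak{h}^*=\{\beta\in\Lambda^2\mathfrak{h}^*\mid J\beta=\beta,\ \beta\wedge\omega^2=0\}$ with $d\psi_+=w_2^+\wedge\omega+w_1\wedge\psi_+$ and $d\psi_-=w_2^-\wedge\omega+Jw_1\wedge\psi_+$. Norms $|\cdot|_g$ on forms satisfy $\beta\wedge*_g\beta=|\beta|_g^2\,\mathrm{vol}_g$, $\mathrm{vol}_g=\frac16\omega^3$. *)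

theory Defs
  imports
    "HOL-Analysis.Product_Vector"
    "HOL-Combinatorics.Permutations"
    "HOL-Library.FuncSet"
    "Jordan_Normal_Form.Determinant"
begin

section \<open>Exterior algebra\<close>

text \<open>A \<open>k\<close>-form takes its arguments \<open>x\<^sub>0, \<dots>, x\<^sub>k\<^sub>-\<^sub>1\<close> as an infinite sequence of which only the first
  \<open>k\<close> entries matter. Hence two \<open>k\<close>-forms agree iff they are equal as functions.\<close>

type_synonym 'v form = "(nat \<Rightarrow> 'v) \<Rightarrow> real"

definition is_form :: "nat \<Rightarrow> 'v::real_vector form \<Rightarrow> bool" where
  "is_form k \<alpha> \<longleftrightarrow>
     (\<forall>x y. (\<forall>i<k. x i = y i) \<longrightarrow> \<alpha> x = \<alpha> y) \<and>
     (\<forall>x. \<forall>i<k. linear (\<lambda>v. \<alpha> (x(i := v)))) \<and>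
     (\<forall>x. \<forall>i<k. \<forall>j<k. i \<noteq> j \<and> x i = x j \<longrightarrow> \<alpha> x = 0)"

definition wedge :: "nat \<Rightarrow> nat \<Rightarrow> 'v form \<Rightarrow> 'v form \<Rightarrow> 'v form" where
  "wedge k l \<alpha> \<beta> = (\<lambda>x.
     (\<Sum>\<sigma> | \<sigma> permutes {..<k + l}.
        of_int (sign \<sigma>) * \<alpha> (\<lambda>i. x (\<sigma> i)) * \<beta> (\<lambda>i. x (\<sigma> (k + i)))) / (fact k * fact l))"

definition contract :: "'v \<Rightarrow> 'v form \<Rightarrow> 'v form" where
  "contract v \<alpha> = (\<lambda>x. \<alpha> (case_nat v x))"

abbreviation eval2 :: "'v form \<Rightarrow> 'v \<Rightarrow> 'v \<Rightarrow> real" where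
  "eval2 \<beta> v w \<equiv> \<beta> (case_nat v (\<lambda>_. w))"

text \<open>The rank of the linear map \<open>v \<mapsto> \<iota>\<^sub>v \<beta>\<close> into the dual space, by rank-nullity.\<close>

definition form2_rank :: "'v::real_vector form \<Rightarrow> nat" where
  "form2_rank \<beta> = dim (UNIV :: 'v set) - dim {v. \<forall>w. eval2 \<beta> v w = 0}"

definition pullback :: "('v \<Rightarrow> 'w) \<Rightarrow> 'w form \<Rightarrow> 'v form" where
  "pullback f \<alpha> = (\<lambda>x. \<alpha> (\<lambda>i. f (x i)))"

text \<open>The derivation action \<open>A\<^sup>* \<beta>\<close> of an endomorphism on \<open>k\<close>-forms, as opposed to the
  multiplicative action \<^const>\<open>pullback\<close>.\<close>

definition der_action :: "('v \<Rightarrow> 'v) \<Rightarrow> nat \<Rightarrow> 'v form \<Rightarrow> 'v form" where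
  "der_action A k \<beta> = (\<lambda>x. \<Sum>i<k. \<beta> (x(i := A (x i))))"


section \<open>Metrics on forms and the Hodge operator\<close>

definition orthonormal_frame :: "('v::real_vector \<Rightarrow> 'v \<Rightarrow> real) \<Rightarrow> (nat \<Rightarrow> 'v) \<Rightarrow> bool" where
  "orthonormal_frame g e \<longleftrightarrow>
     (\<forall>i < dim (UNIV :: 'v set). \<forall>j < dim (UNIV :: 'v set). g (e i) (e j) = of_bool (i = j))"

text \<open>The inner product on \<open>k\<close>-forms for which the products \<open>e\<^sup>i\<^sup>1 \<and> \<dots> \<and> e\<^sup>i\<^sup>k\<close> with increasing indices
  of an orthonormal coframe are orthonormal. The sum runs over all index tuples, whence the
  division by \<open>k!\<close>. The value does not depend on the chosen frame.\<close>

definition form_inner ::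
  "('v::real_vector \<Rightarrow> 'v \<Rightarrow> real) \<Rightarrow> nat \<Rightarrow> 'v form \<Rightarrow> 'v form \<Rightarrow> real" where
  "form_inner g k \<alpha> \<beta> =
     (let e = (SOME e. orthonormal_frame g e) in
        (\<Sum>f \<in> {..<k} \<rightarrow>\<^sub>E {..<dim (UNIV :: 'v set)}.
           \<alpha> (\<lambda>i. e (f i)) * \<beta> (\<lambda>i. e (f i))) / fact k)"

definition form_norm :: "('v::real_vector \<Rightarrow> 'v \<Rightarrow> real) \<Rightarrow> nat \<Rightarrow> 'v form \<Rightarrow> real" where
  "form_norm g k \<beta> = sqrt (form_inner g k \<beta> \<beta>)"

definition hodge ::
  "('v::real_vector \<Rightarrow> 'v \<Rightarrow> real) \<Rightarrow> 'v form \<Rightarrow> nat \<Rightarrow> 'v form \<Rightarrow> 'v form" where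
  "hodge g vol k \<beta> =
     (THE \<gamma>. is_form (dim (UNIV :: 'v set) - k) \<gamma> \<and>
        (\<forall>\<alpha>. is_form k \<alpha> \<longrightarrow>
           wedge k (dim (UNIV :: 'v set) - k) \<alpha> \<gamma> = (\<lambda>x. form_inner g k \<alpha> \<beta> * vol x)))"


section \<open>Lie algebras\<close>

definition lie_algebra :: "('v::real_vector \<Rightarrow> 'v \<Rightarrow> 'v) \<Rightarrow> bool" where
  "lie_algebra br \<longleftrightarrow>
     (\<forall>x. linear (br x)) \<and> (\<forall>y. linear (\<lambda>x. br x y)) \<and> (\<forall>x. br x x = 0) \<and>
     (\<forall>x y z. br x (br y z) + br y (br z x) + br z (br x y) = 0)"

definition lin_trace :: "('v::real_vector \<Rightarrow> 'v) \<Rightarrow> real" where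
  "lin_trace f =
     (let B = (SOME B. independent B \<and> span B = (UNIV :: 'v set)) in
        \<Sum>b\<in>B. representation B (f b) b)"

definition unimodular :: "('v::real_vector \<Rightarrow> 'v \<Rightarrow> 'v) \<Rightarrow> bool" where
  "unimodular br \<longleftrightarrow> (\<forall>x. lin_trace (br x) = 0)"

definition lie_center :: "('v::real_vector \<Rightarrow> 'v \<Rightarrow> 'v) \<Rightarrow> 'v set" where
  "lie_center br = {x. \<forall>y. br x y = 0}"

definition lie_derivation :: "('v::real_vector \<Rightarrow> 'v \<Rightarrow> 'v) \<Rightarrow> ('v \<Rightarrow> 'v) \<Rightarrow> bool" where
  "lie_derivation br D \<longleftrightarrow>
     linear D \<and> (\<forall>x y. D (br x y) = br (D x) y + br x (D y))"

text \<open>Chevalley--Eilenberg differential of a \<open>k\<close>-form: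
  \<open>(d\<alpha>)(x\<^sub>0, \<dots>, x\<^sub>k) = \<Sum>i<j. (-1)\<^sup>i\<^sup>+\<^sup>j \<alpha>([x\<^sub>i, x\<^sub>j], x\<^sub>0, \<dots>, x\<^sub>k)\<close> with \<open>x\<^sub>i\<close> and \<open>x\<^sub>j\<close> omitted from
  the list; \<open>skip2 i j\<close> enumerates the indices other than \<open>i < j\<close> in increasing order.
  For \<open>k = 1\<close> this is \<open>d\<alpha>(x, y) = - \<alpha>([x, y])\<close>.\<close>

definition skip2 :: "nat \<Rightarrow> nat \<Rightarrow> nat \<Rightarrow> nat" where
  "skip2 i j m = (if m < i then m else if m + 1 < j then m + 1 else m + 2)"

definition ce_d :: "('v \<Rightarrow> 'v \<Rightarrow> 'v) \<Rightarrow> nat \<Rightarrow> 'v form \<Rightarrow> 'v form" where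
  "ce_d br k \<alpha> = (\<lambda>x. \<Sum>j\<le>k. \<Sum>i<j.
     (-1) ^ (i + j) * \<alpha> (case_nat (br (x i) (x j)) (\<lambda>m. x (skip2 i j m))))"

text \<open>The central extension of \<open>\<hh>\<close> is modelled on the product \<open>\<hh> \<times> \<real>\<close>, with \<open>z = (0, 1)\<close>.\<close>

definition central_ext ::
  "('h \<Rightarrow> 'h \<Rightarrow> 'h) \<Rightarrow> 'h form \<Rightarrow> 'h \<times> real \<Rightarrow> 'h \<times> real \<Rightarrow> 'h \<times> real" where
  "central_ext br \<omega>\<^sub>0 = (\<lambda>(x, s) (y, t). (br x y, - eval2 \<omega>\<^sub>0 x y))"

definition zvec :: "'h::real_vector \<times> real" where
  "zvec = (0, 1)"

abbreviation lift_form :: "'h form \<Rightarrow> ('h \<times> real) form" where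
  "lift_form \<equiv> pullback fst"


section \<open>\<open>G\<^sub>2\<close>-structures\<close>

definition g2_structure :: "'v::real_vector form \<Rightarrow> bool" where
  "g2_structure \<phi> \<longleftrightarrow>
     dim (UNIV :: 'v set) = 7 \<and> is_form 3 \<phi> \<and> (\<forall>w. w \<noteq> 0 \<longrightarrow> form2_rank (contract w \<phi>) = 6)"

definition g2_b :: "'v form \<Rightarrow> 'v \<Rightarrow> 'v \<Rightarrow> 'v form" where
  "g2_b \<phi> v w = (\<lambda>x. wedge 4 3 (wedge 2 2 (contract v \<phi>) (contract w \<phi>)) \<phi> x / 6)"

text \<open>The 7-form \<open>det(b)\<^sup>1\<^sup>/\<^sup>9\<close>: if \<open>x\<^sub>0, \<dots>, x\<^sub>6\<close> is a basis with dual basis \<open>x\<^sup>0, \<dots>, x\<^sup>6\<close> and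
  \<open>b(x\<^sub>i, x\<^sub>j) = B\<^sub>i\<^sub>j x\<^sup>0 \<and> \<dots> \<and> x\<^sup>6\<close>, then \<open>B\<^sub>i\<^sub>j = b(x\<^sub>i, x\<^sub>j)(x\<^sub>0, \<dots>, x\<^sub>6)\<close> and
  \<open>det(b)\<^sup>1\<^sup>/\<^sup>9 = det(B)\<^sup>1\<^sup>/\<^sup>9 x\<^sup>0 \<and> \<dots> \<and> x\<^sup>6\<close>, with the real ninth root, which may be negative.
  On linearly dependent arguments the formula gives 0.\<close>

definition g2_vol :: "'v form \<Rightarrow> 'v form" where
  "g2_vol \<phi> = (\<lambda>x. root 9 (det (mat 7 7 (\<lambda>(i, j). g2_b \<phi> (x i) (x j) x))))"

text \<open>\<open>b(v, w) = g(v, w) vol\<close>, that is \<open>g = det(b)\<^sup>-\<^sup>1\<^sup>/\<^sup>9 b\<close>.\<close>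

definition g2_metric :: "'v form \<Rightarrow> 'v \<Rightarrow> 'v \<Rightarrow> real" where
  "g2_metric \<phi> v w = (THE r. \<forall>x. g2_b \<phi> v w x = r * g2_vol \<phi> x)"

abbreviation g2_hodge :: "'v::real_vector form \<Rightarrow> nat \<Rightarrow> 'v form \<Rightarrow> 'v form" where
  "g2_hodge \<phi> \<equiv> hodge (g2_metric \<phi>) (g2_vol \<phi>)"

definition closed_g2_structure :: "('v::real_vector \<Rightarrow> 'v \<Rightarrow> 'v) \<Rightarrow> 'v form \<Rightarrow> bool" where
  "closed_g2_structure br \<phi> \<longleftrightarrow> g2_structure \<phi> \<and> ce_d br 3 \<phi> = (\<lambda>_. 0)"

definition g2_torsion_form ::
  "('v::real_vector \<Rightarrow> 'v \<Rightarrow> 'v) \<Rightarrow> 'v form \<Rightarrow> 'v form \<Rightarrow> bool" where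
  "g2_torsion_form br \<phi> \<tau> \<longleftrightarrow>
     is_form 2 \<tau> \<and>
     wedge 2 3 \<tau> \<phi> = (\<lambda>x. - g2_hodge \<phi> 2 \<tau> x) \<and>
     ce_d br 4 (g2_hodge \<phi> 3 \<phi>) = wedge 2 3 \<tau> \<phi>"

text \<open>The Hodge Laplacian \<open>\<Delta>\<^sub>\<phi> \<phi> = d\<tau>\<close> of a closed \<open>G\<^sub>2\<close>-structure.\<close>

definition g2_laplacian :: "('v::real_vector \<Rightarrow> 'v \<Rightarrow> 'v) \<Rightarrow> 'v form \<Rightarrow> 'v form" where
  "g2_laplacian br \<phi> = ce_d br 2 (THE \<tau>. g2_torsion_form br \<phi> \<tau>)"

definition semi_algebraic_soliton ::
  "('v::real_vector \<Rightarrow> 'v \<Rightarrow> 'v) \<Rightarrow> 'v form \<Rightarrow> real \<Rightarrow> ('v \<Rightarrow> 'v) \<Rightarrow> bool" where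
  "semi_algebraic_soliton br \<phi> l D \<longleftrightarrow>
     closed_g2_structure br \<phi> \<and> lie_derivation br D \<and>
     g2_laplacian br \<phi> = (\<lambda>x. l * \<phi> x + der_action D 3 \<phi> x)"


section \<open>\<open>SU(3)\<close>-structures\<close>

definition form2_square :: "'v form \<Rightarrow> 'v form" where
  "form2_square \<omega> = wedge 2 2 \<omega> \<omega>"

definition form2_cube :: "'v form \<Rightarrow> 'v form" where
  "form2_cube \<omega> = wedge 4 2 (form2_square \<omega>) \<omega>"

definition su3_S :: "'v::real_vector form \<Rightarrow> 'v form \<Rightarrow> 'v \<Rightarrow> 'v" where
  "su3_S \<Omega> \<rho> v =
     (THE s. \<forall>\<eta>. is_form 1 \<eta> \<longrightarrow>
        wedge 5 1 (wedge 2 3 (contract v \<rho>) \<rho>) \<eta> = (\<lambda>x. \<eta> (\<lambda>_. s) * \<Omega> x))"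

definition su3_P :: "'v::real_vector form \<Rightarrow> 'v form \<Rightarrow> real" where
  "su3_P \<Omega> \<rho> = (THE P. \<forall>v. su3_S \<Omega> \<rho> (su3_S \<Omega> \<rho> v) = P *\<^sub>R v)"

text \<open>The complex structure induced by a definite 3-form and the orientation \<open>\<Omega>\<close>; rescaling \<open>\<Omega>\<close>
  by a positive constant does not change it.\<close>

definition induced_J :: "'v::real_vector form \<Rightarrow> 'v form \<Rightarrow> 'v \<Rightarrow> 'v" where
  "induced_J \<Omega> \<rho> v = (1 / sqrt (- su3_P \<Omega> \<rho>)) *\<^sub>R su3_S \<Omega> \<rho> v"

abbreviation su3_J :: "'v::real_vector form \<Rightarrow> 'v form \<Rightarrow> 'v \<Rightarrow> 'v" where
  "su3_J \<omega> \<psi> \<equiv> induced_J (form2_cube \<omega>) \<psi>"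

definition su3_metric :: "'v::real_vector form \<Rightarrow> 'v form \<Rightarrow> 'v \<Rightarrow> 'v \<Rightarrow> real" where
  "su3_metric \<omega> \<psi> v w = eval2 \<omega> v (su3_J \<omega> \<psi> w)"

definition psi_minus :: "'v::real_vector form \<Rightarrow> 'v form \<Rightarrow> 'v form" where
  "psi_minus \<omega> \<psi> = pullback (su3_J \<omega> \<psi>) \<psi>"

definition su3_structure :: "'v::real_vector form \<Rightarrow> 'v form \<Rightarrow> bool" where
  "su3_structure \<omega> \<psi> \<longleftrightarrow>
     dim (UNIV :: 'v set) = 6 \<and>
     is_form 2 \<omega> \<and> (\<forall>v. v \<noteq> 0 \<longrightarrow> (\<exists>w. eval2 \<omega> v w \<noteq> 0)) \<and>
     is_form 3 \<psi> \<and> (\<forall>v. v \<noteq> 0 \<longrightarrow> form2_rank (contract v \<psi>) = 4) \<and>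
     wedge 2 3 \<omega> \<psi> = (\<lambda>_. 0) \<and>
     (\<forall>x. 3 * wedge 3 3 \<psi> (psi_minus \<omega> \<psi>) x = 2 * form2_cube \<omega> x) \<and>
     (\<forall>v. v \<noteq> 0 \<longrightarrow> su3_metric \<omega> \<psi> v v > 0)"

definition Lambda2_8 :: "'v::real_vector form \<Rightarrow> 'v form \<Rightarrow> 'v form set" where
  "Lambda2_8 \<omega> \<psi> = {\<beta>. is_form 2 \<beta> \<and> pullback (su3_J \<omega> \<psi>) \<beta> = \<beta> \<and>
     wedge 2 4 \<beta> (form2_square \<omega>) = (\<lambda>_. 0)}"

definition su3_torsion_forms ::
  "('v::real_vector \<Rightarrow> 'v \<Rightarrow> 'v) \<Rightarrow> 'v form \<Rightarrow> 'v form \<Rightarrow>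
     'v form \<Rightarrow> 'v form \<Rightarrow> 'v form \<Rightarrow> bool" where
  "su3_torsion_forms br \<omega> \<psi> w1 w2p w2m \<longleftrightarrow>
     is_form 1 w1 \<and> w2p \<in> Lambda2_8 \<omega> \<psi> \<and> w2m \<in> Lambda2_8 \<omega> \<psi> \<and>
     ce_d br 3 \<psi> = (\<lambda>x. wedge 2 2 w2p \<omega> x + wedge 1 3 w1 \<psi> x) \<and>
     ce_d br 3 (psi_minus \<omega> \<psi>) =
       (\<lambda>x. wedge 2 2 w2m \<omega> x + wedge 1 3 (pullback (su3_J \<omega> \<psi>) w1) \<psi> x)"


section \<open>The \<open>SU(3)\<close>-structure induced on the central quotient\<close>

definition induced_u :: "('h::real_vector \<times> real) form \<Rightarrow> real" where
  "induced_u \<phi> = sqrt (g2_metric \<phi> zvec zvec)"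

definition induced_eta :: "('h::real_vector \<times> real) form \<Rightarrow> ('h \<times> real) form" where
  "induced_eta \<phi> = (\<lambda>x. g2_metric \<phi> zvec (x 0) / (induced_u \<phi>)\<^sup>2)"

definition induced_su3_structure ::
  "('h::real_vector \<times> real) form \<Rightarrow> 'h form \<Rightarrow> 'h form \<Rightarrow> bool" where
  "induced_su3_structure \<phi> \<omega> \<psi> \<longleftrightarrow>
     su3_structure \<omega> \<psi> \<and>
     \<phi> = (\<lambda>x. induced_u \<phi> * wedge 2 1 (lift_form \<omega>) (induced_eta \<phi>) x + lift_form \<psi> x)"

end

theory Submission imports Defs begin

text \<open>
  The constant \<open>\<lambda>\<close> is determined by two scalar identities. Evaluating the soliton equation on \<open>(z, p\<^sub>i, q\<^sub>i)\<close> and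
  summing over a symplectic basis of \<open>\<hh>\<close> gives \<open>tr D = - 3 \<lambda> - 2 c\<close>: the left-hand side is
  \<open>\<tau>(z, \<Sum>\<^sub>i [p\<^sub>i, q\<^sub>i])\<close>, and \<open>\<Sum>\<^sub>i [p\<^sub>i, q\<^sub>i]\<close> is a multiple of \<open>z\<close> because \<open>\<omega>\<close> is closed and \<open>\<hh>\<close> is unimodular. On the
  other hand \<open>\<tau> \<and> *\<phi> = 0\<close>, so differentiating gives \<open>\<langle>d\<tau>, \<phi>\<rangle> = |\<tau>|\<^sup>2\<close>, while the soliton equation gives
  \<open>\<langle>d\<tau>, \<phi>\<rangle> = 7 \<lambda> + 3 tr D\<close>. Finally \<open>|\<tau>| = |d*\<phi>|\<close>, and with \<open>\<theta> = u \<eta>\<close> one has \<open>*\<phi> = \<omega>\<^sup>2/2 + \<psi>\<^sub>- \<and> \<theta>\<close> and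
  \<open>d\<psi>\<^sub>+ = - \<omega> \<and> d\<theta>\<close>; so the components of \<open>d*\<phi>\<close> are those of \<open>d\<psi>\<^sub>-\<close> and of \<open>\<psi>\<^sub>- \<and> d\<theta>\<close>, whose squared norms are
  \<open>|w\<^sub>2\<^sup>-|\<^sup>2 + 2 |w\<^sub>1|\<^sup>2\<close> and \<open>4 |w\<^sub>1|\<^sup>2\<close>. All computations take place in a frame adapted to the \<open>SU(3)\<close>-structure,
  whose existence is proved from the definition of the induced complex structure.
\<close>

section \<open>Alternating forms\<close>

text \<open>General identities for forms are proved by induction on the degree: a form is determined
  by its contractions, contraction is an antiderivation of the wedge product, and Cartan's formula
  makes the differential a recursion of the same kind. The geometric part is shaped by description
  operators. The maps \<open>su3_S\<close>, \<open>su3_P\<close>, \<open>g2_metric\<close> and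
  \<open>hodge\<close> are given by \<open>THE\<close>, and the frame behind
  \<open>form_inner\<close> by \<open>SOME\<close>; nothing is known of them before existence and
  uniqueness, or independence of the choice, is proved. This dictates the order: first \<omega>^3 is
  nonzero, then S exists, then S^2 is a negative scalar, and only then is there a frame. In 7
  \<lambda> + 3 tr D the 7 is |\<phi>|^2 and the 3 counts the slots of \<phi> on which D acts. The
  norms of \<tau> and of the differential of the dual of \<phi> agree because that differential is
  minus the dual of \<tau>. The form w_2^+ leaves no trace in the norm of \<tau>: the wedge product
  of \<psi>_- with a J-invariant 2-form vanishes, so \<psi>_- \<and> d\<theta> sees only the w_1
  part of d\<psi>_+.\<close>

lemma is_form_cong: "is_form k \<alpha> \<Longrightarrow> (\<And>i. i < k \<Longrightarrow> x i = y i) \<Longrightarrow> \<alpha> x = \<alpha> y"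
  unfolding is_form_def by blast

lemma is_form_linear: "is_form k \<alpha> \<Longrightarrow> i < k \<Longrightarrow> linear (\<lambda>v. \<alpha> (x(i := v)))"
  unfolding is_form_def by blast

lemma is_form_alt: "is_form k \<alpha> \<Longrightarrow> i < k \<Longrightarrow> j < k \<Longrightarrow> i \<noteq> j \<Longrightarrow> x i = x j \<Longrightarrow> \<alpha> x = 0"
  unfolding is_form_def by blast

lemma is_form_linear_head:
  assumes "is_form (Suc k) \<alpha>"
  shows "linear (\<lambda>v. \<alpha> (case_nat v x))"
proof -
  have "(case_nat undefined x)(0 := v) = case_nat v x" for v
    by (auto simp: fun_eq_iff split: nat.split)
  then show ?thesis
    using is_form_linear[OF assms, of 0 "case_nat undefined x"] by simp
qed

lemma is_form_alt_head: "is_form (Suc (Suc k)) \<alpha> \<Longrightarrow> \<alpha> (case_nat v (case_nat v x)) = 0"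
  by (erule is_form_alt[where i = 0 and j = 1]) auto

text \<open>Polarization: the value with \<open>x i + x j\<close> in both slots vanishes, and so do
  the two diagonal terms of its expansion.\<close>

lemma is_form_transpose:
  assumes "is_form k \<alpha>" "i < k" "j < k" "i \<noteq> j"
  shows "\<alpha> (x \<circ> transpose i j) = - \<alpha> x"
proof -
  define f where "f a b = \<alpha> (x(i := a, j := b))" for a b
  have l2: "linear (f a)" for a
    unfolding f_def using is_form_linear[OF assms(1,3)] by simp
  have l1: "linear (\<lambda>a. f a b)" for b
    unfolding f_def using is_form_linear[OF assms(1,2), of "x(j := b)"] assms(4)
    by (simp add: fun_upd_twist)
  have 0: "f a a = 0" for a
    unfolding f_def using assms by (intro is_form_alt[OF assms(1-4)]) auto
  have "f (x i + x j) (x i + x j) = f (x i) (x i) + f (x i) (x j) + f (x j) (x i) + f (x j) (x j)"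
    by (simp add: linear_add[OF l2] linear_add[OF l1])
  then have "f (x j) (x i) = - f (x i) (x j)"
    by (simp add: 0)
  moreover have "x(i := x j, j := x i) = x \<circ> transpose i j"
    using assms(4) by (auto simp: fun_eq_iff transpose_def)
  ultimately show ?thesis
    by (simp add: f_def)
qed

lemma is_form_swap_head:
  assumes "is_form (Suc (Suc k)) \<alpha>"
  shows "\<alpha> (case_nat v (case_nat w x)) = - \<alpha> (case_nat w (case_nat v x))"
proof -
  have "case_nat v (case_nat w x) = case_nat w (case_nat v x) \<circ> transpose 0 1"
    by (auto simp: fun_eq_iff transpose_def split: nat.split)
  then show ?thesis
    using is_form_transpose[OF assms, of 0 1 "case_nat w (case_nat v x)"] by simp
qed

lemma is_form_permute:
  assumes "is_form k \<alpha>" "\<sigma> permutes {..<k}"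
  shows "\<alpha> (x \<circ> \<sigma>) = of_int (sign \<sigma>) * \<alpha> x"
  using finite_lessThan[of k] assms(2)
proof (induction rule: permutes_rev_induct)
  case id
  then show ?case by simp
next
  case (swap a b p)
  have "\<alpha> (x \<circ> (p \<circ> transpose a b)) = - \<alpha> (x \<circ> p)"
    using is_form_transpose[OF assms(1), of a b "x \<circ> p"] swap.hyps by (simp add: comp_assoc)
  also have "\<dots> = of_int (sign (p \<circ> transpose a b)) * \<alpha> x"
    using swap.hyps permutes_imp_permutation[of "{..<k}" p]
    by (subst sign_compose) (simp_all add: swap.IH sign_swap_id permutation_swap_id)
  finally show ?case .
qed

text \<open>Moving the entry at position \<open>p\<close> to the head takes \<open>p\<close>
  adjacent transpositions; all signs in the contraction rules below come from this.\<close>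

definition insert_at :: "nat \<Rightarrow> 'v \<Rightarrow> (nat \<Rightarrow> 'v) \<Rightarrow> nat \<Rightarrow> 'v" where
  "insert_at p v x = (\<lambda>i. if i < p then x i else if i = p then v else x (i - 1))"

lemma insert_at_0: "insert_at 0 v x = case_nat v x"
  by (auto simp: insert_at_def fun_eq_iff split: nat.split)

lemma insert_at_Suc: "insert_at (Suc p) v x = insert_at p v x \<circ> transpose p (Suc p)"
  by (auto simp: insert_at_def fun_eq_iff transpose_def)

lemma is_form_insert_at:
  assumes "is_form k \<alpha>" "p < k"
  shows "\<alpha> (insert_at p v x) = (- 1) ^ p * \<alpha> (case_nat v x)"
  using assms(2)
proof (induction p)
  case 0
  then show ?case by (simp add: insert_at_0)
next
  case (Suc p)
  have "\<alpha> (insert_at (Suc p) v x) = - \<alpha> (insert_at p v x)"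
    unfolding insert_at_Suc using Suc.prems by (intro is_form_transpose[OF assms(1)]) auto
  then show ?case
    using Suc by simp
qed

lemma is_form_contract:
  assumes "is_form (Suc k) \<alpha>"
  shows "is_form k (contract v \<alpha>)"
  unfolding is_form_def
proof (intro conjI allI impI)
  fix x y :: "nat \<Rightarrow> 'a"
  assume "\<forall>i<k. x i = y i"
  then show "contract v \<alpha> x = contract v \<alpha> y"
    unfolding contract_def by (intro is_form_cong[OF assms]) (auto split: nat.split)
next
  fix x :: "nat \<Rightarrow> 'a" and i
  assume "i < k"
  moreover have "case_nat v (x(i := w)) = (case_nat v x)(Suc i := w)" for w
    by (auto simp: fun_eq_iff split: nat.split)
  ultimately show "linear (\<lambda>w. contract v \<alpha> (x(i := w)))"
    unfolding contract_def using is_form_linear[OF assms, of "Suc i" "case_nat v x"] by simp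
next
  fix x :: "nat \<Rightarrow> 'a" and i j
  assume "i < k" "j < k" "i \<noteq> j \<and> x i = x j"
  then show "contract v \<alpha> x = 0"
    unfolding contract_def by (intro is_form_alt[OF assms, of "Suc i" "Suc j"]) auto
qed

lemma contract_case_nat: "contract v \<alpha> x = \<alpha> (case_nat v x)"
  by (simp add: contract_def)

lemma case_nat_head_tail: "case_nat (x 0) (\<lambda>i. x (Suc i)) = x"
  by (auto simp: fun_eq_iff split: nat.split)

text \<open>Every sequence is its head followed by its tail. This is the entry to all inductions on
  the degree, since contraction lowers the degree by one.\<close>

lemma form_eq_contractI:
  "(\<And>v. contract v \<alpha> = contract v \<beta>) \<Longrightarrow> \<alpha> = \<beta>"
  unfolding contract_def fun_eq_iff by (metis case_nat_head_tail)

text \<open>Alternation has to be checked in the first two slots only: a coincidence of slots 0 and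
  j is brought there by moving slot j to the head inside the contracted form, and one between later
  slots is seen by the contracted form itself.\<close>

lemma is_form_SucI:
  assumes c: "\<And>v. is_form k (contract v \<alpha>)"
    and l: "\<And>x. linear (\<lambda>v. \<alpha> (case_nat v x))"
    and a: "\<And>v x. 0 < k \<Longrightarrow> \<alpha> (case_nat v (case_nat v x)) = 0"
  shows "is_form (Suc k) \<alpha>"
proof -
  have split: "\<alpha> x = contract (x 0) \<alpha> (\<lambda>i. x (Suc i))" for x
    by (simp add: contract_def case_nat_head_tail)
  have alt: "\<alpha> x = 0" if "i < j" "j < Suc k" "x i = x j" for x i j
  proof (cases i)
    case (Suc i')
    then show ?thesis
      using that split[of x] is_form_alt[OF c, of i' "j - 1" "\<lambda>i. x (Suc i)" "x 0"] by auto
  next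
    case 0
    \<comment> \<open>Entries 0 and \<open>j\<close> of \<open>x\<close> agree, so the tail of
      \<open>x\<close> is a sequence with \<open>v\<close> inserted at \<open>j - 1\<close>.\<close>
    define v where "v = x 0"
    define y where "y = (\<lambda>i. x (Suc i))"
    define y' where "y' = (\<lambda>i. if i < j - 1 then y i else y (Suc i))"
    have "y = insert_at (j - 1) v y'"
      using that 0 unfolding y'_def y_def v_def insert_at_def by (auto simp: fun_eq_iff)
    then have "\<alpha> x = (- 1) ^ (j - 1) * contract v \<alpha> (case_nat v y')"
      using split[of x] is_form_insert_at[OF c, of "j - 1" v v y'] that 0
      unfolding v_def y_def by simp
    also have "contract v \<alpha> (case_nat v y') = 0"
      using a that 0 by (simp add: contract_def)
    finally show ?thesis by simp
  qed
  show ?thesis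
    unfolding is_form_def
  proof (intro conjI allI impI)
    fix x y :: "nat \<Rightarrow> 'a"
    assume "\<forall>i<Suc k. x i = y i"
    then show "\<alpha> x = \<alpha> y"
      unfolding split[of x] split[of y]
      using is_form_cong[OF c, of "\<lambda>i. x (Suc i)" "\<lambda>i. y (Suc i)" "x 0"] by auto
  next
    fix x :: "nat \<Rightarrow> 'a" and i
    assume i: "i < Suc k"
    show "linear (\<lambda>w. \<alpha> (x(i := w)))"
    proof (cases i)
      case 0
      have "x(0 := w) = case_nat w (\<lambda>i. x (Suc i))" for w
        by (auto simp: fun_eq_iff split: nat.split)
      then show ?thesis using 0 l by simp
    next
      case (Suc i')
      have "\<alpha> (x(Suc i' := w)) = contract (x 0) \<alpha> ((\<lambda>i. x (Suc i))(i' := w))" for w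
        unfolding split[of "x(Suc i' := w)"] by (simp add: fun_upd_def)
      then show ?thesis using Suc i is_form_linear[OF c, of i'] by simp
    qed
  next
    fix x :: "nat \<Rightarrow> 'a" and i j
    assume "i < Suc k" "j < Suc k" "i \<noteq> j \<and> x i = x j"
    then show "\<alpha> x = 0"
      using alt[of i j x] alt[of j i x] by (metis linorder_neqE_nat)
  qed
qed

lemma is_form_0_iff: "is_form 0 \<alpha> \<longleftrightarrow> (\<forall>x y. \<alpha> x = \<alpha> y)"
  unfolding is_form_def by auto

lemma linear_add_fun: "linear f \<Longrightarrow> linear g \<Longrightarrow> linear (\<lambda>v. f v + g v :: real)"
  by (rule linear_compose_add)

lemma linear_cmult_fun: "linear f \<Longrightarrow> linear (\<lambda>v. c * f v :: real)"
  using linear_compose_scale_right[of f c] by simp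

lemma is_form_add:
  "is_form k \<alpha> \<Longrightarrow> is_form k \<beta> \<Longrightarrow> is_form k (\<lambda>x. \<alpha> x + \<beta> x)"
  unfolding is_form_def by (auto intro!: linear_add_fun arg_cong2[of _ _ _ _ plus])

lemma is_form_cmult: "is_form k \<alpha> \<Longrightarrow> is_form k (\<lambda>x. c * \<alpha> x)"
  unfolding is_form_def by (auto intro!: linear_cmult_fun arg_cong2[of _ _ _ _ times])

lemma is_form_zero: "is_form k (\<lambda>x. 0)"
  unfolding is_form_def by (auto simp: linear_zero)

lemma is_form_uminus: "is_form k \<alpha> \<Longrightarrow> is_form k (\<lambda>x. - \<alpha> x)"
  using is_form_cmult[of k \<alpha> "-1"] by simp

lemma is_form_diff: "is_form k \<alpha> \<Longrightarrow> is_form k \<beta> \<Longrightarrow> is_form k (\<lambda>x. \<alpha> x - \<beta> x)"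
  using is_form_add[OF _ is_form_uminus, of k \<alpha> \<beta>] by simp

lemma is_form_sum: "(\<And>i. i \<in> I \<Longrightarrow> is_form k (\<alpha> i)) \<Longrightarrow> is_form k (\<lambda>x. \<Sum>i\<in>I. \<alpha> i x)"
  by (induction I rule: infinite_finite_induct) (auto intro: is_form_zero is_form_add)

lemma is_form_pullback:
  assumes "linear f" "is_form k \<alpha>"
  shows "is_form k (pullback f \<alpha>)"
  unfolding is_form_def pullback_def
proof (intro conjI allI impI)
  fix x y :: "nat \<Rightarrow> 'a"
  assume "\<forall>i<k. x i = y i"
  then show "\<alpha> (\<lambda>i. f (x i)) = \<alpha> (\<lambda>i. f (y i))"
    by (intro is_form_cong[OF assms(2)]) auto
next
  fix x :: "nat \<Rightarrow> 'a" and i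
  assume "i < k"
  moreover have "(\<lambda>j. f ((x(i := v)) j)) = (\<lambda>j. f (x j))(i := f v)" for v
    by auto
  ultimately show "linear (\<lambda>v. \<alpha> (\<lambda>j. f ((x(i := v)) j)))"
    using linear_compose[OF assms(1) is_form_linear[OF assms(2)], of i "\<lambda>j. f (x j)"]
    by (simp add: comp_def)
next
  fix x :: "nat \<Rightarrow> 'a" and i j
  assume "i < k" "j < k" "i \<noteq> j \<and> x i = x j"
  then show "\<alpha> (\<lambda>i. f (x i)) = 0"
    by (intro is_form_alt[OF assms(2), of i j]) auto
qed

lemma wedge_pullback: "wedge k l (pullback f \<alpha>) (pullback f \<beta>) = pullback f (wedge k l \<alpha> \<beta>)"
  by (simp add: wedge_def pullback_def)

section \<open>Permutations split by the place of the value 0; contraction of wedge products\<close>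

definition shift_perm :: "(nat \<Rightarrow> nat) \<Rightarrow> nat \<Rightarrow> nat" where
  "shift_perm \<rho> = case_nat 0 (\<lambda>i. Suc (\<rho> i))"

text \<open>The cycle bringing position \<open>p\<close> to 0 and keeping the order of the others. A
  permutation with value 0 at \<open>p\<close> is this cycle followed by some
  \<open>shift_perm\<close>.\<close>

definition to_front :: "nat \<Rightarrow> nat \<Rightarrow> nat" where
  "to_front p i = (if i < p then Suc i else if i = p then 0 else i)"

lemma to_front_0: "to_front 0 = id"
  by (auto simp: to_front_def fun_eq_iff)

lemma to_front_Suc: "to_front (Suc p) = to_front p \<circ> transpose p (Suc p)"
  by (auto simp: to_front_def fun_eq_iff transpose_def)

lemma to_front_permutes: "p < n \<Longrightarrow> to_front p permutes {..<n}"
proof (induction p)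
  case 0
  show ?case unfolding to_front_0 by (rule permutes_id)
next
  case (Suc p)
  then show ?case
    unfolding to_front_Suc by (intro permutes_compose permutes_swap_id) auto
qed

lemma sign_to_front: "sign (to_front p) = (- 1) ^ p"
proof (induction p)
  case 0
  then show ?case by (simp add: to_front_0)
next
  case (Suc p)
  have "permutation (to_front p)"
    using to_front_permutes[of p "Suc p"] permutes_imp_permutation by blast
  then show ?case
    unfolding to_front_Suc by (subst sign_compose) (simp_all add: permutation_swap_id Suc sign_swap_id)
qed

text \<open>Identifies the shift with a transported permutation, whose sign is available.\<close>

lemma shift_perm_eq: "shift_perm \<rho> = map_permutation {..<n} Suc \<rho>" if "\<rho> permutes {..<n}"
proof
  fix i
  show "shift_perm \<rho> i = map_permutation {..<n} Suc \<rho> i"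
  proof (cases "i \<in> Suc ` {..<n}")
    case True
    then show ?thesis
      by (auto simp: shift_perm_def map_permutation_apply)
  next
    case False
    then have "map_permutation {..<n} Suc \<rho> i = i"
      by (simp add: map_permutation_def restrict_id_def)
    moreover have "shift_perm \<rho> i = i"
    proof (cases i)
      case (Suc j)
      then have "j \<notin> {..<n}" using False by auto
      then show ?thesis using that Suc by (simp add: shift_perm_def permutes_not_in)
    qed (simp add: shift_perm_def)
    ultimately show ?thesis by simp
  qed
qed

lemma sign_shift_perm: "\<rho> permutes {..<n} \<Longrightarrow> sign (shift_perm \<rho>) = sign \<rho>"
  by (simp add: shift_perm_eq sign_map_permutation)

lemma shift_perm_permutes:
  assumes "\<rho> permutes {..<n}"
  shows "shift_perm \<rho> permutes {..<Suc n}"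
proof -
  have "bij_betw Suc {..<n} {1..<Suc n}"
    by (rule bij_betwI[where g = "\<lambda>i. i - 1"]) auto
  from map_permutation_permutes[OF this assms] show ?thesis
    unfolding shift_perm_eq[OF assms] by (rule permutes_subset) auto
qed

text \<open>Permutations are sorted by the position \<open>p\<close> where they take the value 0;
  the other values form an arbitrary permutation of \<open>n\<close> letters. Injectivity of this
  parametrization and the count (n + 1) n! = (n + 1)! give surjectivity.\<close>

lemma sum_permutations_Suc:
  fixes F :: "(nat \<Rightarrow> nat) \<Rightarrow> real"
  shows "(\<Sum>\<sigma> | \<sigma> permutes {..<Suc n}. F \<sigma>) =
    (\<Sum>p<Suc n. \<Sum>\<rho> | \<rho> permutes {..<n}. F (shift_perm \<rho> \<circ> to_front p))"
proof -
  let ?h = "\<lambda>(p, \<rho>). shift_perm \<rho> \<circ> to_front p"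
  have inj: "inj_on ?h ({..<Suc n} \<times> {\<rho>. \<rho> permutes {..<n}})"
  proof (rule inj_onI, clarify)
    fix p \<rho> q \<pi>
    assume *: "p < Suc n" "q < Suc n" "shift_perm \<rho> \<circ> to_front p = shift_perm \<pi> \<circ> to_front q"
    have z: "(shift_perm \<rho> \<circ> to_front p) i = 0 \<longleftrightarrow> i = p" for p \<rho> i
      by (auto simp: shift_perm_def to_front_def split: nat.split)
    have pq: "p = q"
      using z[of \<rho> p p] z[of \<pi> q p] *(3) by simp
    have "bij (to_front q)"
      using to_front_permutes[OF *(2)] permutes_bij by blast
    then have "shift_perm \<rho> = shift_perm \<pi>"
      using *(3) pq by (metis bij_is_surj comp_assoc comp_id surj_iff)
    then have "Suc (\<rho> i) = Suc (\<pi> i)" for i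
      by (metis shift_perm_def old.nat.simps(5))
    then show "p = q \<and> \<rho> = \<pi>"
      using pq by auto
  qed
  have sub: "?h ` ({..<Suc n} \<times> {\<rho>. \<rho> permutes {..<n}}) \<subseteq> {\<sigma>. \<sigma> permutes {..<Suc n}}"
    by (auto intro!: permutes_compose to_front_permutes shift_perm_permutes)
  have "card (?h ` ({..<Suc n} \<times> {\<rho>. \<rho> permutes {..<n}})) = card {\<sigma>. \<sigma> permutes {..<Suc n}}"
    by (simp add: card_image[OF inj] card_cartesian_product card_permutations)
  then have "?h ` ({..<Suc n} \<times> {\<rho>. \<rho> permutes {..<n}}) = {\<sigma>. \<sigma> permutes {..<Suc n}}"
    by (intro card_subset_eq sub) (auto simp: finite_permutations)
  then show ?thesis
    using sum.reindex[OF inj, of F] by (simp add: sum.cartesian_product case_prod_unfold)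
qed

text \<open>The position p with \<sigma>(p) = 0 decides which factor receives v. The k positions p <
  k contribute equally, and so do the l others; this turns the denominator k! l! into (k - 1)! l!
  and k! (l - 1)!. The hypotheses ask for locality and for the sign rule of moving one slot, so that
  a 1-form not yet known to be linear can be treated, as happens for
  \<open>induced_eta\<close>.\<close>

lemma wedge_contract_weak:
  assumes ca: "\<And>x y. (\<And>i. i < k \<Longrightarrow> x i = y i) \<Longrightarrow> \<alpha> x = \<alpha> y"
    and ia: "\<And>p v x. p < k \<Longrightarrow> \<alpha> (insert_at p v x) = (- 1) ^ p * \<alpha> (case_nat v x)"
    and ib: "\<And>p v x. p < l \<Longrightarrow> \<beta> (insert_at p v x) = (- 1) ^ p * \<beta> (case_nat v x)"
    and pos: "0 < k + l"
  shows "contract v (wedge k l \<alpha> \<beta>) =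
    (\<lambda>x. (if k = 0 then 0 else wedge (k - 1) l (contract v \<alpha>) \<beta> x)
       + (if l = 0 then 0 else (- 1) ^ k * wedge k (l - 1) \<alpha> (contract v \<beta>) x))"
proof
  fix y
  obtain n where n: "k + l = Suc n"
    using pos gr0_implies_Suc by blast
  define x where "x = case_nat v y"
  define F where "F \<sigma> = of_int (sign \<sigma>) * \<alpha> (\<lambda>i. x (\<sigma> i)) * \<beta> (\<lambda>i. x (\<sigma> (k + i)))" for \<sigma>
  define G where "G \<rho> = of_int (sign \<rho>) * contract v \<alpha> (\<lambda>i. y (\<rho> i)) * \<beta> (\<lambda>i. y (\<rho> (k - 1 + i)))" for \<rho>
  define H where "H \<rho> = of_int (sign \<rho>) * \<alpha> (\<lambda>i. y (\<rho> i)) * contract v \<beta> (\<lambda>i. y (\<rho> (k + i)))" for \<rho>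
  have sgn: "sign (shift_perm \<rho> \<circ> to_front p) = sign \<rho> * (- 1) ^ p"
    if "\<rho> permutes {..<n}" "p < Suc n" for \<rho> p
    using that to_front_permutes shift_perm_permutes
    by (subst sign_compose)
      (auto simp: sign_to_front sign_shift_perm intro!: permutes_imp_permutation[of "{..<Suc n}"])
  have xs: "x ((shift_perm \<rho> \<circ> to_front p) i) = insert_at p v (\<lambda>i. y (\<rho> i)) i" for \<rho> p i
    by (auto simp: x_def shift_perm_def to_front_def insert_at_def split: nat.split)
  have FG: "F (shift_perm \<rho> \<circ> to_front p) = G \<rho>" if "\<rho> permutes {..<n}" "p < k" for \<rho> p
  proof -
    have 2: "(\<lambda>i. insert_at p v (\<lambda>i. y (\<rho> i)) (k + i)) = (\<lambda>i. y (\<rho> (k - 1 + i)))"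
      using that by (auto simp: insert_at_def fun_eq_iff)
    show ?thesis
      unfolding F_def G_def xs 2 using that n
      by (simp add: sgn ia contract_case_nat power_mult_distrib[symmetric]
          flip: power_mult)
  qed
  have FH: "F (shift_perm \<rho> \<circ> to_front p) = (- 1) ^ k * H \<rho>"
    if "\<rho> permutes {..<n}" "k \<le> p" "p < Suc n" for \<rho> p
  proof -
    have 1: "\<alpha> (insert_at p v (\<lambda>i. y (\<rho> i))) = \<alpha> (\<lambda>i. y (\<rho> i))"
      using that by (intro ca) (auto simp: insert_at_def)
    have 2: "(\<lambda>i. insert_at p v (\<lambda>i. y (\<rho> i)) (k + i)) = insert_at (p - k) v (\<lambda>i. y (\<rho> (k + i)))"
      using that by (auto simp: insert_at_def fun_eq_iff)
    have 3: "(- 1 :: real) ^ p * (- 1) ^ (p - k) = (- 1) ^ k"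
      using that by (simp add: minus_one_power_iff)
    show ?thesis
      unfolding F_def H_def xs 2 using that n 3[symmetric]
      by (simp add: sgn 1 ib contract_case_nat)
  qed
  have "(\<Sum>\<sigma> | \<sigma> permutes {..<k + l}. F \<sigma>) =
      (\<Sum>p<Suc n. \<Sum>\<rho> | \<rho> permutes {..<n}. F (shift_perm \<rho> \<circ> to_front p))"
    unfolding n by (rule sum_permutations_Suc)
  also have "{..<Suc n} = {..<k} \<union> {k..<Suc n}"
    using n by auto
  also have "(\<Sum>p\<in>\<dots>. \<Sum>\<rho> | \<rho> permutes {..<n}. F (shift_perm \<rho> \<circ> to_front p)) =
      (\<Sum>p<k. \<Sum>\<rho> | \<rho> permutes {..<n}. G \<rho>) +
      (\<Sum>p\<in>{k..<Suc n}. \<Sum>\<rho> | \<rho> permutes {..<n}. (- 1) ^ k * H \<rho>)"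
    using n by (subst sum.union_disjoint)
      (auto intro!: arg_cong2[of _ _ _ _ plus] sum.cong simp: FG FH simp del: sum_constant)
  also have "\<dots> = k * sum G {\<rho>. \<rho> permutes {..<n}} + l * ((- 1) ^ k * sum H {\<rho>. \<rho> permutes {..<n}})"
    using n by (simp add: sum_distrib_left flip: n)
  finally have eq: "contract v (wedge k l \<alpha> \<beta>) y =
      (k * sum G {\<rho>. \<rho> permutes {..<n}} + l * ((- 1) ^ k * sum H {\<rho>. \<rho> permutes {..<n}})) / (fact k * fact l)"
    unfolding contract_def wedge_def F_def x_def by simp
  have 1: "k * sum G {\<rho>. \<rho> permutes {..<n}} / (fact k * fact l) =
      (if k = 0 then 0 else wedge (k - 1) l (contract v \<alpha>) \<beta> y)"
  proof (cases k)
    case (Suc k')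
    then have "k' + l = n" using n by simp
    then show ?thesis
      unfolding Suc fact_Suc of_nat_mult mult.assoc
      by (subst mult_divide_mult_cancel_left) (simp_all add: wedge_def G_def Suc)
  qed simp
  have 2: "l * ((- 1) ^ k * sum H {\<rho>. \<rho> permutes {..<n}}) / (fact k * fact l) =
      (if l = 0 then 0 else (- 1) ^ k * wedge k (l - 1) \<alpha> (contract v \<beta>) y)"
  proof (cases l)
    case (Suc l')
    then have "k + l' = n" using n by simp
    then show ?thesis
      unfolding Suc fact_Suc of_nat_mult mult.left_commute[of "fact k"]
      by (subst mult_divide_mult_cancel_left) (simp_all add: wedge_def H_def)
  qed simp
  show "contract v (wedge k l \<alpha> \<beta>) y =
    (if k = 0 then 0 else wedge (k - 1) l (contract v \<alpha>) \<beta> y)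
       + (if l = 0 then 0 else (- 1) ^ k * wedge k (l - 1) \<alpha> (contract v \<beta>) y)"
    unfolding eq add_divide_distrib 1 2 ..
qed

lemma wedge_contract:
  assumes "is_form k \<alpha>" "is_form l \<beta>" "0 < k + l"
  shows "contract v (wedge k l \<alpha> \<beta>) =
    (\<lambda>x. (if k = 0 then 0 else wedge (k - 1) l (contract v \<alpha>) \<beta> x)
       + (if l = 0 then 0 else (- 1) ^ k * wedge k (l - 1) \<alpha> (contract v \<beta>) x))"
  by (rule wedge_contract_weak[OF is_form_cong[OF assms(1)] is_form_insert_at[OF assms(1)]
        is_form_insert_at[OF assms(2)] assms(3)])

section \<open>The wedge product\<close>

lemma wedge_0_0: "wedge 0 0 \<alpha> \<beta> x = \<alpha> x * \<beta> x"
  by (simp add: wedge_def)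

lemma wedge_add_left: "wedge k l (\<lambda>x. \<alpha> x + \<alpha>' x) \<beta> = (\<lambda>x. wedge k l \<alpha> \<beta> x + wedge k l \<alpha>' \<beta> x)"
  by (simp add: wedge_def algebra_simps sum.distrib add_divide_distrib)

lemma wedge_add_right: "wedge k l \<alpha> (\<lambda>x. \<beta> x + \<beta>' x) = (\<lambda>x. wedge k l \<alpha> \<beta> x + wedge k l \<alpha> \<beta>' x)"
  by (simp add: wedge_def algebra_simps sum.distrib add_divide_distrib)

lemma wedge_cmult_left: "wedge k l (\<lambda>x. c * \<alpha> x) \<beta> = (\<lambda>x. c * wedge k l \<alpha> \<beta> x)"
  by (simp add: wedge_def mult.left_commute[of _ c] mult.assoc flip: sum_distrib_left)

lemma wedge_cmult_right: "wedge k l \<alpha> (\<lambda>x. c * \<beta> x) = (\<lambda>x. c * wedge k l \<alpha> \<beta> x)"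
  by (simp add: wedge_def mult.left_commute[of _ c] mult.assoc flip: sum_distrib_left)

lemma wedge_zero_left: "wedge k l (\<lambda>x. 0) \<beta> = (\<lambda>x. 0)"
  by (simp add: wedge_def)

lemma wedge_zero_right: "wedge k l \<alpha> (\<lambda>x. 0) = (\<lambda>x. 0)"
  by (simp add: wedge_def)

lemma wedge_minus_left: "wedge k l (\<lambda>x. - \<alpha> x) \<beta> = (\<lambda>x. - wedge k l \<alpha> \<beta> x)"
  using wedge_cmult_left[of k l "-1" \<alpha> \<beta>] by simp

lemma wedge_minus_right: "wedge k l \<alpha> (\<lambda>x. - \<beta> x) = (\<lambda>x. - wedge k l \<alpha> \<beta> x)"
  using wedge_cmult_right[of k l \<alpha> "-1" \<beta>] by simp

lemma wedge_diff_left: "wedge k l (\<lambda>x. \<alpha> x - \<alpha>' x) \<beta> = (\<lambda>x. wedge k l \<alpha> \<beta> x - wedge k l \<alpha>' \<beta> x)"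
  using wedge_add_left[of k l \<alpha> "\<lambda>x. - \<alpha>' x" \<beta>] by (simp add: wedge_minus_left)

lemma wedge_diff_right: "wedge k l \<alpha> (\<lambda>x. \<beta> x - \<beta>' x) = (\<lambda>x. wedge k l \<alpha> \<beta> x - wedge k l \<alpha> \<beta>' x)"
  using wedge_add_right[of k l \<alpha> \<beta> "\<lambda>x. - \<beta>' x"] by (simp add: wedge_minus_right)

lemma wedge_sum_right: "wedge k l \<alpha> (\<lambda>x. \<Sum>i\<in>I. \<beta> i x) = (\<lambda>x. \<Sum>i\<in>I. wedge k l \<alpha> (\<beta> i) x)"
  by (induction I rule: infinite_finite_induct) (auto simp: wedge_zero_right wedge_add_right)

lemmas wedge_linear_simps = wedge_add_left wedge_add_right wedge_cmult_left wedge_cmult_right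
  wedge_minus_left wedge_minus_right wedge_diff_left wedge_diff_right wedge_zero_left wedge_zero_right

lemma contract_add: "contract v (\<lambda>x. \<alpha> x + \<beta> x) = (\<lambda>x. contract v \<alpha> x + contract v \<beta> x)"
  and contract_cmult: "contract v (\<lambda>x. c * \<alpha> x) = (\<lambda>x. c * contract v \<alpha> x)"
  and contract_diff: "contract v (\<lambda>x. \<alpha> x - \<beta> x) = (\<lambda>x. contract v \<alpha> x - contract v \<beta> x)"
  and contract_minus: "contract v (\<lambda>x. - \<alpha> x) = (\<lambda>x. - contract v \<alpha> x)"
  and contract_zero: "contract v (\<lambda>x. 0) = (\<lambda>x. 0)"
  by (simp_all add: contract_def)

lemmas contract_linear_simps = contract_add contract_cmult contract_diff contract_minus contract_zero

lemma contract_add_vec: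
  "is_form (Suc k) \<alpha> \<Longrightarrow> contract (v + w) \<alpha> = (\<lambda>x. contract v \<alpha> x + contract w \<alpha> x)"
  unfolding contract_def by (auto simp: linear_add[OF is_form_linear_head])

lemma contract_scale_vec:
  "is_form (Suc k) \<alpha> \<Longrightarrow> contract (r *\<^sub>R v) \<alpha> = (\<lambda>x. r * contract v \<alpha> x)"
  unfolding contract_def by (auto simp: linear_cmul[OF is_form_linear_head])

lemma contract_uminus_vec:
  "is_form (Suc k) \<alpha> \<Longrightarrow> contract (- v) \<alpha> = (\<lambda>x. - contract v \<alpha> x)"
  unfolding contract_def by (auto simp: linear_neg[OF is_form_linear_head])

lemma contract_sum_vec:
  "is_form (Suc k) \<alpha> \<Longrightarrow> contract (\<Sum>i\<in>I. v i) \<alpha> = (\<lambda>x. \<Sum>i\<in>I. contract (v i) \<alpha> x)"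
  unfolding contract_def by (auto simp: linear_sum[OF is_form_linear_head])

lemma contract_contract_same: "is_form (Suc (Suc k)) \<alpha> \<Longrightarrow> contract v (contract v \<alpha>) = (\<lambda>x. 0)"
  unfolding contract_def by (auto simp: is_form_alt_head)

lemma contract_swap:
  "is_form (Suc (Suc k)) \<alpha> \<Longrightarrow> contract v (contract w \<alpha>) = (\<lambda>x. - contract w (contract v \<alpha>) x)"
  unfolding contract_def fun_eq_iff using is_form_swap_head by blast

lemma wedge_contract_Suc_Suc:
  assumes "is_form (Suc k) \<alpha>" "is_form (Suc l) \<beta>"
  shows "contract v (wedge (Suc k) (Suc l) \<alpha> \<beta>) =
    (\<lambda>x. wedge k (Suc l) (contract v \<alpha>) \<beta> x - (- 1) ^ k * wedge (Suc k) l \<alpha> (contract v \<beta>) x)"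
  using wedge_contract[OF assms] by simp

lemma wedge_contract_Suc_0:
  assumes "is_form (Suc k) \<alpha>" "is_form 0 \<beta>"
  shows "contract v (wedge (Suc k) 0 \<alpha> \<beta>) = wedge k 0 (contract v \<alpha>) \<beta>"
  using wedge_contract[OF assms] by simp

lemma wedge_contract_0_Suc:
  assumes "is_form 0 \<alpha>" "is_form (Suc l) \<beta>"
  shows "contract v (wedge 0 (Suc l) \<alpha> \<beta>) = wedge 0 l \<alpha> (contract v \<beta>)"
  using wedge_contract[OF assms] by simp

lemma is_form_wedge_0_0: "is_form 0 \<alpha> \<Longrightarrow> is_form 0 \<beta> \<Longrightarrow> is_form 0 (wedge 0 0 \<alpha> \<beta>)"
  unfolding is_form_0_iff wedge_0_0 by metis

text \<open>Induction on the total degree: contractions are forms by the antiderivation rule, and in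
  a double contraction with the same vector the two mixed terms cancel.\<close>

lemma is_form_wedge_aux:
  "k + l = n \<Longrightarrow> is_form k \<alpha> \<Longrightarrow> is_form l \<beta> \<Longrightarrow> is_form n (wedge k l \<alpha> \<beta>)"
proof (induction n arbitrary: k l \<alpha> \<beta>)
  case 0
  then show ?case by (simp add: is_form_wedge_0_0)
next
  case (Suc n)
  note IH = Suc.IH and prems = Suc.prems
  have c: "contract v (wedge k l \<alpha> \<beta>) =
    (\<lambda>x. (if k = 0 then 0 else wedge (k - 1) l (contract v \<alpha>) \<beta> x)
       + (if l = 0 then 0 else (- 1) ^ k * wedge k (l - 1) \<alpha> (contract v \<beta>) x))" for v
    using prems by (intro wedge_contract) auto
  have ca: "is_form (k - 1) (contract v \<alpha>)" if "k \<noteq> 0" for v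
    using that prems is_form_contract[of "k - 1"] by auto
  have cb: "is_form (l - 1) (contract v \<beta>)" if "l \<noteq> 0" for v
    using that prems is_form_contract[of "l - 1"] by auto
  show ?case
  proof (rule is_form_SucI)
    fix v
    show "is_form n (contract v (wedge k l \<alpha> \<beta>))"
      unfolding c using prems
      by (cases "k = 0"; cases "l = 0") (auto intro!: is_form_add is_form_cmult IH ca[unfolded One_nat_def] cb[unfolded One_nat_def]
          is_form_contract)
  next
    fix x :: "nat \<Rightarrow> 'a"
    have "linear (\<lambda>v. contract v (wedge k l \<alpha> \<beta>) x)"
    proof (rule linearI)
      fix v w :: 'a and r :: real
      have a: "contract (v + w) \<alpha> = (\<lambda>x. contract v \<alpha> x + contract w \<alpha> x)"
        "contract (r *\<^sub>R v) \<alpha> = (\<lambda>x. r * contract v \<alpha> x)" if "k \<noteq> 0"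
        using that prems contract_add_vec[of "k - 1" \<alpha>] contract_scale_vec[of "k - 1" \<alpha>] by auto
      have b: "contract (v + w) \<beta> = (\<lambda>x. contract v \<beta> x + contract w \<beta> x)"
        "contract (r *\<^sub>R v) \<beta> = (\<lambda>x. r * contract v \<beta> x)" if "l \<noteq> 0"
        using that prems contract_add_vec[of "l - 1" \<beta>] contract_scale_vec[of "l - 1" \<beta>] by auto
      show "contract (v + w) (wedge k l \<alpha> \<beta>) x =
          contract v (wedge k l \<alpha> \<beta>) x + contract w (wedge k l \<alpha> \<beta>) x"
        by (simp add: c a b wedge_linear_simps algebra_simps)
      show "contract (r *\<^sub>R v) (wedge k l \<alpha> \<beta>) x = r *\<^sub>R contract v (wedge k l \<alpha> \<beta>) x"
        by (simp add: c a b wedge_linear_simps algebra_simps)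
    qed
    then show "linear (\<lambda>v. wedge k l \<alpha> \<beta> (case_nat v x))"
      by (simp add: contract_case_nat)
  next
    fix v and x :: "nat \<Rightarrow> 'a"
    assume "0 < n"
    have "contract v (contract v (wedge k l \<alpha> \<beta>)) = (\<lambda>x. 0)"
    proof (cases k)
      case 0
      then obtain l' where l: "l = Suc (Suc l')"
        using \<open>0 < n\<close> prems(1) by (metis add_0 Suc_inject not0_implies_Suc less_numeral_extra(3))
      have fa: "is_form 0 \<alpha>" and fb: "is_form (Suc (Suc l')) \<beta>"
        using prems 0 l by auto
      show ?thesis
        unfolding 0 l wedge_contract_0_Suc[OF fa fb] wedge_contract_0_Suc[OF fa is_form_contract[OF fb]]
          contract_contract_same[OF fb] wedge_zero_right ..
    next
      case (Suc k')
      note k = this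
      show ?thesis
      proof (cases l)
        case 0
        then obtain k'' where k': "k' = Suc k''"
          using \<open>0 < n\<close> prems(1) k by (metis add_0_right Suc_inject not0_implies_Suc less_numeral_extra(3))
        have fa: "is_form (Suc (Suc k'')) \<alpha>" and fb: "is_form 0 \<beta>"
          using prems 0 k k' by auto
        show ?thesis
          unfolding 0 k k' wedge_contract_Suc_0[OF fa fb] wedge_contract_Suc_0[OF is_form_contract[OF fa] fb]
            contract_contract_same[OF fa] wedge_zero_left ..
      next
        case (Suc l')
        have "wedge (k' - Suc 0) (Suc l') (contract v (contract v \<alpha>)) \<beta> = (\<lambda>x. 0)" if "k' \<noteq> 0"
          using that prems k contract_contract_same[of "k' - 1" \<alpha> v] by (simp add: wedge_zero_left)
        moreover have "wedge (Suc k') (l' - Suc 0) \<alpha> (contract v (contract v \<beta>)) = (\<lambda>x. 0)" if "l' \<noteq> 0"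
          using that prems Suc contract_contract_same[of "l' - 1" \<beta> v] by (simp add: wedge_zero_right)
        ultimately show ?thesis
          using prems k Suc
          by (auto simp: fun_eq_iff wedge_contract_Suc_Suc contract_linear_simps wedge_contract is_form_contract
              algebra_simps)
      qed
    qed
    then show "wedge k l \<alpha> \<beta> (case_nat v (case_nat v x)) = 0"
      by (metis contract_case_nat)
  qed
qed

lemma is_form_wedge: "is_form k \<alpha> \<Longrightarrow> is_form l \<beta> \<Longrightarrow> is_form (k + l) (wedge k l \<alpha> \<beta>)"
  by (rule is_form_wedge_aux) auto

text \<open>Both sides have the same contractions: each term of the antiderivation rule is an
  instance in lower total degree, with matching signs.\<close>

lemma wedge_commute_aux:
  "k + l = n \<Longrightarrow> is_form k \<alpha> \<Longrightarrow> is_form l \<beta> \<Longrightarrow>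
    wedge k l \<alpha> \<beta> = (\<lambda>x. (- 1) ^ (k * l) * wedge l k \<beta> \<alpha> x)"
proof (induction n arbitrary: k l \<alpha> \<beta>)
  case 0
  then show ?case by (simp add: fun_eq_iff wedge_0_0)
next
  case (Suc n)
  show ?case
  proof (rule form_eq_contractI)
    fix v
    have a: "wedge (k - 1) l (contract v \<alpha>) \<beta> = (\<lambda>x. (- 1) ^ ((k - 1) * l) * wedge l (k - 1) \<beta> (contract v \<alpha>) x)"
      if "k \<noteq> 0"
      using that Suc.prems is_form_contract[of "k - 1" \<alpha> v] by (intro Suc.IH) auto
    have b: "wedge k (l - 1) \<alpha> (contract v \<beta>) = (\<lambda>x. (- 1) ^ (k * (l - 1)) * wedge (l - 1) k (contract v \<beta>) \<alpha> x)"
      if "l \<noteq> 0"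
      using that Suc.prems is_form_contract[of "l - 1" \<beta> v] by (intro Suc.IH) auto
    have s1: "(- 1 :: real) ^ (k * l) * (- 1) ^ l = (- 1) ^ ((k - 1) * l)" if "k \<noteq> 0"
      using that by (cases k) (auto simp: minus_one_power_iff)
    have s2: "(- 1 :: real) ^ k * (- 1) ^ (k * (l - 1)) = (- 1) ^ (k * l)" if "l \<noteq> 0"
      using that by (cases l) (auto simp: power_add)
    have b0: "wedge 0 n \<gamma> \<delta> = wedge n 0 \<delta> \<gamma>" if "is_form 0 \<gamma>" "is_form n \<delta>" for \<gamma> \<delta> :: "'a form"
      using that Suc.IH[of 0 n \<gamma> \<delta>] by simp
    show "contract v (wedge k l \<alpha> \<beta>) = contract v (\<lambda>x. (- 1) ^ (k * l) * wedge l k \<beta> \<alpha> x)"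
      unfolding contract_cmult using Suc.prems
      by (cases "k = 0"; cases "l = 0")
        (auto simp: fun_eq_iff wedge_contract a[unfolded One_nat_def] b[unfolded One_nat_def]
          s1[symmetric, unfolded One_nat_def] s2[symmetric, unfolded One_nat_def] mult.assoc mult.left_commute
          distrib_left b0 is_form_contract)
  qed
qed

lemma wedge_commute:
  "is_form k \<alpha> \<Longrightarrow> is_form l \<beta> \<Longrightarrow> wedge k l \<alpha> \<beta> = (\<lambda>x. (- 1) ^ (k * l) * wedge l k \<beta> \<alpha> x)"
  by (rule wedge_commute_aux) auto

text \<open>Both bracketings obey the same antiderivation rule in three factors, so the induction on
  the total degree needs no comparison of permutations.\<close>

lemma wedge_assoc_aux:
  "k + l + m = n \<Longrightarrow> is_form k \<alpha> \<Longrightarrow> is_form l \<beta> \<Longrightarrow> is_form m \<gamma> \<Longrightarrow>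
    wedge (k + l) m (wedge k l \<alpha> \<beta>) \<gamma> = wedge k (l + m) \<alpha> (wedge l m \<beta> \<gamma>)"
proof (induction n arbitrary: k l m \<alpha> \<beta> \<gamma>)
  case 0
  then show ?case by (simp add: fun_eq_iff wedge_0_0)
next
  case (Suc n)
  have ab: "is_form (k + l) (wedge k l \<alpha> \<beta>)" and bc: "is_form (l + m) (wedge l m \<beta> \<gamma>)"
    using Suc.prems by (auto intro: is_form_wedge)
  show ?case
  proof (rule form_eq_contractI)
    fix v
    have a: "wedge (k - 1 + l) m (wedge (k - 1) l (contract v \<alpha>) \<beta>) \<gamma> = wedge (k - 1) (l + m) (contract v \<alpha>) (wedge l m \<beta> \<gamma>)"
      if "k \<noteq> 0"
      using that Suc.prems is_form_contract[of "k - 1" \<alpha> v] by (intro Suc.IH) auto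
    have b: "wedge (k + (l - 1)) m (wedge k (l - 1) \<alpha> (contract v \<beta>)) \<gamma> = wedge k (l - 1 + m) \<alpha> (wedge (l - 1) m (contract v \<beta>) \<gamma>)"
      if "l \<noteq> 0"
      using that Suc.prems is_form_contract[of "l - 1" \<beta> v] by (intro Suc.IH) auto
    have c: "wedge (k + l) (m - 1) (wedge k l \<alpha> \<beta>) (contract v \<gamma>) = wedge k (l + (m - 1)) \<alpha> (wedge l (m - 1) \<beta> (contract v \<gamma>))"
      if "m \<noteq> 0"
      using that Suc.prems is_form_contract[of "m - 1" \<gamma> v] by (intro Suc.IH) auto
    show "contract v (wedge (k + l) m (wedge k l \<alpha> \<beta>) \<gamma>) = contract v (wedge k (l + m) \<alpha> (wedge l m \<beta> \<gamma>))"
      unfolding wedge_contract[OF ab Suc.prems(4), unfolded Suc.prems(1), OF zero_less_Suc]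
        wedge_contract[OF Suc.prems(2) bc, unfolded add.assoc[symmetric] Suc.prems(1), OF zero_less_Suc]
    proof (cases "k = 0"; cases "l = 0"; cases "m = 0")
    qed (use Suc.prems a b c in \<open>auto simp: wedge_contract wedge_linear_simps power_add algebra_simps\<close>)
  qed
qed

lemma wedge_assoc:
  "is_form k \<alpha> \<Longrightarrow> is_form l \<beta> \<Longrightarrow> is_form m \<gamma> \<Longrightarrow>
    wedge (k + l) m (wedge k l \<alpha> \<beta>) \<gamma> = wedge k (l + m) \<alpha> (wedge l m \<beta> \<gamma>)"
  by (rule wedge_assoc_aux) auto

section \<open>The Chevalley--Eilenberg differential\<close>

lemma der_action_0: "der_action A 0 \<alpha> = (\<lambda>x. 0)"
  by (simp add: der_action_def)

lemma contract_der_action: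
  "contract v (der_action A (Suc k) \<alpha>) = (\<lambda>x. der_action A k (contract v \<alpha>) x + contract (A v) \<alpha> x)"
proof
  fix x
  have 1: "(case_nat v x)(0 := w) = case_nat w x" "(case_nat v x)(Suc i := w) = case_nat v (x(i := w))" for w i
    by (auto simp: fun_eq_iff split: nat.split)
  show "contract v (der_action A (Suc k) \<alpha>) x = der_action A k (contract v \<alpha>) x + contract (A v) \<alpha> x"
    unfolding contract_def der_action_def sum.lessThan_Suc_shift by (simp add: 1)
qed

lemma der_action_add: "der_action A k (\<lambda>x. \<alpha> x + \<beta> x) = (\<lambda>x. der_action A k \<alpha> x + der_action A k \<beta> x)"
  and der_action_cmult: "der_action A k (\<lambda>x. c * \<alpha> x) = (\<lambda>x. c * der_action A k \<alpha> x)"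
  and der_action_zero: "der_action A k (\<lambda>x. 0) = (\<lambda>x. 0)"
  by (simp_all add: der_action_def sum.distrib sum_distrib_left)

lemma is_form_der_action:
  assumes A: "linear A"
  shows "is_form k \<alpha> \<Longrightarrow> is_form k (der_action A k \<alpha>)"
proof (induction k arbitrary: \<alpha>)
  case 0
  then show ?case by (simp add: der_action_0 is_form_zero)
next
  case (Suc k)
  show ?case
  proof (rule is_form_SucI)
    show "is_form k (contract v (der_action A (Suc k) \<alpha>))" for v
      unfolding contract_der_action by (intro is_form_add Suc.IH is_form_contract Suc.prems)
    show "linear (\<lambda>v. der_action A (Suc k) \<alpha> (case_nat v x))" for x
      unfolding contract_case_nat[symmetric]
      by (rule linearI)
        (simp_all add: contract_der_action contract_add_vec[OF Suc.prems] contract_scale_vec[OF Suc.prems]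
          der_action_add der_action_cmult linear_add[OF A] linear_cmul[OF A] distrib_left)
    show "der_action A (Suc k) \<alpha> (case_nat v (case_nat v x)) = 0" if pos: "0 < k" for v x
    proof -
      obtain k' where k: "k = Suc k'" using pos gr0_implies_Suc by blast
      have f: "is_form (Suc (Suc k')) \<alpha>" using Suc.prems k by simp
      have "contract v (contract v (der_action A (Suc k) \<alpha>)) = (\<lambda>x. 0)"
        unfolding k contract_der_action contract_add contract_swap[OF f, of v "A v"]
          contract_contract_same[OF f] der_action_zero
        by simp
      then show ?thesis by (simp add: contract_def fun_eq_iff)
    qed
  qed
qed

lemma der_action_wedge:
  assumes A: "linear A"
  shows "k + l = n \<Longrightarrow> is_form k \<alpha> \<Longrightarrow> is_form l \<beta> \<Longrightarrow>
    der_action A n (wedge k l \<alpha> \<beta>) =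
      (\<lambda>x. wedge k l (der_action A k \<alpha>) \<beta> x + wedge k l \<alpha> (der_action A l \<beta>) x)"
proof (induction n arbitrary: k l \<alpha> \<beta>)
  case 0
  then show ?case by (simp add: der_action_0 wedge_linear_simps)
next
  case (Suc n)
  have dA: "is_form k (der_action A k \<alpha>)" "is_form l (der_action A l \<beta>)"
    using Suc.prems is_form_der_action[OF A] by auto
  show ?case
  proof (rule form_eq_contractI)
    fix v
    have a: "der_action A n (wedge (k - 1) l (contract v \<alpha>) \<beta>) =
      (\<lambda>x. wedge (k - 1) l (der_action A (k - 1) (contract v \<alpha>)) \<beta> x + wedge (k - 1) l (contract v \<alpha>) (der_action A l \<beta>) x)"
      if "k \<noteq> 0"
      using that Suc.prems is_form_contract[of "k - 1" \<alpha> v] by (intro Suc.IH) auto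
    have b: "der_action A n (wedge k (l - 1) \<alpha> (contract v \<beta>)) =
      (\<lambda>x. wedge k (l - 1) (der_action A k \<alpha>) (contract v \<beta>) x + wedge k (l - 1) \<alpha> (der_action A (l - 1) (contract v \<beta>)) x)"
      if "l \<noteq> 0"
      using that Suc.prems is_form_contract[of "l - 1" \<beta> v] by (intro Suc.IH) auto
    have ca: "contract v (der_action A k \<alpha>) = (\<lambda>x. der_action A (k - 1) (contract v \<alpha>) x + contract (A v) \<alpha> x)" if "k \<noteq> 0"
      using that contract_der_action[of v A "k - 1" \<alpha>] by simp
    have cb: "contract v (der_action A l \<beta>) = (\<lambda>x. der_action A (l - 1) (contract v \<beta>) x + contract (A v) \<beta> x)" if "l \<noteq> 0"
      using that contract_der_action[of v A "l - 1" \<beta>] by simp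
    have pos: "0 < k + l" using Suc.prems by simp
    show "contract v (der_action A (Suc n) (wedge k l \<alpha> \<beta>)) =
        contract v (\<lambda>x. wedge k l (der_action A k \<alpha>) \<beta> x + wedge k l \<alpha> (der_action A l \<beta>) x)"
      unfolding contract_der_action contract_add wedge_contract[OF Suc.prems(2,3) pos]
        wedge_contract[OF dA(1) Suc.prems(3) pos] wedge_contract[OF Suc.prems(2) dA(2) pos]
      using a b ca cb
      by (cases "k = 0"; cases "l = 0")
        (simp_all add: der_action_add der_action_cmult der_action_zero der_action_0
          wedge_linear_simps algebra_simps)
  qed
qed

text \<open>The part of \<open>lie_algebra\<close> under which \<open>ce_d\<close> maps forms to
  forms and is an antiderivation.\<close>

definition alternating_bilinear :: "('v::real_vector \<Rightarrow> 'v \<Rightarrow> 'v) \<Rightarrow> bool" where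
  "alternating_bilinear br \<longleftrightarrow>
     (\<forall>x. linear (br x)) \<and> (\<forall>y. linear (\<lambda>x. br x y)) \<and> (\<forall>x. br x x = 0)"

lemma ce_d_0: "ce_d br 0 \<alpha> = (\<lambda>x. 0)"
  by (simp add: ce_d_def)

lemma ce_d_add: "ce_d br k (\<lambda>x. \<alpha> x + \<beta> x) = (\<lambda>x. ce_d br k \<alpha> x + ce_d br k \<beta> x)"
  and ce_d_cmult: "ce_d br k (\<lambda>x. c * \<alpha> x) = (\<lambda>x. c * ce_d br k \<alpha> x)"
  and ce_d_zero: "ce_d br k (\<lambda>x. 0) = (\<lambda>x. 0)"
  by (simp_all add: ce_d_def distrib_left sum.distrib sum_distrib_left mult.left_commute)

lemma skip2_Suc_Suc: "skip2 (Suc i) (Suc j) = case_nat 0 (\<lambda>m. Suc (skip2 i j m))"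
  by (auto simp: skip2_def fun_eq_iff split: nat.split)

text \<open>Cartan's formula, with minus the derivation action of ad_v as Lie derivative; it is used
  as a recursion for \<open>ce_d\<close>. The summands with i = 0 contain [v, x_j] and give the
  derivation action. In the others v stands second and is moved past the bracket to the head, which
  costs a sign.\<close>

lemma cartan_formula:
  assumes "is_form k \<alpha>"
  shows "contract v (ce_d br k \<alpha>) =
    (\<lambda>x. - der_action (br v) k \<alpha> x - ce_d br (k - 1) (contract v \<alpha>) x)"
proof (cases k)
  case 0
  then show ?thesis by (simp add: ce_d_0 der_action_0 contract_zero)
next
  case (Suc k')
  show ?thesis
  proof
    fix x
    define y where "y = case_nat v x"
    define T where "T i j = (- 1) ^ (i + j) * \<alpha> (case_nat (br (y i) (y j)) (\<lambda>m. y (skip2 i j m)))" for i j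
    have T0: "T 0 (Suc j) = - \<alpha> (x(j := br v (x j)))" if "j < k" for j
    proof -
      define w where "w = (\<lambda>m. x (if m < j then m else Suc m))"
      have "(\<lambda>m. y (skip2 0 (Suc j) m)) = w"
        by (auto simp: y_def w_def skip2_def fun_eq_iff)
      moreover have "x(j := br v (x j)) = insert_at j (br v (x j)) w"
        by (auto simp: insert_at_def w_def fun_eq_iff)
      ultimately show ?thesis
        using is_form_insert_at[OF assms that, of "br v (x j)" w]
        by (simp add: T_def y_def minus_one_power_iff)
    qed
    have TS: "T (Suc i) (Suc j) =
        - ((- 1) ^ (i + j) * contract v \<alpha> (case_nat (br (x i) (x j)) (\<lambda>m. x (skip2 i j m))))" if ij: "i < j" "j < k" for i j
    proof -
      obtain k'' where k: "k = Suc (Suc k'')"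
        using ij less_imp_Suc_add[of 0 "k - 1"] Suc by auto
      have "(\<lambda>m. y (skip2 (Suc i) (Suc j) m)) = case_nat v (\<lambda>m. x (skip2 i j m))"
        by (auto simp: y_def skip2_Suc_Suc fun_eq_iff split: nat.split)
      then have "T (Suc i) (Suc j) = (- 1) ^ (i + j) * \<alpha> (case_nat (br (x i) (x j)) (case_nat v (\<lambda>m. x (skip2 i j m))))"
        by (simp add: T_def y_def)
      also have "\<alpha> (case_nat (br (x i) (x j)) (case_nat v (\<lambda>m. x (skip2 i j m)))) =
          - contract v \<alpha> (case_nat (br (x i) (x j)) (\<lambda>m. x (skip2 i j m)))"
        unfolding contract_case_nat by (rule is_form_swap_head[OF assms[unfolded k]])
      finally show ?thesis by simp
    qed
    have "contract v (ce_d br k \<alpha>) x = (\<Sum>j<Suc k. \<Sum>i<j. T i j)"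
      by (simp add: contract_def ce_d_def T_def y_def lessThan_Suc_atMost)
    also have "\<dots> = (\<Sum>j<k. \<Sum>i<Suc j. T i (Suc j))"
      by (subst sum.lessThan_Suc_shift) simp
    also have "\<dots> = (\<Sum>j<k. T 0 (Suc j) + (\<Sum>i<j. T (Suc i) (Suc j)))"
      by (intro sum.cong refl) (simp add: sum.lessThan_Suc_shift del: sum.lessThan_Suc)
    also have "\<dots> = (\<Sum>j<k. - \<alpha> (x(j := br v (x j)))) + (\<Sum>j<k. \<Sum>i<j. T (Suc i) (Suc j))"
      unfolding sum.distrib by (simp add: T0)
    also have "(\<Sum>j<k. \<Sum>i<j. T (Suc i) (Suc j)) = - ce_d br (k - 1) (contract v \<alpha>) x"
      by (simp add: TS ce_d_def sum_negf Suc lessThan_Suc_atMost)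
    finally show "contract v (ce_d br k \<alpha>) x = - der_action (br v) k \<alpha> x - ce_d br (k - 1) (contract v \<alpha>) x"
      by (simp only: der_action_def sum_negf diff_conv_add_uminus)
  qed
qed

lemma is_form_ce_d:
  assumes br: "alternating_bilinear br"
  shows "is_form k \<alpha> \<Longrightarrow> is_form (Suc k) (ce_d br k \<alpha>)"
proof (induction k arbitrary: \<alpha>)
  case 0
  then show ?case by (simp add: ce_d_0 is_form_zero)
next
  case (Suc k)
  note c = cartan_formula[OF Suc.prems, of _ br, simplified]
  have lin: "linear (br v)" "linear (\<lambda>v. br v w)" "br v v = 0" for v w
    using br by (auto simp: alternating_bilinear_def)
  show ?case
  proof (rule is_form_SucI)
    show "is_form (Suc k) (contract v (ce_d br (Suc k) \<alpha>))" for v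
      unfolding c by (intro is_form_diff is_form_uminus is_form_der_action lin Suc.IH is_form_contract Suc.prems)
    show "linear (\<lambda>v. ce_d br (Suc k) \<alpha> (case_nat v x))" for x
    proof -
      have "linear (\<lambda>v. \<alpha> (x(i := br v (x i))))" if "i < Suc k" for i
        by (rule linear_compose[OF lin(2)[of "x i"] is_form_linear[OF Suc.prems that, of x], unfolded comp_def])
      then have "linear (\<lambda>v. der_action (br v) (Suc k) \<alpha> x)"
        unfolding der_action_def by (intro linear_compose_sum) auto
      moreover have "linear (\<lambda>v. ce_d br k (contract v \<alpha>) x)"
        by (rule linearI) (simp_all add: contract_add_vec[OF Suc.prems] contract_scale_vec[OF Suc.prems]
            ce_d_add ce_d_cmult)
      ultimately show ?thesis
        unfolding contract_case_nat[symmetric] c by (intro linear_compose_sub linear_compose_neg)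
    qed
    show "ce_d br (Suc k) \<alpha> (case_nat v (case_nat v x)) = 0" for v x
    proof -
      have 1: "contract (0::'a) \<alpha> = (\<lambda>x. 0)"
        using contract_scale_vec[OF Suc.prems, of 0] by simp
      have "contract v (contract v (ce_d br (Suc k) \<alpha>)) = (\<lambda>x. 0)"
        unfolding c contract_diff contract_minus contract_der_action lin(3) 1
      proof (cases k)
        case 0
        then show "(\<lambda>x. - (der_action (br v) k (contract v \<alpha>) x + 0) - contract v (ce_d br k (contract v \<alpha>)) x) = (\<lambda>x. 0)"
          by (simp add: ce_d_0 der_action_0 contract_zero)
      next
        case (Suc k')
        have "is_form (Suc k') (contract v \<alpha>)" "is_form (Suc (Suc k')) \<alpha>"
          using Suc Suc.prems is_form_contract by blast+
        then show "(\<lambda>x. - (der_action (br v) k (contract v \<alpha>) x + 0) - contract v (ce_d br k (contract v \<alpha>)) x) = (\<lambda>x. 0)"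
          unfolding Suc by (simp add: cartan_formula contract_contract_same ce_d_zero)
      qed
      then show ?thesis by (simp add: contract_def fun_eq_iff)
    qed
  qed
qed

text \<open>After contraction, Cartan's formula splits the claim into the Leibniz rule for the
  derivation action of ad_v and instances for the contracted factors.\<close>

lemma ce_d_wedge_aux:
  assumes br: "alternating_bilinear br"
  shows "k + l = n \<Longrightarrow> is_form k \<alpha> \<Longrightarrow> is_form l \<beta> \<Longrightarrow>
    ce_d br n (wedge k l \<alpha> \<beta>) =
      (\<lambda>x. wedge (Suc k) l (ce_d br k \<alpha>) \<beta> x + (- 1) ^ k * wedge k (Suc l) \<alpha> (ce_d br l \<beta>) x)"
proof (induction n arbitrary: k l \<alpha> \<beta>)
  case 0
  then show ?case by (simp add: ce_d_0 wedge_linear_simps)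
next
  case (Suc n)
  have dA: "is_form (Suc k) (ce_d br k \<alpha>)" "is_form (Suc l) (ce_d br l \<beta>)"
    using Suc.prems is_form_ce_d[OF br] by auto
  have lin: "linear (br v)" for v
    using br by (auto simp: alternating_bilinear_def)
  have w: "is_form (Suc n) (wedge k l \<alpha> \<beta>)"
    using Suc.prems is_form_wedge_aux by blast
  show ?case
  proof (rule form_eq_contractI)
    fix v
    have a: "ce_d br n (wedge (k - 1) l (contract v \<alpha>) \<beta>) =
      (\<lambda>x. wedge k l (ce_d br (k - 1) (contract v \<alpha>)) \<beta> x - (- 1) ^ k * wedge (k - 1) (Suc l) (contract v \<alpha>) (ce_d br l \<beta>) x)"
      if "k \<noteq> 0"
    proof -
      have "is_form (k - 1) (contract v \<alpha>)" "k - 1 + l = n"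
        using that Suc.prems is_form_contract[of "k - 1" \<alpha> v] by auto
      from Suc.IH[OF this(2,1) Suc.prems(3)] show ?thesis
        using that by (cases k) auto
    qed
    have b: "ce_d br n (wedge k (l - 1) \<alpha> (contract v \<beta>)) =
      (\<lambda>x. wedge (Suc k) (l - 1) (ce_d br k \<alpha>) (contract v \<beta>) x + (- 1) ^ k * wedge k l \<alpha> (ce_d br (l - 1) (contract v \<beta>)) x)"
      if "l \<noteq> 0"
    proof -
      have "is_form (l - 1) (contract v \<beta>)" "k + (l - 1) = n"
        using that Suc.prems is_form_contract[of "l - 1" \<beta> v] by auto
      from Suc.IH[OF this(2) Suc.prems(2) this(1)] show ?thesis
        using that by (cases l) auto
    qed
    have pos: "0 < k + l" "0 < Suc k + l" "0 < k + Suc l" using Suc.prems by auto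
    show "contract v (ce_d br (Suc n) (wedge k l \<alpha> \<beta>)) =
        contract v (\<lambda>x. wedge (Suc k) l (ce_d br k \<alpha>) \<beta> x + (- 1) ^ k * wedge k (Suc l) \<alpha> (ce_d br l \<beta>) x)"
      unfolding cartan_formula[OF w] contract_add contract_cmult wedge_contract[OF Suc.prems(2,3) pos(1)]
        der_action_wedge[OF lin Suc.prems]
        wedge_contract[OF dA(1) Suc.prems(3) pos(2)] wedge_contract[OF Suc.prems(2) dA(2) pos(3)]
      using a b
      by (cases "k = 0"; cases "l = 0")
        (simp_all add: contract_zero
          cartan_formula[OF Suc.prems(2)] cartan_formula[OF Suc.prems(3)] ce_d_add ce_d_cmult ce_d_zero ce_d_0
          wedge_linear_simps der_action_0 algebra_simps flip: power_mult_distrib mult.assoc)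
  qed
qed

lemma ce_d_wedge:
  "alternating_bilinear br \<Longrightarrow> is_form k \<alpha> \<Longrightarrow> is_form l \<beta> \<Longrightarrow>
    ce_d br (k + l) (wedge k l \<alpha> \<beta>) =
      (\<lambda>x. wedge (Suc k) l (ce_d br k \<alpha>) \<beta> x + (- 1) ^ k * wedge k (Suc l) \<alpha> (ce_d br l \<beta>) x)"
  by (rule ce_d_wedge_aux) auto

section \<open>Bases, traces and top forms\<close>

definition dual_bases :: "nat \<Rightarrow> (nat \<Rightarrow> 'v::real_vector) \<Rightarrow> (nat \<Rightarrow> 'v \<Rightarrow> real) \<Rightarrow> bool" where
  "dual_bases n b c \<longleftrightarrow> (\<forall>i<n. linear (c i)) \<and> (\<forall>i<n. \<forall>j<n. c i (b j) = of_bool (i = j)) \<and>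
     (\<forall>x. x = (\<Sum>i<n. c i x *\<^sub>R b i))"

lemma dual_bases_linear: "dual_bases n b c \<Longrightarrow> i < n \<Longrightarrow> linear (c i)"
  and dual_bases_eval: "dual_bases n b c \<Longrightarrow> i < n \<Longrightarrow> j < n \<Longrightarrow> c i (b j) = of_bool (i = j)"
  and dual_bases_expand: "dual_bases n b c \<Longrightarrow> x = (\<Sum>i<n. c i x *\<^sub>R b i)"
  unfolding dual_bases_def by blast+

lemma exists_dual_bases:
  assumes dim: "dim (UNIV :: 'v::real_vector set) = n" and pos: "0 < n"
  obtains b :: "nat \<Rightarrow> 'v::real_vector" and c where "dual_bases n b c"
proof -
  obtain B :: "'v set" where B: "independent B" "UNIV \<subseteq> span B" "card B = n"
    using basis_exists[of "UNIV :: 'v set"] dim by auto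
  have spB: "x \<in> span B" for x
    using B(2) by auto
  have "finite B"
    using B(3) pos card_ge_0_finite by blast
  then obtain b where b: "bij_betw b {..<n} B"
    using B(3) ex_bij_betw_nat_finite lessThan_atLeast0 by metis
  define c where "c i x = representation B x (b i)" for i x
  have "dual_bases n b c"
    unfolding dual_bases_def
  proof (intro conjI allI impI)
    show "linear (c i)" for i
      unfolding c_def using B(1) spB by (intro linearI) (auto simp: representation_add representation_scale)
    show "c i (b j) = of_bool (i = j)" if "i < n" "j < n" for i j
    proof -
      have "b j \<in> B" "b i = b j \<longleftrightarrow> i = j"
        using b that unfolding bij_betw_def inj_on_def by auto
      then show ?thesis
        unfolding c_def using B by (auto simp: representation_basis)
    qed
    show "x = (\<Sum>i<n. c i x *\<^sub>R b i)" for x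
      unfolding c_def sum.reindex_bij_betw[OF b, of "\<lambda>v. representation B x v *\<^sub>R v"]
      using sum_representation_eq[OF B(1) spB \<open>finite B\<close> order_refl, of x] by simp
  qed
  then show thesis by (rule that)
qed

lemma biorthogonal_independent:
  fixes b :: "nat \<Rightarrow> 'v::real_vector"
  assumes lin: "\<And>i. i < n \<Longrightarrow> linear (c i)" and c: "\<And>i j. i < n \<Longrightarrow> j < n \<Longrightarrow> c i (b j) = (of_bool (i = j) :: real)"
  shows "independent (b ` {..<n})" "inj_on b {..<n}"
proof -
  show inj: "inj_on b {..<n}"
  proof (rule inj_onI)
    fix i j assume "i \<in> {..<n}" "j \<in> {..<n}" "b i = b j"
    then show "i = j"
      using c[of i i] c[of i j] by (auto split: if_splits)
  qed
  show "independent (b ` {..<n})"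
  proof (rule independent_if_scalars_zero)
    fix f v
    assume 0: "(\<Sum>x\<in>b ` {..<n}. f x *\<^sub>R x) = 0" and "v \<in> b ` {..<n}"
    then obtain j where j: "j < n" "v = b j" by auto
    have "0 = c j (\<Sum>i<n. f (b i) *\<^sub>R b i)"
      using 0 linear_0[OF lin[OF j(1)]] by (simp add: sum.reindex[OF inj])
    also have "\<dots> = (\<Sum>i<n. f (b i) * c j (b i))"
      using lin[OF j(1)] by (simp add: linear_sum linear_cmul)
    also have "\<dots> = (\<Sum>i<n. if i = j then f (b i) else 0)"
      using j(1) by (intro sum.cong) (auto simp: c)
    also have "\<dots> = f (b j)"
      using j(1) by simp
    finally show "f v = 0" using j by simp
  qed simp
qed

lemma dual_bases_independent:
  fixes b :: "nat \<Rightarrow> 'v::real_vector"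
  assumes "dual_bases n b c"
  shows "independent (b ` {..<n})" "inj_on b {..<n}" "span (b ` {..<n}) = UNIV"
    "dim (UNIV :: 'v set) = n"
proof -
  show ind: "independent (b ` {..<n})" and inj: "inj_on b {..<n}"
    using biorthogonal_independent[of n c b] dual_bases_linear[OF assms] dual_bases_eval[OF assms] by auto
  show span: "span (b ` {..<n}) = UNIV"
  proof -
    have "x \<in> span (b ` {..<n})" for x
      by (subst dual_bases_expand[OF assms, of x]) (intro span_sum span_scale span_base, auto)
    then show ?thesis by auto
  qed
  show "dim (UNIV :: 'v set) = n"
    using dim_span_eq_card_independent[OF ind] card_image[OF inj] span by simp
qed

text \<open>The definition of \<open>lin_trace\<close> picks some basis. The choice does not matter:
  expand \<open>b i\<close> in the chosen basis and exchange the two sums.\<close>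

lemma lin_trace_dual_bases:
  fixes f :: "'v::real_vector \<Rightarrow> 'v"
  assumes db: "dual_bases n b c" and f: "linear f"
  shows "lin_trace f = (\<Sum>i<n. c i (f (b i)))"
proof -
  define B where "B = (SOME B. independent B \<and> span B = (UNIV :: 'v set))"
  have "\<exists>B. independent B \<and> span B = (UNIV :: 'v set)"
    using dual_bases_independent[OF db] by blast
  then have B: "independent B" "span B = UNIV"
    unfolding B_def by (metis (mono_tags, lifting) someI_ex)+
  have "finite B"
    using independent_span_bound[of "b ` {..<n}" B] B dual_bases_independent[OF db] by auto
  let ?r = "representation B"
  have rl: "linear (\<lambda>x. ?r x v)" for v
    using B by (intro linearI) (auto simp: representation_add representation_scale)
  have ex: "x = (\<Sum>v\<in>B. ?r x v *\<^sub>R v)" for x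
    using sum_representation_eq[OF B(1) _ \<open>finite B\<close>, of x] B(2) by auto
  have "(\<Sum>i<n. c i (f (b i))) = (\<Sum>i<n. \<Sum>v\<in>B. ?r (b i) v * c i (f v))"
  proof (rule sum.cong[OF refl])
    fix i assume "i \<in> {..<n}"
    then have ci: "linear (c i)" using dual_bases_linear[OF db] by auto
    show "c i (f (b i)) = (\<Sum>v\<in>B. ?r (b i) v * c i (f v))"
      by (subst ex[of "b i"]) (simp add: linear_sum[OF f] linear_cmul[OF f] linear_sum[OF ci] linear_cmul[OF ci])
  qed
  also have "\<dots> = (\<Sum>v\<in>B. \<Sum>i<n. c i (f v) * ?r (b i) v)"
    by (subst sum.swap) (simp add: mult.commute)
  also have "\<dots> = (\<Sum>v\<in>B. ?r (\<Sum>i<n. c i (f v) *\<^sub>R b i) v)"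
    by (simp add: linear_sum[OF rl] linear_cmul[OF rl])
  also have "\<dots> = (\<Sum>v\<in>B. ?r (f v) v)"
    by (simp flip: dual_bases_expand[OF db])
  finally show ?thesis
    unfolding lin_trace_def Let_def B_def by simp
qed

lemma form_eq_0_on_basis:
  assumes db: "dual_bases n b c"
  shows "is_form k \<alpha> \<Longrightarrow> (\<And>f. (\<And>i. i < k \<Longrightarrow> f i < n) \<Longrightarrow> \<alpha> (\<lambda>i. b (f i)) = 0) \<Longrightarrow> \<alpha> = (\<lambda>x. 0)"
proof (induction k arbitrary: \<alpha>)
  case 0
  have "\<alpha> (\<lambda>i. b (id i)) = 0" by (rule 0(2)) simp
  moreover have "\<alpha> x = \<alpha> (\<lambda>i. b (id i))" for x
    using 0(1) unfolding is_form_0_iff by (elim allE)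
  ultimately show ?case by (intro ext) simp
next
  case (Suc k)
  have c0: "contract (b j) \<alpha> = (\<lambda>x. 0)" if "j < n" for j
  proof (rule Suc.IH)
    show "is_form k (contract (b j) \<alpha>)" by (rule is_form_contract[OF Suc.prems(1)])
    fix f assume "\<And>i. i < k \<Longrightarrow> f i < n"
    moreover have "case_nat (b j) (\<lambda>i. b (f i)) = (\<lambda>i. b (case_nat j f i))"
      by (auto simp: fun_eq_iff split: nat.split)
    ultimately show "contract (b j) \<alpha> (\<lambda>i. b (f i)) = 0"
      unfolding contract_case_nat using that Suc.prems(2)[of "case_nat j f"] by (auto split: nat.split)
  qed
  show ?case
  proof (rule form_eq_contractI)
    fix v
    have "contract v \<alpha> = contract (\<Sum>i<n. c i v *\<^sub>R b i) \<alpha>"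
      using dual_bases_expand[OF db, of v] by simp
    also have "\<dots> = (\<lambda>x. 0)"
      by (simp add: contract_sum_vec[OF Suc.prems(1)] contract_scale_vec[OF Suc.prems(1)] c0)
    finally show "contract v \<alpha> = contract v (\<lambda>x. 0)"
      by (simp add: contract_zero)
  qed
qed

lemma form_not_inj_0:
  assumes "is_form k \<alpha>" "\<not> inj_on f {..<k}"
  shows "\<alpha> (\<lambda>i. b (f i)) = 0"
  using assms(2) is_form_alt[OF assms(1), of _ _ "\<lambda>i. b (f i)"] unfolding inj_on_def by auto

text \<open>Repeated indices give 0, and sorting distinct ones changes the value by a sign only.
  This leaves finite tables of components to be checked.\<close>

lemma form_eq_0_increasing:
  assumes db: "dual_bases n b c" and \<alpha>: "is_form k \<alpha>"
    and inc: "\<And>f. strict_mono_on {..<k} f \<Longrightarrow> (\<And>i. i < k \<Longrightarrow> f i < n) \<Longrightarrow> \<alpha> (\<lambda>i. b (f i)) = 0"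
  shows "\<alpha> = (\<lambda>x. 0)"
proof (rule form_eq_0_on_basis[OF db \<alpha>])
  fix f :: "nat \<Rightarrow> nat" assume f: "\<And>i. i < k \<Longrightarrow> f i < n"
  show "\<alpha> (\<lambda>i. b (f i)) = 0"
  proof (cases "inj_on f {..<k}")
    case True
    define xs where "xs = map f [0..<k]"
    have "distinct xs"
      using True by (simp add: xs_def distinct_map lessThan_atLeast0)
    obtain p where p: "p permutes {..<length xs}" "permute_list p xs = sort xs"
      using mset_eq_permutation[of "sort xs" xs] by auto
    have len: "length xs = k" by (simp add: xs_def)
    have nth: "sort xs ! i = f (p i)" if "i < k" for i
      using that p permutes_in_image[OF p(1), of i] unfolding p(2)[symmetric]
      by (subst permute_list_nth) (auto simp: len xs_def)
    have "strict_mono_on {..<k} (\<lambda>i. f (p i))"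
    proof (rule strict_mono_onI)
      fix r s assume rs: "r \<in> {..<k}" "s \<in> {..<k}" "r < s"
      have "sort xs ! r < sort xs ! s"
        using sorted_nth_mono[of "sort xs" r s] nth_eq_iff_index_eq[of "sort xs" r s] \<open>distinct xs\<close> rs len
        by (metis distinct_sort length_sort lessThan_iff nat_less_le sorted_sort order_less_imp_le)
      then show "f (p r) < f (p s)"
        using nth rs by simp
    qed
    moreover have "f (p i) < n" if "i < k" for i
      using that f permutes_in_image[OF p(1), of i] len by auto
    ultimately have "\<alpha> (\<lambda>i. b (f (p i))) = 0"
      using inc[of "\<lambda>i. f (p i)"] by simp
    moreover have "\<alpha> ((\<lambda>i. b (f i)) \<circ> p) = of_int (sign p) * \<alpha> (\<lambda>i. b (f i))"
      using is_form_permute[OF \<alpha>] p(1) len by blast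
    moreover have "(\<lambda>i. b (f i)) \<circ> p = (\<lambda>i. b (f (p i)))" by auto
    ultimately show ?thesis
      by (simp add: sign_def split: if_splits)
  qed (rule form_not_inj_0[OF \<alpha>])
qed

text \<open>An injective choice of \<open>n\<close> indices below \<open>n\<close> is a permutation,
  so every value on basis vectors is plus or minus \<open>\<alpha> b\<close>, or 0.\<close>

lemma top_form_eq_0:
  assumes db: "dual_bases n b c" and \<alpha>: "is_form n \<alpha>" and "\<alpha> b = 0"
  shows "\<alpha> = (\<lambda>x. 0)"
proof (rule form_eq_0_on_basis[OF db \<alpha>])
  fix f :: "nat \<Rightarrow> nat" assume f: "\<And>i. i < n \<Longrightarrow> f i < n"
  show "\<alpha> (\<lambda>i. b (f i)) = 0"
  proof (cases "inj_on f {..<n}")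
    case True
    define p where "p i = (if i < n then f i else i)" for i
    have "inj_on p {..<n}"
      using True by (simp add: p_def inj_on_def)
    moreover have "p ` {..<n} \<subseteq> {..<n}"
      using f by (auto simp: p_def)
    ultimately have "bij_betw p {..<n} {..<n}"
      unfolding bij_betw_def using endo_inj_surj[of "{..<n}" p] by simp
    then have "p permutes {..<n}"
      by (rule bij_imp_permutes) (simp add: p_def)
    then have "\<alpha> (b \<circ> p) = 0"
      using is_form_permute[OF \<alpha>, of p b] \<open>\<alpha> b = 0\<close> by simp
    moreover have "\<alpha> (\<lambda>i. b (f i)) = \<alpha> (b \<circ> p)"
      by (rule is_form_cong[OF \<alpha>]) (auto simp: p_def)
    ultimately show ?thesis by simp
  qed (rule form_not_inj_0[OF \<alpha>])
qed

lemma top_form_eqI: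
  assumes "dual_bases n b c" "is_form n \<alpha>" "is_form n \<beta>" "\<alpha> b = \<beta> b"
  shows "\<alpha> = \<beta>"
  using top_form_eq_0[OF assms(1) is_form_diff[OF assms(2,3)]] assms(4) by (simp add: fun_eq_iff)

lemma form_above_top_eq_0:
  fixes b :: "nat \<Rightarrow> 'v::real_vector" and \<alpha> :: "'v form"
  assumes db: "dual_bases n b c" and \<alpha>: "is_form k \<alpha>" and "n < k"
  shows "\<alpha> = (\<lambda>x. 0)"
proof (rule form_eq_0_on_basis[OF db \<alpha>])
  fix f :: "nat \<Rightarrow> nat" assume f: "\<And>i. i < k \<Longrightarrow> f i < n"
  have "card (f ` {..<k}) \<le> card {..<n}"
    by (rule card_mono) (auto simp: f)
  then have "\<not> inj_on f {..<k}"
    using card_image[of f "{..<k}"] \<open>n < k\<close> by auto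
  then show "\<alpha> (\<lambda>i. b (f i)) = 0"
    by (rule form_not_inj_0[OF \<alpha>])
qed

section \<open>The volume form of a basis as a determinant\<close>

lemma permutes_lt:
  fixes n :: nat
  assumes "p permutes {0..<n}" "i < n"
  shows "p i < n"
proof -
  have "p i \<in> {0..<n}"
    by (subst permutes_in_image[OF assms(1)]) (simp add: assms(2))
  then show ?thesis by simp
qed

text \<open>The wedge product of all coordinate functionals, written as a determinant so that it can
  be compared with the determinant inside \<open>g2_vol\<close>.\<close>

definition det_form :: "nat \<Rightarrow> (nat \<Rightarrow> 'v \<Rightarrow> real) \<Rightarrow> 'v form" where
  "det_form n c = (\<lambda>x. det (mat n n (\<lambda>(i, j). c j (x i))))"

lemma is_form_det_form:
  assumes c: "\<And>i. i < n \<Longrightarrow> linear (c i)"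
  shows "is_form n (det_form n c)"
  unfolding is_form_def
proof (intro conjI allI impI)
  fix x y :: "nat \<Rightarrow> 'a"
  assume "\<forall>i<n. x i = y i"
  then show "det_form n c x = det_form n c y"
    unfolding det_form_def by (intro arg_cong[where f = det] eq_matI) auto
next
  fix x :: "nat \<Rightarrow> 'a" and i
  assume i: "i < n"
  have eq: "det_form n c (x(i := v)) =
      (\<Sum>p | p permutes {0..<n}. (signof p * (\<Prod>j\<in>{0..<n} - {i}. c (p j) (x j))) * c (p i) v)" for v
  proof -
    have "det_form n c (x(i := v)) = (\<Sum>p | p permutes {0..<n}. signof p * (\<Prod>j = 0..<n. c (p j) ((x(i := v)) j)))"
      unfolding det_form_def by (subst det_def') (auto intro!: sum.cong prod.cong simp: permutes_lt)
    also have "\<dots> = (\<Sum>p | p permutes {0..<n}. (signof p * (\<Prod>j\<in>{0..<n} - {i}. c (p j) (x j))) * c (p i) v)"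
    proof (rule sum.cong[OF refl])
      fix p
      have "(\<Prod>j\<in>{0..<n} - {i}. c (p j) ((x(i := v)) j)) = (\<Prod>j\<in>{0..<n} - {i}. c (p j) (x j))"
        by (intro prod.cong) auto
      then show "signof p * (\<Prod>j = 0..<n. c (p j) ((x(i := v)) j)) =
          (signof p * (\<Prod>j\<in>{0..<n} - {i}. c (p j) (x j))) * c (p i) v"
        using i by (subst prod.remove[of _ i]) auto
    qed
    finally show ?thesis .
  qed
  show "linear (\<lambda>v. det_form n c (x(i := v)))"
    unfolding eq using i
    by (intro linear_compose_sum ballI linear_cmult_fun c) (auto simp: permutes_lt)
next
  fix x :: "nat \<Rightarrow> 'a" and i j
  assume "i < n" "j < n" "i \<noteq> j \<and> x i = x j"
  then show "det_form n c x = 0"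
    unfolding det_form_def by (intro det_identical_rows[of _ n i j]) (auto intro!: eq_vecI)
qed

lemma det_form_dual_bases:
  assumes "dual_bases n b c"
  shows "is_form n (det_form n c)" "det_form n c b = 1"
proof -
  show "is_form n (det_form n c)"
    by (intro is_form_det_form dual_bases_linear[OF assms])
  have "mat n n (\<lambda>(i, j). c j (b i)) = 1\<^sub>m n"
    by (intro eq_matI) (auto simp: dual_bases_eval[OF assms])
  then show "det_form n c b = 1"
    by (simp add: det_form_def)
qed

lemma top_form_det_form:
  assumes "dual_bases n b c" "is_form n \<alpha>"
  shows "\<alpha> = (\<lambda>x. \<alpha> b * det_form n c x)"
  using det_form_dual_bases[OF assms(1)] assms
  by (intro top_form_eqI[OF assms(1,2)] is_form_cmult) auto

section \<open>Inner products of forms and the Hodge operator\<close>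

text \<open>This is k! times the inner product computed in the frame \<open>e\<close>; without the
  factorial it satisfies a recursion over contractions.\<close>

definition frame_sum :: "nat \<Rightarrow> (nat \<Rightarrow> 'v) \<Rightarrow> nat \<Rightarrow> 'v form \<Rightarrow> 'v form \<Rightarrow> real" where
  "frame_sum n e k \<alpha> \<beta> =
     (\<Sum>f \<in> {..<k} \<rightarrow>\<^sub>E {..<n}. \<alpha> (\<lambda>i. e (f i)) * \<beta> (\<lambda>i. e (f i)))"

lemma sum_PiE_Suc:
  fixes F :: "(nat \<Rightarrow> 'a) \<Rightarrow> real"
  shows "(\<Sum>f \<in> {..<Suc k} \<rightarrow>\<^sub>E A. F f) = (\<Sum>a\<in>A. \<Sum>f \<in> {..<k} \<rightarrow>\<^sub>E A. F (case_nat a f))"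
proof -
  have "bij_betw (\<lambda>(a, f). case_nat a f) (A \<times> ({..<k} \<rightarrow>\<^sub>E A)) ({..<Suc k} \<rightarrow>\<^sub>E A)"
  proof (rule bij_betwI[where g = "\<lambda>f. (f 0, \<lambda>i. f (Suc i))"])
    show "(\<lambda>(a, f). case_nat a f) \<in> A \<times> ({..<k} \<rightarrow>\<^sub>E A) \<rightarrow> {..<Suc k} \<rightarrow>\<^sub>E A"
    proof (rule funcsetI, clarify)
      fix a f assume *: "a \<in> A" "f \<in> {..<k} \<rightarrow>\<^sub>E A"
      show "case_nat a f \<in> {..<Suc k} \<rightarrow>\<^sub>E A"
      proof (rule PiE_I)
        fix i assume "i \<in> {..<Suc k}"
        then show "case_nat a f i \<in> A"
          using * PiE_mem[OF *(2)] by (cases i) simp_all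
      next
        fix i assume "i \<notin> {..<Suc k}"
        then show "case_nat a f i = undefined"
          using PiE_arb[OF *(2)] by (cases i) simp_all
      qed
    qed
    show "(\<lambda>f. (f 0, \<lambda>i. f (Suc i))) \<in> ({..<Suc k} \<rightarrow>\<^sub>E A) \<rightarrow> A \<times> ({..<k} \<rightarrow>\<^sub>E A)"
    proof (rule funcsetI, rule SigmaI)
      fix f assume f: "f \<in> {..<Suc k} \<rightarrow>\<^sub>E A"
      show "f 0 \<in> A" by (rule PiE_mem[OF f]) simp
      show "(\<lambda>i. f (Suc i)) \<in> {..<k} \<rightarrow>\<^sub>E A"
        by (rule PiE_I) (simp_all add: PiE_mem[OF f] PiE_arb[OF f])
    qed
  qed (simp_all add: case_nat_head_tail split_beta)
  from sum.reindex_bij_betw[OF this, of F] show ?thesis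
    by (simp add: sum.cartesian_product case_prod_unfold)
qed

lemma frame_sum_0: "frame_sum n e 0 \<alpha> \<beta> = \<alpha> (\<lambda>i. e undefined) * \<beta> (\<lambda>i. e undefined)"
  by (simp add: frame_sum_def)

lemma frame_sum_Suc:
  "frame_sum n e (Suc k) \<alpha> \<beta> = (\<Sum>i<n. frame_sum n e k (contract (e i) \<alpha>) (contract (e i) \<beta>))"
proof -
  have "(\<lambda>j. e (case_nat i f j)) = case_nat (e i) (\<lambda>j. e (f j))" for i f
    by (auto simp: fun_eq_iff split: nat.split)
  then show ?thesis
    by (simp add: frame_sum_def sum_PiE_Suc contract_case_nat)
qed

lemma frame_sum_0_form:
  assumes "is_form 0 \<alpha>" "is_form 0 \<beta>"
  shows "frame_sum n e 0 \<alpha> \<beta> = \<alpha> x * \<beta> x"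
  using assms unfolding frame_sum_0 is_form_0_iff by metis

lemma frame_sum_linear:
  "frame_sum n e k (\<lambda>x. \<alpha> x + \<alpha>' x) \<beta> = frame_sum n e k \<alpha> \<beta> + frame_sum n e k \<alpha>' \<beta>"
  "frame_sum n e k (\<lambda>x. r * \<alpha> x) \<beta> = r * frame_sum n e k \<alpha> \<beta>"
  "frame_sum n e k \<alpha> (\<lambda>x. \<beta> x + \<beta>' x) = frame_sum n e k \<alpha> \<beta> + frame_sum n e k \<alpha> \<beta>'"
  "frame_sum n e k \<alpha> (\<lambda>x. r * \<beta> x) = r * frame_sum n e k \<alpha> \<beta>"
  by (simp_all add: frame_sum_def algebra_simps sum.distrib sum_distrib_left)

text \<open>The metric trace of a bilinear form does not depend on the orthonormal basis: the
  coordinate matrix M of \<open>e\<close> has M M^T = 1, hence also M^T M = 1.\<close>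

lemma orthonormal_bilinear_trace:
  fixes B :: "'v::real_vector \<Rightarrow> 'v \<Rightarrow> real"
  assumes db: "dual_bases n b c" and g: "g = (\<lambda>x y. \<Sum>i<n. c i x * c i y)"
    and e: "orthonormal_frame g e"
    and B1: "\<And>w. linear (\<lambda>v. B v w)" and B2: "\<And>v. linear (B v)"
  shows "(\<Sum>i<n. B (e i) (e i)) = (\<Sum>i<n. B (b i) (b i))"
proof -
  have dim: "dim (UNIV :: 'v set) = n"
    by (rule dual_bases_independent(4)[OF db])
  define M where "M = mat n n (\<lambda>(i, a). c a (e i))"
  have M: "M \<in> carrier_mat n n" "transpose_mat M \<in> carrier_mat n n"
    by (simp_all add: M_def)
  have "M * transpose_mat M = 1\<^sub>m n"
  proof (rule eq_matI)
    fix i j assume "i < dim_row (1\<^sub>m n :: real mat)" "j < dim_col (1\<^sub>m n :: real mat)"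
    then have ij: "i < n" "j < n" by auto
    have "(M * transpose_mat M) $$ (i, j) = (\<Sum>a<n. c a (e i) * c a (e j))"
      using ij by (simp add: M_def scalar_prod_def lessThan_atLeast0)
    also have "\<dots> = g (e i) (e j)" by (simp add: g)
    finally show "(M * transpose_mat M) $$ (i, j) = 1\<^sub>m n $$ (i, j)"
      using e ij unfolding orthonormal_frame_def dim by simp
  qed (simp_all add: M_def)
  then have "transpose_mat M * M = 1\<^sub>m n"
    by (rule mat_mult_left_right_inverse[OF M])
  then have O: "(\<Sum>i<n. c a (e i) * c a' (e i)) = of_bool (a = a')" if "a < n" "a' < n" for a a'
  proof -
    have "(transpose_mat M * M) $$ (a, a') = (\<Sum>i<n. c a (e i) * c a' (e i))"
      using that by (simp add: M_def scalar_prod_def lessThan_atLeast0)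
    moreover have "(1\<^sub>m n :: real mat) $$ (a, a') = of_bool (a = a')"
      using that by simp
    ultimately show ?thesis
      using \<open>transpose_mat M * M = 1\<^sub>m n\<close> by metis
  qed
  have "B v v = (\<Sum>a<n. \<Sum>a'<n. c a v * c a' v * B (b a') (b a))" for v
  proof -
    have "B v v = B (\<Sum>a<n. c a v *\<^sub>R b a) (\<Sum>a'<n. c a' v *\<^sub>R b a')"
      by (simp flip: dual_bases_expand[OF db])
    also have "\<dots> = (\<Sum>a<n. \<Sum>a'<n. c a v * c a' v * B (b a') (b a))"
      by (simp add: linear_sum[OF B1] linear_cmul[OF B1] linear_sum[OF B2] linear_cmul[OF B2]
          sum_distrib_left mult.assoc)
    finally show ?thesis .
  qed
  then have "(\<Sum>i<n. B (e i) (e i)) = (\<Sum>i<n. \<Sum>a<n. \<Sum>a'<n. c a (e i) * c a' (e i) * B (b a') (b a))"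
    by simp
  also have "\<dots> = (\<Sum>a<n. \<Sum>a'<n. (\<Sum>i<n. c a (e i) * c a' (e i)) * B (b a') (b a))"
  proof -
    have "(\<Sum>i<n. \<Sum>a<n. \<Sum>a'<n. c a (e i) * c a' (e i) * B (b a') (b a)) =
        (\<Sum>a<n. \<Sum>i<n. \<Sum>a'<n. c a (e i) * c a' (e i) * B (b a') (b a))"
      by (rule sum.swap)
    also have "\<dots> = (\<Sum>a<n. \<Sum>a'<n. \<Sum>i<n. c a (e i) * c a' (e i) * B (b a') (b a))"
      by (rule sum.cong[OF refl], rule sum.swap)
    finally show ?thesis
      by (simp only: sum_distrib_right)
  qed
  also have "\<dots> = (\<Sum>a<n. \<Sum>a'<n. if a = a' then B (b a') (b a) else 0)"
    by (intro sum.cong refl) (simp add: O)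
  also have "\<dots> = (\<Sum>a<n. B (b a) (b a))"
    by simp
  finally show ?thesis .
qed

text \<open>Makes the \<open>SOME\<close> in \<open>form_inner\<close> harmless. The frame is
  exchanged one slot at a time, each exchange being the invariance of a metric trace.\<close>

lemma frame_sum_orthonormal:
  fixes e :: "nat \<Rightarrow> 'v::real_vector"
  assumes db: "dual_bases n b c" and g: "g = (\<lambda>x y. \<Sum>i<n. c i x * c i y)"
    and e: "orthonormal_frame g e"
  shows "is_form k \<alpha> \<Longrightarrow> is_form k \<beta> \<Longrightarrow> frame_sum n e k \<alpha> \<beta> = frame_sum n b k \<alpha> \<beta>"
proof (induction k arbitrary: \<alpha> \<beta>)
  case 0
  then show ?case
    using frame_sum_0_form[of \<alpha> \<beta> n e undefined] frame_sum_0_form[of \<alpha> \<beta> n b undefined] by simp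
next
  case (Suc k)
  have "frame_sum n e (Suc k) \<alpha> \<beta> = (\<Sum>i<n. frame_sum n b k (contract (e i) \<alpha>) (contract (e i) \<beta>))"
    unfolding frame_sum_Suc by (intro sum.cong refl Suc.IH is_form_contract Suc.prems)
  also have "\<dots> = (\<Sum>i<n. frame_sum n b k (contract (b i) \<alpha>) (contract (b i) \<beta>))"
    by (rule orthonormal_bilinear_trace[OF db g e])
      (auto intro!: linearI simp: contract_add_vec[OF Suc.prems(1)] contract_add_vec[OF Suc.prems(2)]
        contract_scale_vec[OF Suc.prems(1)] contract_scale_vec[OF Suc.prems(2)] frame_sum_linear)
  finally show ?case by (simp add: frame_sum_Suc)
qed

lemma orthonormal_frame_dual_bases:
  assumes "dual_bases n b c" "g = (\<lambda>x y. \<Sum>i<n. c i x * c i y)"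
  shows "orthonormal_frame g b"
proof -
  have "(\<Sum>a<n. c a (b i) * c a (b j)) = of_bool (i = j)" if "i < n" "j < n" for i j
  proof -
    have "(\<Sum>a<n. c a (b i) * c a (b j)) = (\<Sum>a<n. if a = i then of_bool (i = j) else 0)"
      using that by (intro sum.cong) (auto simp: dual_bases_eval[OF assms(1)])
    then show ?thesis using that by simp
  qed
  then show ?thesis
    unfolding orthonormal_frame_def dual_bases_independent(4)[OF assms(1)] assms(2) by simp
qed

lemma form_inner_dual_bases:
  fixes b :: "nat \<Rightarrow> 'v::real_vector"
  assumes db: "dual_bases n b c" and g: "g = (\<lambda>x y. \<Sum>i<n. c i x * c i y)"
    and "is_form k \<alpha>" "is_form k \<beta>"
  shows "form_inner g k \<alpha> \<beta> = frame_sum n b k \<alpha> \<beta> / fact k"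
proof -
  have "orthonormal_frame g (SOME e. orthonormal_frame g e)"
    using orthonormal_frame_dual_bases[OF db g] by (metis someI_ex)
  from frame_sum_orthonormal[OF db g this assms(3,4)] show ?thesis
    by (simp add: form_inner_def frame_sum_def Let_def dual_bases_independent(4)[OF db])
qed

section \<open>Existence and uniqueness of the Hodge dual\<close>

lemma wedge_0_left: "is_form 0 \<alpha> \<Longrightarrow> is_form l \<beta> \<Longrightarrow> wedge 0 l \<alpha> \<beta> = (\<lambda>x. \<alpha> x * \<beta> x)"
proof (induction l arbitrary: \<beta>)
  case 0
  then show ?case by (simp add: wedge_0_0 fun_eq_iff)
next
  case (Suc l)
  show ?case
  proof (rule form_eq_contractI)
    fix v
    have "\<alpha> (case_nat v x) = \<alpha> x" for x
      using Suc.prems(1) unfolding is_form_0_iff by blast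
    then show "contract v (wedge 0 (Suc l) \<alpha> \<beta>) = contract v (\<lambda>x. \<alpha> x * \<beta> x)"
      unfolding wedge_contract_0_Suc[OF Suc.prems] Suc.IH[OF Suc.prems(1) is_form_contract[OF Suc.prems(2)]]
      by (simp add: contract_def)
  qed
qed

text \<open>The iterated contraction with \<open>v 0\<close> first and \<open>v (k - 1)\<close>
  last; Hodge duals are combinations of such forms.\<close>

definition contracts :: "nat \<Rightarrow> (nat \<Rightarrow> 'v) \<Rightarrow> 'v form \<Rightarrow> 'v form" where
  "contracts k v \<mu> = (\<lambda>x. \<mu> (\<lambda>i. if i < k then v i else x (i - k)))"

lemma contracts_0: "contracts 0 v \<mu> = \<mu>"
  by (simp add: contracts_def)

lemma contracts_Suc: "contracts (Suc k) v \<mu> = contract (v k) (contracts k v \<mu>)"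
proof -
  have "(\<lambda>i. if i < Suc k then v i else x (i - Suc k)) = (\<lambda>i. if i < k then v i else case_nat (v k) x (i - k))" for x
    by (auto simp: fun_eq_iff less_Suc_eq split: nat.split)
      (metis Suc_diff_Suc Suc_leI diff_Suc_Suc diff_is_0_eq not_less_less_Suc_eq nat.simps(3) old.nat.inject linorder_not_less not_less_eq)+
  then show ?thesis by (simp add: contracts_def contract_def)
qed

lemma is_form_contracts: "is_form (k + l) \<mu> \<Longrightarrow> is_form l (contracts k v \<mu>)"
  by (induction k arbitrary: l) (auto simp: contracts_0 contracts_Suc is_form_contract)

text \<open>Contracting the vanishing \<open>(n + 1)\<close>-form \<open>\<alpha> \<and> \<iota>(v\<^sub>k\<^sub>-\<^sub>1) \<dots> \<iota>(v\<^sub>0) \<mu>\<close> with \<open>v\<^sub>k\<close> moves this vector onto \<open>\<alpha>\<close>.\<close>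

lemma wedge_contracts_top:
  fixes b :: "nat \<Rightarrow> 'v::real_vector" and \<alpha> :: "'v form"
  assumes db: "dual_bases n b c" and \<mu>: "is_form n \<mu>"
  shows "k \<le> n \<Longrightarrow> is_form k \<alpha> \<Longrightarrow> wedge k (n - k) \<alpha> (contracts k v \<mu>) = (\<lambda>x. \<alpha> v * \<mu> x)"
proof (induction k arbitrary: \<alpha>)
  case 0
  then have const: "\<alpha> x = \<alpha> v" for x
    unfolding is_form_0_iff by blast
  have "wedge 0 n \<alpha> (contracts 0 v \<mu>) = (\<lambda>x. \<alpha> x * \<mu> x)"
    using 0 \<mu> by (simp add: wedge_0_left contracts_0)
  also have "\<dots> = (\<lambda>x. \<alpha> v * \<mu> x)"
    by (intro ext, subst const, rule refl)
  finally show ?case by simp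
next
  case (Suc k)
  obtain l where l: "n - k = Suc l" "n - Suc k = l" "k + Suc l = n"
    using Suc.prems(1) by (metis Suc_diff_Suc Suc_le_lessD le_add_diff_inverse less_imp_le)
  have f: "is_form (Suc l) (contracts k v \<mu>)"
    using \<mu> l by (intro is_form_contracts) simp
  have "is_form (Suc k + Suc l) (wedge (Suc k) (Suc l) \<alpha> (contracts k v \<mu>))"
    by (rule is_form_wedge[OF Suc.prems(2) f])
  then have "wedge (Suc k) (Suc l) \<alpha> (contracts k v \<mu>) = (\<lambda>x. 0)"
    using l by (intro form_above_top_eq_0[OF db]) auto
  then have "(\<lambda>x. wedge k (Suc l) (contract (v k) \<alpha>) (contracts k v \<mu>) x -
      (- 1) ^ k * wedge (Suc k) l \<alpha> (contracts (Suc k) v \<mu>) x) = (\<lambda>x. 0)"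
    using wedge_contract_Suc_Suc[OF Suc.prems(2) f, of "v k"] by (simp add: contract_zero contracts_Suc)
  moreover have "wedge k (Suc l) (contract (v k) \<alpha>) (contracts k v \<mu>) = (\<lambda>x. contract (v k) \<alpha> v * \<mu> x)"
    using Suc.IH[of "contract (v k) \<alpha>"] Suc.prems l by (simp add: is_form_contract)
  moreover have "contract (v k) \<alpha> v = (- 1) ^ k * \<alpha> v"
  proof -
    \<comment> \<open>Inserting \<open>v k\<close> at position \<open>k\<close> of \<open>v\<close>
      leaves the first k + 1 entries unchanged, and a (k + 1)-form sees no others.\<close>
    have "\<alpha> (insert_at k (v k) v) = (- 1) ^ k * \<alpha> (case_nat (v k) v)"
      using is_form_insert_at[OF Suc.prems(2), of k "v k" v] by simp
    moreover have "\<alpha> (insert_at k (v k) v) = \<alpha> v"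
      by (rule is_form_cong[OF Suc.prems(2)]) (auto simp: insert_at_def less_Suc_eq)
    ultimately have "(- 1) ^ k * \<alpha> v = ((- 1) ^ k * (- 1) ^ k) * \<alpha> (case_nat (v k) v)"
      by simp
    then show ?thesis
      by (simp add: contract_case_nat flip: power_mult_distrib)
  qed
  ultimately have "(- 1) ^ k * wedge (Suc k) l \<alpha> (contracts (Suc k) v \<mu>) x = (- 1) ^ k * (\<alpha> v * \<mu> x)" for x
    by (simp add: fun_eq_iff)
  then show ?case
    by (simp add: l fun_eq_iff)
qed

text \<open>The wedge product with an iterated contraction of the volume form returns the value of
  \<gamma> on the contracted vectors.\<close>

lemma wedge_nondegenerate:
  fixes b :: "nat \<Rightarrow> 'v::real_vector" and \<gamma> :: "'v form"
  assumes db: "dual_bases n b c" and k: "k \<le> n" and \<gamma>: "is_form (n - k) \<gamma>"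
    and 0: "\<And>\<alpha>. is_form k \<alpha> \<Longrightarrow> wedge k (n - k) \<alpha> \<gamma> = (\<lambda>x. 0)"
  shows "\<gamma> = (\<lambda>x. 0)"
proof
  fix y
  let ?\<mu> = "det_form n c"
  have f: "is_form k (contracts (n - k) y ?\<mu>)"
    using det_form_dual_bases[OF db] k by (intro is_form_contracts) simp
  have "wedge (n - k) k \<gamma> (contracts (n - k) y ?\<mu>) = (\<lambda>x. 0)"
    using wedge_commute[OF \<gamma> f] 0[OF f] by simp
  moreover have "wedge (n - k) k \<gamma> (contracts (n - k) y ?\<mu>) = (\<lambda>x. \<gamma> y * ?\<mu> x)"
    using wedge_contracts_top[OF db det_form_dual_bases(1)[OF db] _ \<gamma>, of y] k by simp
  ultimately show "\<gamma> y = 0"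
    using det_form_dual_bases(2)[OF db] by (metis mult.right_neutral)
qed

text \<open>The witness is the sum over index tuples f of \<beta>(e_f) / k! times the contraction of
  the volume form with e_f, where e is the very frame that \<open>form_inner\<close> selects.
  Uniqueness is nondegeneracy of the wedge pairing.\<close>

lemma hodge_unique_existence:
  fixes b :: "nat \<Rightarrow> 'v::real_vector" and vol \<beta> :: "'v form"
  assumes db: "dual_bases n b c" and vol: "is_form n vol" and k: "k \<le> n"
  shows "\<exists>!\<gamma>. is_form (n - k) \<gamma> \<and>
    (\<forall>\<alpha>. is_form k \<alpha> \<longrightarrow> wedge k (n - k) \<alpha> \<gamma> = (\<lambda>x. form_inner g k \<alpha> \<beta> * vol x))"
proof (rule ex_ex1I)
  define e where "e = (SOME e. orthonormal_frame g e)"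
  define I where "I = ({..<k} \<rightarrow>\<^sub>E {..<n} :: (nat \<Rightarrow> nat) set)"
  define \<gamma> where "\<gamma> = (\<lambda>x. \<Sum>f\<in>I. \<beta> (\<lambda>i. e (f i)) / fact k * contracts k (\<lambda>i. e (f i)) vol x)"
  have "is_form (n - k) \<gamma>"
    unfolding \<gamma>_def using vol k by (intro is_form_sum is_form_cmult is_form_contracts) simp
  moreover have "wedge k (n - k) \<alpha> \<gamma> = (\<lambda>x. form_inner g k \<alpha> \<beta> * vol x)" if "is_form k \<alpha>" for \<alpha>
    unfolding \<gamma>_def wedge_sum_right wedge_cmult_right wedge_contracts_top[OF db vol k that]
    by (auto simp: form_inner_def Let_def e_def I_def dual_bases_independent(4)[OF db] sum_distrib_right sum_divide_distrib
        intro!: sum.cong)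
  ultimately show "\<exists>\<gamma>. is_form (n - k) \<gamma> \<and>
    (\<forall>\<alpha>. is_form k \<alpha> \<longrightarrow> wedge k (n - k) \<alpha> \<gamma> = (\<lambda>x. form_inner g k \<alpha> \<beta> * vol x))"
    by blast
next
  fix \<gamma> \<gamma>'
  assume *: "is_form (n - k) \<gamma> \<and>
    (\<forall>\<alpha>. is_form k \<alpha> \<longrightarrow> wedge k (n - k) \<alpha> \<gamma> = (\<lambda>x. form_inner g k \<alpha> \<beta> * vol x))"
    "is_form (n - k) \<gamma>' \<and>
    (\<forall>\<alpha>. is_form k \<alpha> \<longrightarrow> wedge k (n - k) \<alpha> \<gamma>' = (\<lambda>x. form_inner g k \<alpha> \<beta> * vol x))"
  have "(\<lambda>x. \<gamma> x - \<gamma>' x) = (\<lambda>x. 0)"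
  proof (rule wedge_nondegenerate[OF db k])
    show "is_form (n - k) (\<lambda>x. \<gamma> x - \<gamma>' x)"
      by (rule is_form_diff[OF conjunct1[OF *(1)] conjunct1[OF *(2)]])
    show "wedge k (n - k) \<alpha> (\<lambda>x. \<gamma> x - \<gamma>' x) = (\<lambda>x. 0)" if "is_form k \<alpha>" for \<alpha>
      using conjunct2[OF *(1)] conjunct2[OF *(2)] that by (simp add: wedge_diff_right)
  qed
  then show "\<gamma> = \<gamma>'"
    by (simp add: fun_eq_iff)
qed

lemma hodge_works:
  fixes b :: "nat \<Rightarrow> 'v::real_vector" and vol \<beta> :: "'v form"
  assumes "dual_bases n b c" "is_form n vol" "k \<le> n"
  shows "is_form (n - k) (hodge g vol k \<beta>)"
    "is_form k \<alpha> \<Longrightarrow> wedge k (n - k) \<alpha> (hodge g vol k \<beta>) = (\<lambda>x. form_inner g k \<alpha> \<beta> * vol x)"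
proof -
  have *: "is_form (n - k) (hodge g vol k \<beta>) \<and> (\<forall>\<alpha>. is_form k \<alpha> \<longrightarrow>
      wedge k (n - k) \<alpha> (hodge g vol k \<beta>) = (\<lambda>x. form_inner g k \<alpha> \<beta> * vol x))"
    unfolding hodge_def dual_bases_independent(4)[OF assms(1)]
    by (rule theI'[OF hodge_unique_existence[OF assms]])
  show "is_form (n - k) (hodge g vol k \<beta>)"
    by (rule conjunct1[OF *])
  show "is_form k \<alpha> \<Longrightarrow> wedge k (n - k) \<alpha> (hodge g vol k \<beta>) = (\<lambda>x. form_inner g k \<alpha> \<beta> * vol x)"
    by (rule conjunct2[OF *, rule_format])
qed

lemma hodge_eqI:
  fixes b :: "nat \<Rightarrow> 'v::real_vector" and vol \<beta> :: "'v form"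
  assumes "dual_bases n b c" "is_form n vol" "k \<le> n" "is_form (n - k) \<gamma>"
    and "\<And>\<alpha>. is_form k \<alpha> \<Longrightarrow> wedge k (n - k) \<alpha> \<gamma> = (\<lambda>x. form_inner g k \<alpha> \<beta> * vol x)"
  shows "hodge g vol k \<beta> = \<gamma>"
  unfolding hodge_def dual_bases_independent(4)[OF assms(1)]
  by (rule the1_equality[OF hodge_unique_existence[OF assms(1-3)]]) (rule conjI[OF assms(4)], intro allI impI, rule assms(5))

lemma wedge_0_right: "is_form k \<alpha> \<Longrightarrow> is_form 0 \<beta> \<Longrightarrow> wedge k 0 \<alpha> \<beta> = (\<lambda>x. \<alpha> x * \<beta> x)"
  by (simp add: wedge_commute[of k \<alpha> 0 \<beta>] wedge_0_left mult.commute)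

text \<open>Evaluates wedge products by peeling off one argument at a time. The rule matches degrees
  built from \<open>Suc\<close>, which is why numerals are unfolded wherever it is applied.\<close>

lemma wedge_eval_Suc_Suc:
  "is_form (Suc k) \<alpha> \<Longrightarrow> is_form (Suc l) \<beta> \<Longrightarrow> wedge (Suc k) (Suc l) \<alpha> \<beta> (case_nat v x) =
    wedge k (Suc l) (contract v \<alpha>) \<beta> x - (- 1) ^ k * wedge (Suc k) l \<alpha> (contract v \<beta>) x"
  using wedge_contract_Suc_Suc[of k \<alpha> l \<beta> v] by (simp add: contract_def fun_eq_iff)

lemmas wedge_eval = wedge_eval_Suc_Suc wedge_0_left wedge_0_right is_form_contract contract_case_nat

section \<open>\<open>SU(3)\<close>-structures: linear algebra\<close>

lemma form1_eval: "is_form 1 \<eta> \<Longrightarrow> \<eta> (case_nat v x) = \<eta> (\<lambda>_. v)"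
  by (erule is_form_cong) simp

text \<open>Normal form of a value: the irrelevant tail of the argument sequence is replaced by the
  one used in \<open>eval2\<close>.\<close>

lemma form2_eval: "is_form 2 \<beta> \<Longrightarrow> \<beta> (case_nat v (case_nat w x)) = eval2 \<beta> v w"
  by (erule is_form_cong) (auto simp: less_2_cases_iff)

lemma form2_linear:
  assumes "is_form 2 \<beta>"
  shows "linear (eval2 \<beta> v)" "linear (\<lambda>v. eval2 \<beta> v w)"
proof -
  have f: "is_form (Suc (Suc 0)) \<beta>" using assms by (simp add: numeral_2_eq_2)
  show "linear (\<lambda>v. eval2 \<beta> v w)" by (rule is_form_linear_head[OF f])
  have "linear (\<lambda>w. contract v \<beta> (case_nat w (\<lambda>_. w0)))" for w0
    by (rule is_form_linear_head[OF is_form_contract[OF f]])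
  then show "linear (eval2 \<beta> v)"
    unfolding contract_case_nat form2_eval[OF assms] .
qed

lemma form2_alt:
  assumes "is_form 2 \<beta>"
  shows "eval2 \<beta> v v = 0" "eval2 \<beta> v w = - eval2 \<beta> w v"
proof -
  have f: "is_form (Suc (Suc 0)) \<beta>" using assms by (simp add: numeral_2_eq_2)
  show "eval2 \<beta> v v = 0"
    using is_form_alt_head[OF f, of v "\<lambda>_. v"] unfolding form2_eval[OF assms] .
  show "eval2 \<beta> v w = - eval2 \<beta> w v"
    using is_form_swap_head[OF f, of v w "\<lambda>_. v"] unfolding form2_eval[OF assms] .
qed

lemma is_form_contract_3: "is_form 3 \<rho> \<Longrightarrow> is_form 2 (contract v \<rho>)"
  using is_form_contract[of 2 \<rho> v] by simp

lemma is_form_contract_2: "is_form 2 \<rho> \<Longrightarrow> is_form 1 (contract v \<rho>)"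
  using is_form_contract[of 1 \<rho> v] by (simp add: numeral_2_eq_2)

abbreviation eval3 :: "'v form \<Rightarrow> 'v \<Rightarrow> 'v \<Rightarrow> 'v \<Rightarrow> real" where
  "eval3 \<rho> v \<equiv> eval2 (contract v \<rho>)"

lemma form3_eval: "is_form 3 \<rho> \<Longrightarrow> \<rho> (case_nat u (case_nat v (case_nat w x))) = eval3 \<rho> u v w"
  unfolding contract_case_nat by (erule is_form_cong) (auto split: nat.split)

lemma form3_linear:
  assumes "is_form 3 \<rho>"
  shows "linear (eval3 \<rho> u v)" "linear (\<lambda>v. eval3 \<rho> u v w)" "linear (\<lambda>u. eval3 \<rho> u v w)"
proof -
  show "linear (eval3 \<rho> u v)" "linear (\<lambda>v. eval3 \<rho> u v w)"
    by (intro form2_linear is_form_contract_3 assms)+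
  have "is_form (Suc 2) \<rho>" using assms by simp
  from is_form_linear_head[OF this] show "linear (\<lambda>u. eval3 \<rho> u v w)"
    unfolding contract_case_nat .
qed

lemma form3_alt:
  assumes "is_form 3 \<rho>"
  shows "eval3 \<rho> u u w = 0" "eval3 \<rho> u v v = 0" "eval3 \<rho> u v u = 0"
    "eval3 \<rho> u v w = - eval3 \<rho> v u w" "eval3 \<rho> u v w = - eval3 \<rho> u w v"
proof -
  have f: "is_form (Suc (Suc 1)) \<rho>" using assms by (simp add: eval_nat_numeral)
  show a: "eval3 \<rho> u u w = 0" for u w
    unfolding contract_case_nat by (rule is_form_alt_head[OF f])
  show "eval3 \<rho> u v v = 0" by (rule form2_alt(1)[OF is_form_contract_3[OF assms]])
  show b: "eval3 \<rho> u v w = - eval3 \<rho> u w v" for u v w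
    by (rule form2_alt(2)[OF is_form_contract_3[OF assms]])
  show "eval3 \<rho> u v u = 0"
    using b[of u v u] a by simp
  show "eval3 \<rho> u v w = - eval3 \<rho> v u w"
    unfolding contract_case_nat by (rule is_form_swap_head[OF f])
qed

section \<open>Forms of codegree one, and 2-forms of rank four\<close>

lemma is_form_coord: "linear f \<Longrightarrow> is_form 1 (\<lambda>x. f (x 0))"
  unfolding is_form_def by auto

text \<open>Once a top form \<Omega> is fixed, forms of codegree one correspond to vectors: the i-th
  coordinate of s is the ratio of \<kappa> \<and> c^i to \<Omega>. This gives a meaning to the
  description in \<open>su3_S\<close>.\<close>

lemma codim1_form_vector:
  fixes b :: "nat \<Rightarrow> 'v::real_vector" and \<kappa> \<Omega> :: "'v form"
  assumes db: "dual_bases (Suc n) b c" and \<Omega>: "is_form (Suc n) \<Omega>" "\<Omega> \<noteq> (\<lambda>x. 0)"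
    and \<kappa>: "is_form n \<kappa>"
  shows "\<exists>!s. \<forall>\<eta>. is_form 1 \<eta> \<longrightarrow> wedge n 1 \<kappa> \<eta> = (\<lambda>x. \<eta> (\<lambda>_. s) * \<Omega> x)"
proof -
  have \<Omega>b: "\<Omega> b \<noteq> 0"
    using top_form_eq_0[OF db \<Omega>(1)] \<Omega>(2) by blast
  define C where "C i = (\<lambda>x::nat \<Rightarrow> 'v. c i (x 0))" for i
  have C: "is_form 1 (C i)" if "i < Suc n" for i
    unfolding C_def by (rule is_form_coord[OF dual_bases_linear[OF db that]])
  define r where "r i = wedge n 1 \<kappa> (C i) b / \<Omega> b" for i
  define s where "s = (\<Sum>i<Suc n. r i *\<^sub>R b i)"
  have top: "wedge n 1 \<kappa> (C i) = (\<lambda>x. r i * \<Omega> x)" if "i < Suc n" for i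
  proof (rule top_form_eqI[OF db])
    show "is_form (Suc n) (wedge n 1 \<kappa> (C i))"
      using is_form_wedge[OF \<kappa> C[OF that]] by simp
    show "is_form (Suc n) (\<lambda>x. r i * \<Omega> x)"
      by (rule is_form_cmult[OF \<Omega>(1)])
    show "wedge n 1 \<kappa> (C i) b = r i * \<Omega> b"
      using \<Omega>b by (simp add: r_def)
  qed
  show ?thesis
  proof (rule ex1I[of _ s])
    have "wedge n 1 \<kappa> \<eta> = (\<lambda>x. \<eta> (\<lambda>_. s) * \<Omega> x)" if \<eta>: "is_form 1 \<eta>" for \<eta> :: "'v form"
    proof -
      have lin: "linear (\<lambda>v. \<eta> (\<lambda>_. v))"
        using is_form_linear_head[of 0 \<eta>] \<eta> form1_eval[OF \<eta>] by simp
      have "\<eta> = (\<lambda>x. \<Sum>i<Suc n. \<eta> (\<lambda>_. b i) * C i x)"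
      proof
        fix x
        have "\<eta> x = \<eta> (\<lambda>_. x 0)"
          by (rule is_form_cong[OF \<eta>]) simp
        also have "\<dots> = \<eta> (\<lambda>_. \<Sum>i<Suc n. c i (x 0) *\<^sub>R b i)"
          by (simp only: dual_bases_expand[OF db, of "x 0", symmetric])
        finally show "\<eta> x = (\<Sum>i<Suc n. \<eta> (\<lambda>_. b i) * C i x)"
          by (simp only: linear_sum[OF lin] linear_cmul[OF lin] C_def real_scaleR_def mult.commute)
      qed
      then have "wedge n 1 \<kappa> \<eta> = wedge n 1 \<kappa> (\<lambda>x. \<Sum>i<Suc n. \<eta> (\<lambda>_. b i) * C i x)"
        by (rule arg_cong)
      also have "\<dots> = (\<lambda>x. \<Sum>i<Suc n. \<eta> (\<lambda>_. b i) * wedge n 1 \<kappa> (C i) x)"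
        by (simp only: wedge_sum_right wedge_cmult_right)
      also have "\<dots> = (\<lambda>x. (\<Sum>i<Suc n. \<eta> (\<lambda>_. b i) * r i) * \<Omega> x)"
        by (intro ext) (simp only: sum_distrib_right mult.assoc, intro sum.cong refl, subst top, simp_all)
      also have "(\<Sum>i<Suc n. \<eta> (\<lambda>_. b i) * r i) = \<eta> (\<lambda>_. s)"
        by (simp only: s_def linear_sum[OF lin] linear_cmul[OF lin] real_scaleR_def mult.commute)
      finally show "wedge n 1 \<kappa> \<eta> = (\<lambda>x. \<eta> (\<lambda>_. s) * \<Omega> x)" .
    qed
    then show "\<forall>\<eta>. is_form 1 \<eta> \<longrightarrow> wedge n 1 \<kappa> \<eta> = (\<lambda>x. \<eta> (\<lambda>_. s) * \<Omega> x)"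
      by (intro allI impI)
  next
    fix t assume t: "\<forall>\<eta>. is_form 1 \<eta> \<longrightarrow> wedge n 1 \<kappa> \<eta> = (\<lambda>x. \<eta> (\<lambda>_. t) * \<Omega> x)"
    have "c i t = r i" if "i < Suc n" for i
    proof -
      have "(\<lambda>x. c i t * \<Omega> x) = (\<lambda>x. r i * \<Omega> x)"
        using t[rule_format, OF C[OF that]] top[OF that] by (simp add: C_def)
      from fun_cong[OF this, of b] show ?thesis using \<Omega>b by simp
    qed
    then show "t = s"
      unfolding s_def by (subst dual_bases_expand[OF db, of t]) simp
  qed
qed

text \<open>Contracting \<eta> \<and> \<Omega>, which vanishes for degree reasons, with s gives
  \<eta> \<and> \<iota>_s \<Omega> = \<eta>(s) \<Omega>. So both sides have the same products with
  all 1-forms; the sign comes from moving \<eta> past \<kappa>.\<close>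

lemma codim1_form_eq_contract:
  fixes b :: "nat \<Rightarrow> 'v::real_vector" and \<kappa> \<Omega> :: "'v form"
  assumes db: "dual_bases (Suc n) b c" and \<Omega>: "is_form (Suc n) \<Omega>" and \<kappa>: "is_form n \<kappa>"
    and s: "\<And>\<eta>. is_form 1 \<eta> \<Longrightarrow> wedge n 1 \<kappa> \<eta> = (\<lambda>x. \<eta> (\<lambda>_. s) * \<Omega> x)"
  shows "\<kappa> = (\<lambda>x. (- 1) ^ n * contract s \<Omega> x)"
proof -
  have "wedge 1 n \<eta> (\<lambda>x. \<kappa> x - (- 1) ^ n * contract s \<Omega> x) = (\<lambda>x. 0)" if \<eta>: "is_form 1 \<eta>" for \<eta>
  proof -
    have "is_form (Suc (Suc n)) (wedge 1 (Suc n) \<eta> \<Omega>)"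
      using is_form_wedge[OF \<eta> \<Omega>] by simp
    then have "wedge 1 (Suc n) \<eta> \<Omega> = (\<lambda>x. 0)"
      by (intro form_above_top_eq_0[OF db]) auto
    then have "(\<lambda>x. wedge 0 (Suc n) (contract s \<eta>) \<Omega> x - wedge 1 n \<eta> (contract s \<Omega>) x) = (\<lambda>x. 0)"
      using wedge_contract_Suc_Suc[of 0 \<eta> n \<Omega> s] \<eta> \<Omega> by (simp add: contract_zero)
    moreover have "wedge 0 (Suc n) (contract s \<eta>) \<Omega> = (\<lambda>x. \<eta> (\<lambda>_. s) * \<Omega> x)"
      using \<eta> is_form_contract[of 0 \<eta> s] \<Omega> by (simp add: wedge_0_left contract_case_nat form1_eval)
    moreover have "wedge 1 n \<eta> \<kappa> = (\<lambda>x. (- 1) ^ n * (\<eta> (\<lambda>_. s) * \<Omega> x))"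
      using wedge_commute[OF \<eta> \<kappa>] s[OF \<eta>] by simp
    ultimately have "wedge 1 n \<eta> (contract s \<Omega>) = (\<lambda>x. \<eta> (\<lambda>_. s) * \<Omega> x)"
      unfolding fun_eq_iff by simp
    then show ?thesis
      using \<open>wedge 1 n \<eta> \<kappa> = _\<close> by (simp add: wedge_diff_right wedge_cmult_right)
  qed
  then have 0: "\<And>\<eta>. is_form 1 \<eta> \<Longrightarrow> wedge 1 (Suc n - 1) \<eta> (\<lambda>x. \<kappa> x - (- 1) ^ n * contract s \<Omega> x) = (\<lambda>x. 0)"
    by simp
  have 1: "is_form (Suc n - 1) (\<lambda>x. \<kappa> x - (- 1) ^ n * contract s \<Omega> x)"
    using is_form_diff[OF \<kappa> is_form_cmult[OF is_form_contract[OF \<Omega>]]] by simp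
  have "(\<lambda>x. \<kappa> x - (- 1) ^ n * contract s \<Omega> x) = (\<lambda>x. 0)"
    by (rule wedge_nondegenerate[OF db _ 1 0]) simp_all
  then show ?thesis
    by (simp add: fun_eq_iff)
qed

lemma wedge_1_2_eval:
  assumes "is_form 1 \<alpha>" "is_form 2 \<beta>"
  shows "wedge 1 2 \<alpha> \<beta> (case_nat x (case_nat y (case_nat z w))) =
    \<alpha> (\<lambda>_. x) * eval2 \<beta> y z - \<alpha> (\<lambda>_. y) * eval2 \<beta> x z + \<alpha> (\<lambda>_. z) * eval2 \<beta> x y"
proof -
  have "is_form (Suc 0) \<alpha>" "is_form (Suc (Suc 0)) \<beta>"
    using assms by (auto simp: numeral_2_eq_2)
  then have "wedge (Suc 0) (Suc (Suc 0)) \<alpha> \<beta> (case_nat x (case_nat y (case_nat z w))) =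
    \<alpha> (\<lambda>_. x) * eval2 \<beta> y z - \<alpha> (\<lambda>_. y) * eval2 \<beta> x z + \<alpha> (\<lambda>_. z) * eval2 \<beta> x y"
    by (simp add: wedge_eval form2_eval[OF assms(2)] form1_eval[OF assms(1)])
  then show ?thesis
    by (simp add: numeral_2_eq_2)
qed

text \<open>If \<open>\<alpha>(x) = 1\<close>, contracting \<open>\<alpha> \<and> \<beta> = 0\<close> with \<open>x\<close> gives \<open>\<beta> = \<alpha> \<and> \<iota>\<^sub>x \<beta>\<close>, which has rank at most two.\<close>

lemma wedge_1_2_eq_0:
  fixes \<alpha> \<beta> :: "'v::real_vector form"
  assumes \<alpha>: "is_form 1 \<alpha>" and \<beta>: "is_form 2 \<beta>" and 0: "wedge 1 2 \<alpha> \<beta> = (\<lambda>x. 0)"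
    and rank: "form2_rank \<beta> = 4" and dim: "dim (UNIV :: 'v set) = 6"
  shows "\<alpha> (\<lambda>_. v) = 0"
proof (rule ccontr)
  assume nz: "\<alpha> (\<lambda>_. v) \<noteq> 0"
  define K where "K = {v. \<forall>w. eval2 \<beta> v w = 0}"
  have "dim K = 2"
    using rank dim unfolding form2_rank_def K_def by simp
  then obtain B where B: "B \<subseteq> K" "independent B" "K \<subseteq> span B" "card B = 2"
    using basis_exists[of K] by metis
  have "finite B" using B(4) card_ge_0_finite by force
  define x where "x = (1 / \<alpha> (\<lambda>_. v)) *\<^sub>R v"
  have la: "linear (\<lambda>v. \<alpha> (\<lambda>_. v))"
    using is_form_linear_head[of 0 \<alpha>] \<alpha> form1_eval[OF \<alpha>] by simp
  note lb = form2_linear[OF \<beta>]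
  have x1: "\<alpha> (\<lambda>_. x) = 1"
    using nz by (simp add: x_def linear_cmul[OF la])
  have eq: "eval2 \<beta> a b = \<alpha> (\<lambda>_. a) * eval2 \<beta> x b - \<alpha> (\<lambda>_. b) * eval2 \<beta> x a" for a b
    using fun_cong[OF 0, of "case_nat x (case_nat a (case_nat b undefined))"]
    unfolding wedge_1_2_eval[OF \<alpha> \<beta>] by (simp add: x1)
  have K: "a \<in> K" if "\<alpha> (\<lambda>_. a) = 0" "eval2 \<beta> x a = 0" for a
    using that unfolding K_def by (simp add: eq[of a])
  \<comment> \<open>By \<open>eq\<close>, the common zeros of \<alpha> and \<iota>_x \<beta> lie in
    the kernel \<open>K\<close>. Two vectors dual to these functionals therefore complete a basis of
    \<open>K\<close> to a spanning set with at most four elements; if \<iota>_x \<beta> = 0,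
    \<open>x\<close> alone suffices.\<close>
  have "\<exists>y. \<forall>a. a \<in> span (insert x (insert y B))"
  proof (cases "\<forall>y. eval2 \<beta> x y = 0")
    case True
    have "a \<in> span (insert x (insert x B))" for a
    proof -
      have "a - \<alpha> (\<lambda>_. a) *\<^sub>R x \<in> K"
        by (rule K) (simp_all add: linear_diff[OF la] linear_cmul[OF la] x1 True)
      then have "a - \<alpha> (\<lambda>_. a) *\<^sub>R x \<in> span B" using B(3) by blast
      then show ?thesis by (auto simp: span_insert)
    qed
    then show ?thesis by blast
  next
    case False
    then obtain y0 where y0: "eval2 \<beta> x y0 \<noteq> 0" by blast
    define y where "y = (1 / eval2 \<beta> x y0) *\<^sub>R (y0 - \<alpha> (\<lambda>_. y0) *\<^sub>R x)"
    have y: "eval2 \<beta> x y = 1" "\<alpha> (\<lambda>_. y) = 0"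
      using y0 by (simp_all add: y_def linear_diff[OF la] linear_cmul[OF la] linear_diff[OF lb(1)]
          linear_cmul[OF lb(1)] form2_alt(1)[OF \<beta>] x1)
    have "a \<in> span (insert x (insert y B))" for a
    proof -
      have "a - \<alpha> (\<lambda>_. a) *\<^sub>R x - eval2 \<beta> x a *\<^sub>R y \<in> K"
        by (rule K) (simp_all add: linear_diff[OF la] linear_cmul[OF la] linear_diff[OF lb(1)]
            linear_cmul[OF lb(1)] form2_alt(1)[OF \<beta>] x1 y)
      then have "a - \<alpha> (\<lambda>_. a) *\<^sub>R x - eval2 \<beta> x a *\<^sub>R y \<in> span B" using B(3) by blast
      then show ?thesis by (auto simp: span_insert)
    qed
    then show ?thesis by blast
  qed
  then obtain y where y: "\<And>a. a \<in> span (insert x (insert y B))" by blast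
  obtain C :: "'v set" where C: "independent C" "card C = 6"
    using basis_exists[of "UNIV :: 'v set"] dim by metis
  have "card C \<le> card (insert x (insert y B))"
    using independent_span_bound[OF _ C(1), of "insert x (insert y B)"] \<open>finite B\<close> y by auto
  also have "\<dots> \<le> 4"
    using B(4) \<open>finite B\<close> by (simp add: card_insert_if)
  finally show False using C(2) by simp
qed

text \<open>In dimension six the kernel is a plane, and the independent kernel vectors
  \<open>p\<close> and \<open>q\<close> span it.\<close>

lemma rank_4_kernel:
  fixes \<beta> :: "'v::real_vector form"
  assumes rank: "form2_rank \<beta> = 4" and dim: "dim (UNIV :: 'v set) = 6"
    and p: "\<And>u. eval2 \<beta> p u = 0" and q: "\<And>u. eval2 \<beta> q u = 0"
    and pq: "p \<noteq> 0" "q \<notin> span {p}" and w: "\<And>u. eval2 \<beta> w u = 0"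
  shows "\<exists>a b. w = a *\<^sub>R p + b *\<^sub>R q"
proof -
  define K where "K = {v. \<forall>w. eval2 \<beta> v w = 0}"
  have "dim K = 2"
    using rank dim unfolding form2_rank_def K_def by simp
  then obtain B where B: "B \<subseteq> K" "independent B" "K \<subseteq> span B" "card B = 2"
    using basis_exists[of K] by metis
  have "finite B" using B(4) card_ge_0_finite by force
  have ind: "independent {q, p}"
    using pq by (simp add: independent_insert)
  have ne: "q \<noteq> p" using pq(2) span_base by blast
  have "w \<in> span {q, p}"
  proof (rule ccontr)
    assume nw: "w \<notin> span {q, p}"
    then have "independent {w, q, p}"
      using ind by (rule independent_insertI)
    moreover have "{w, q, p} \<subseteq> span B"
      using B(3) p q w unfolding K_def by blast
    ultimately have "card {w, q, p} \<le> 2"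
      using independent_span_bound[OF \<open>finite B\<close>] B(4) by metis
    moreover have "w \<noteq> q" "w \<noteq> p" using nw span_base by blast+
    ultimately show False using ne by simp
  qed
  then obtain b where "w - b *\<^sub>R q \<in> span {p}" by (auto simp: span_insert)
  then obtain a where "w - b *\<^sub>R q = a *\<^sub>R p" by (auto simp: span_singleton)
  then have "w = a *\<^sub>R p + b *\<^sub>R q" by (simp add: algebra_simps)
  then show ?thesis by blast
qed

lemma exists_nonzero: "\<exists>v::'v::real_vector. v \<noteq> 0" if dim: "dim (UNIV :: 'v set) = n" "0 < n"
proof -
  obtain b :: "nat \<Rightarrow> 'v" and c where db: "dual_bases n b c"
    using exists_dual_bases[OF dim] by auto
  then have "b 0 \<noteq> 0"
    using dual_bases_eval[OF db, of 0 0] linear_0[OF dual_bases_linear[OF db, of 0]] dim by auto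
  then show ?thesis by blast
qed

text \<open>If \<open>\<omega>\<^sup>3 = 0\<close>, the description defining \<^const>\<open>su3_S\<close> has the same solutions for \<open>v\<close> and \<open>- v\<close>, so that
  \<open>g(- v, - v) = - g(v, v)\<close> whatever the value of the description operator is.\<close>

lemma su3_orientation_nonzero:
  assumes su3: "su3_structure \<omega> \<psi>"
  shows "form2_cube \<omega> \<noteq> (\<lambda>x. 0)"
proof
  assume 0: "form2_cube \<omega> = (\<lambda>x. 0)"
  have \<omega>: "is_form 2 \<omega>" and \<psi>: "is_form (Suc 2) \<psi>" and dim: "dim (UNIV :: 'a set) = 6"
    and pos: "\<And>v. v \<noteq> 0 \<Longrightarrow> su3_metric \<omega> \<psi> v v > 0"
    using su3 unfolding su3_structure_def by auto
  have "su3_S (form2_cube \<omega>) \<psi> (- v) = su3_S (form2_cube \<omega>) \<psi> v" for v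
    unfolding su3_S_def 0 contract_uminus_vec[OF \<psi>] wedge_minus_left by (simp add: fun_eq_iff)
  then have "su3_metric \<omega> \<psi> (- v) (- v) = - su3_metric \<omega> \<psi> v v" for v
    unfolding su3_metric_def induced_J_def by (simp add: linear_neg[OF form2_linear(2)[OF \<omega>]])
  moreover obtain v :: 'a where "v \<noteq> 0"
    using exists_nonzero[OF dim] by auto
  ultimately show False
    using pos[of v] pos[of "- v"] by simp
qed

lemma is_form_form2_square: "is_form 2 \<omega> \<Longrightarrow> is_form 4 (form2_square \<omega>)"
  using is_form_wedge[of 2 \<omega> 2 \<omega>] by (simp add: form2_square_def)

lemma is_form_form2_cube: "is_form 2 \<omega> \<Longrightarrow> is_form 6 (form2_cube \<omega>)"
  using is_form_wedge[OF is_form_form2_square, of \<omega> 2 \<omega>] by (simp add: form2_cube_def)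

lemma is_form_wedge_2_3: "is_form 2 \<alpha> \<Longrightarrow> is_form 3 \<beta> \<Longrightarrow> is_form 5 (wedge 2 3 \<alpha> \<beta>)"
  using is_form_wedge[of 2 \<alpha> 3 \<beta>] by simp

section \<open>The endomorphism S and the complex structure\<close>

lemma su3_S_unique_existence:
  assumes su3: "su3_structure \<omega> \<psi>"
  shows "\<exists>!s. \<forall>\<eta>. is_form 1 \<eta> \<longrightarrow>
    wedge 5 1 (wedge 2 3 (contract v \<psi>) \<psi>) \<eta> = (\<lambda>x. \<eta> (\<lambda>_. s) * form2_cube \<omega> x)"
proof -
  have \<omega>: "is_form 2 \<omega>" and \<psi>: "is_form 3 \<psi>" and dim: "dim (UNIV :: 'a set) = 6"
    using su3 unfolding su3_structure_def by auto
  obtain b :: "nat \<Rightarrow> 'a" and c where "dual_bases 6 b c"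
    using exists_dual_bases[OF dim] by auto
  then have db: "dual_bases (Suc 5) b c" by simp
  have \<Omega>: "is_form (Suc 5) (form2_cube \<omega>)" using is_form_form2_cube[OF \<omega>] by simp
  show ?thesis
    by (rule codim1_form_vector[OF db \<Omega> su3_orientation_nonzero[OF su3]
        is_form_wedge_2_3[OF is_form_contract_3[OF \<psi>] \<psi>]])
qed

lemma su3_S_works:
  assumes "su3_structure \<omega> \<psi>" "is_form 1 \<eta>"
  shows "wedge 5 1 (wedge 2 3 (contract v \<psi>) \<psi>) \<eta> =
    (\<lambda>x. \<eta> (\<lambda>_. su3_S (form2_cube \<omega>) \<psi> v) * form2_cube \<omega> x)"
  unfolding su3_S_def by (rule theI'[OF su3_S_unique_existence[OF assms(1)], rule_format, OF assms(2)])

lemma su3_S_unique: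
  assumes "su3_structure \<omega> \<psi>"
    and "\<And>\<eta>. is_form 1 \<eta> \<Longrightarrow> wedge 5 1 (wedge 2 3 (contract v \<psi>) \<psi>) \<eta> =
      (\<lambda>x. \<eta> (\<lambda>_. s) * form2_cube \<omega> x)"
  shows "su3_S (form2_cube \<omega>) \<psi> v = s"
  unfolding su3_S_def
  by (rule the1_equality[OF su3_S_unique_existence[OF assms(1)]]) (intro allI impI assms(2))

lemma linear_su3_S:
  assumes su3: "su3_structure \<omega> \<psi>"
  shows "linear (su3_S (form2_cube \<omega>) \<psi>)"
proof (rule linearI)
  have \<psi>: "is_form (Suc 2) \<psi>"
    using su3 unfolding su3_structure_def by simp
  have lin: "linear (\<lambda>v. \<eta> (\<lambda>_. v))" if "is_form 1 \<eta>" for \<eta> :: "'a form"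
    using is_form_linear_head[of 0 \<eta>] that form1_eval[OF that] by simp
  fix v w and r :: real
  show "su3_S (form2_cube \<omega>) \<psi> (v + w) = su3_S (form2_cube \<omega>) \<psi> v + su3_S (form2_cube \<omega>) \<psi> w"
    by (rule su3_S_unique[OF su3])
      (simp del: One_nat_def add: contract_add_vec[OF \<psi>] wedge_add_left su3_S_works[OF su3]
        linear_add[OF lin] distrib_right)
  show "su3_S (form2_cube \<omega>) \<psi> (r *\<^sub>R v) = r *\<^sub>R su3_S (form2_cube \<omega>) \<psi> v"
    by (rule su3_S_unique[OF su3])
      (simp del: One_nat_def add: contract_scale_vec[OF \<psi>] wedge_cmult_left su3_S_works[OF su3]
        linear_cmul[OF lin] mult.assoc)
qed

text \<open>Contracting \<omega> \<and> \<psi> = 0 with w gives \<psi> \<and> \<iota>_w \<omega> =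
  \<iota>_w \<psi> \<and> \<omega>. Hence \<omega>(w, Sv) \<omega>^3 = \<iota>_v \<psi> \<and>
  \<iota>_w \<psi> \<and> \<omega>, which is symmetric because 2-forms commute.\<close>

lemma su3_S_omega_symmetric:
  assumes su3: "su3_structure \<omega> \<psi>"
  defines "S \<equiv> su3_S (form2_cube \<omega>) \<psi>"
  shows "eval2 \<omega> w (S v) = eval2 \<omega> v (S w)"
proof -
  have \<omega>: "is_form 2 \<omega>" and \<psi>: "is_form 3 \<psi>" and 0: "wedge 2 3 \<omega> \<psi> = (\<lambda>_. 0)"
    using su3 unfolding su3_structure_def by auto
  note \<kappa> = is_form_contract_3[OF \<psi>] and \<iota> = is_form_contract_2[OF \<omega>]
  have eq: "(\<lambda>x. eval2 \<omega> w (S v) * form2_cube \<omega> x) =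
      wedge 4 2 (wedge 2 2 (contract v \<psi>) (contract w \<psi>)) \<omega>" for v w
  proof -
    have "(\<lambda>x. wedge 1 3 (contract w \<omega>) \<psi> x + wedge 2 2 \<omega> (contract w \<psi>) x) = (\<lambda>_. 0)"
      using wedge_contract[OF \<omega> \<psi>, of w] by (simp add: 0 contract_zero)
    then have "wedge 3 1 \<psi> (contract w \<omega>) = wedge 2 2 \<omega> (contract w \<psi>)"
      using wedge_commute[OF \<psi> \<iota>, of w] by (simp add: fun_eq_iff add_eq_0_iff)
    also have "\<dots> = wedge 2 2 (contract w \<psi>) \<omega>"
      using wedge_commute[OF \<omega> \<kappa>, of w] by simp
    finally have 1: "wedge 3 1 \<psi> (contract w \<omega>) = wedge 2 2 (contract w \<psi>) \<omega>" .
    have "(\<lambda>x. eval2 \<omega> w (S v) * form2_cube \<omega> x) = wedge 5 1 (wedge 2 3 (contract v \<psi>) \<psi>) (contract w \<omega>)"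
      unfolding su3_S_works[OF su3 \<iota>] by (simp add: S_def contract_case_nat)
    also have "\<dots> = wedge 2 4 (contract v \<psi>) (wedge 3 1 \<psi> (contract w \<omega>))"
      using wedge_assoc[OF \<kappa> \<psi> \<iota>, of v w] by simp
    also have "\<dots> = wedge 4 2 (wedge 2 2 (contract v \<psi>) (contract w \<psi>)) \<omega>"
      unfolding 1 using wedge_assoc[OF \<kappa> \<kappa> \<omega>, of v w] by simp
    finally show ?thesis .
  qed
  have "wedge 2 2 (contract v \<psi>) (contract w \<psi>) = wedge 2 2 (contract w \<psi>) (contract v \<psi>)"
    using wedge_commute[OF \<kappa> \<kappa>, of v w] by simp
  then have "(\<lambda>x. eval2 \<omega> w (S v) * form2_cube \<omega> x) = (\<lambda>x. eval2 \<omega> v (S w) * form2_cube \<omega> x)"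
    unfolding eq by simp
  moreover obtain x where "form2_cube \<omega> x \<noteq> 0"
    using su3_orientation_nonzero[OF su3] by blast
  ultimately show ?thesis
    by (metis mult_cancel_right)
qed

text \<open>With \<open>\<kappa> = \<iota>\<^sub>v \<psi>\<close> one has \<open>\<kappa> \<and> \<psi> = - \<iota>\<^sub>S\<^sub>v \<Omega>\<close>, hence \<open>\<kappa> \<and> \<kappa> = - \<iota>\<^sub>v \<iota>\<^sub>S\<^sub>v \<Omega>\<close> and
  \<open>2 (\<iota>\<^sub>S\<^sub>v \<kappa>) \<and> \<kappa> = \<iota>\<^sub>S\<^sub>v (\<kappa> \<and> \<kappa>) = 0\<close>; now \<open>\<kappa>\<close> has rank four.\<close>

lemma su3_S_psi:
  assumes su3: "su3_structure \<omega> \<psi>"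
  defines "S \<equiv> su3_S (form2_cube \<omega>) \<psi>"
  shows "eval3 \<psi> v (S v) u = 0"
proof (cases "v = 0")
  case True
  have "is_form 3 \<psi>" using su3 unfolding su3_structure_def by auto
  then show ?thesis
    using True linear_0[OF form3_linear(3)] by blast
next
  case False
  have \<omega>: "is_form 2 \<omega>" and \<psi>: "is_form 3 \<psi>" and dim: "dim (UNIV :: 'a set) = 6"
    and rank: "form2_rank (contract v \<psi>) = 4"
    using su3 False unfolding su3_structure_def by auto
  obtain b :: "nat \<Rightarrow> 'a" and c where "dual_bases 6 b c"
    using exists_dual_bases[OF dim] by auto
  then have db: "dual_bases (Suc 5) b c" by simp
  have \<Omega>: "is_form (Suc 5) (form2_cube \<omega>)" using is_form_form2_cube[OF \<omega>] by simp
  define \<kappa> where "\<kappa> = contract v \<psi>"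
  have \<kappa>: "is_form 2 \<kappa>" unfolding \<kappa>_def by (rule is_form_contract_3[OF \<psi>])
  have \<iota>: "is_form 1 (contract s \<kappa>)" for s by (rule is_form_contract_2[OF \<kappa>])
  have "wedge 2 3 \<kappa> \<psi> = (\<lambda>x. - contract (S v) (form2_cube \<omega>) x)"
    using codim1_form_eq_contract[OF db \<Omega> is_form_wedge_2_3[OF \<kappa> \<psi>], of "S v"]
      su3_S_works[OF su3, of _ v] unfolding S_def \<kappa>_def by simp
  then have "contract v (wedge 2 3 \<kappa> \<psi>) = contract v (\<lambda>x. - contract (S v) (form2_cube \<omega>) x)"
    by (rule arg_cong)
  moreover have "contract v (wedge 2 3 \<kappa> \<psi>) = wedge 2 2 \<kappa> \<kappa>"
  proof -
    have "contract v \<kappa> = (\<lambda>x. 0)"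
      using contract_contract_same[of 1 \<psi> v] \<psi> by (simp add: \<kappa>_def eval_nat_numeral)
    then show ?thesis
      using wedge_contract[OF \<kappa> \<psi>, of v] by (simp add: wedge_zero_left flip: \<kappa>_def)
  qed
  ultimately have "wedge 2 2 \<kappa> \<kappa> = (\<lambda>x. - contract v (contract (S v) (form2_cube \<omega>)) x)"
    by (simp add: contract_minus)
  then have "contract (S v) (wedge 2 2 \<kappa> \<kappa>) = (\<lambda>x. - contract (S v) (contract v (contract (S v) (form2_cube \<omega>))) x)"
    by (simp add: contract_minus)
  also have "\<dots> = (\<lambda>x. 0)"
  proof -
    have f: "is_form (Suc (Suc 4)) (form2_cube \<omega>)" "is_form (Suc (Suc 3)) (contract (S v) (form2_cube \<omega>))"
      using \<Omega> is_form_contract[OF \<Omega>] by simp_all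
    show ?thesis
      unfolding contract_swap[OF f(2), of "S v" v] contract_contract_same[OF f(1)] contract_zero by simp
  qed
  finally have "contract (S v) (wedge 2 2 \<kappa> \<kappa>) = (\<lambda>x. 0)" .
  moreover have "contract (S v) (wedge 2 2 \<kappa> \<kappa>) = (\<lambda>x. 2 * wedge 1 2 (contract (S v) \<kappa>) \<kappa> x)"
    using wedge_contract[OF \<kappa> \<kappa>, of "S v"] wedge_commute[OF \<kappa> \<iota>, of "S v"] by (simp add: fun_eq_iff)
  ultimately have "wedge 1 2 (contract (S v) \<kappa>) \<kappa> = (\<lambda>x. 0)"
    by (simp add: fun_eq_iff)
  from wedge_1_2_eq_0[OF \<iota> \<kappa> this _ dim] rank show ?thesis
    unfolding \<kappa>_def contract_case_nat by blast
qed

text \<open>Compare \<open>A\<close> on v, v0 and v + v0: either the factors of v and v + v0 agree,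
  and then so does that of v0, or v is a multiple of v0.\<close>

lemma scalar_of_pointwise_scalar:
  assumes A: "linear A" and p: "\<And>v::'v::real_vector. \<exists>r. A v = r *\<^sub>R v"
  shows "\<exists>r. \<forall>v. A v = r *\<^sub>R v"
proof (cases "\<exists>v::'v. v \<noteq> 0")
  case True
  then obtain v0 :: 'v where v0: "v0 \<noteq> 0" by blast
  obtain r where r: "A v0 = r *\<^sub>R v0" using p by blast
  have "A v = r *\<^sub>R v" for v
  proof -
    obtain s where s: "A v = s *\<^sub>R v" using p by blast
    obtain t where "A (v + v0) = t *\<^sub>R (v + v0)" using p by blast
    then have e: "(s - t) *\<^sub>R v = (t - r) *\<^sub>R v0"
      by (simp add: linear_add[OF A] r s algebra_simps)
    show ?thesis
    proof (cases "s = t")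
      case True
      then show ?thesis using e v0 s by simp
    next
      case False
      then have "v = ((t - r) / (s - t)) *\<^sub>R v0"
        using e by (metis (no_types) divide_inverse_commute eq_iff_diff_eq_0 scaleR_left_imp_eq scaleR_scaleR
            right_inverse scaleR_one inverse_eq_divide mult.commute)
      then show ?thesis
        by (simp add: linear_cmul[OF A] r)
    qed
  qed
  then show ?thesis by blast
next
  case False
  then have "A v = 0 *\<^sub>R v" for v
    using linear_0[OF A] by (metis scaleR_zero_left)
  then show ?thesis by blast
qed

text \<open>As \<open>\<iota>\<^sub>v \<psi>\<close> is annihilated by \<open>v\<close>, \<open>S v\<close> and, by polarization, \<open>S\<^sup>2 v\<close>, one has \<open>S\<^sup>2 v = a v + b S v\<close>; the symmetry
  of \<open>\<omega>(\<cdot>, S \<cdot>)\<close> forces \<open>b = 0\<close>, and its definiteness forces \<open>a < 0\<close>.\<close>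

lemma su3_J_properties:
  assumes su3: "su3_structure \<omega> \<psi>"
  defines "J \<equiv> su3_J \<omega> \<psi>"
  shows "linear J" "J (J v) = - v" "eval2 \<omega> w (J v) = eval2 \<omega> v (J w)" "eval3 \<psi> v (J v) u = 0"
proof -
  define S where "S = su3_S (form2_cube \<omega>) \<psi>"
  define k where "k = 1 / sqrt (- su3_P (form2_cube \<omega>) \<psi>)"
  have \<omega>: "is_form 2 \<omega>" and \<psi>: "is_form 3 \<psi>" and dim: "dim (UNIV :: 'a set) = 6"
    and rank: "\<And>v. v \<noteq> 0 \<Longrightarrow> form2_rank (contract v \<psi>) = 4"
    and pos: "\<And>v. v \<noteq> 0 \<Longrightarrow> su3_metric \<omega> \<psi> v v > 0"
    using su3 unfolding su3_structure_def by auto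
  have JS: "J v = k *\<^sub>R S v" for v
    unfolding J_def induced_J_def k_def S_def ..
  note lS = linear_su3_S[OF su3, folded S_def] and sym = su3_S_omega_symmetric[OF su3, folded S_def]
    and T0 = su3_S_psi[OF su3, folded S_def]
  note l\<omega> = form2_linear[OF \<omega>] and l\<psi> = form3_linear[OF \<psi>] and alt = form2_alt[OF \<omega>] and alt3 = form3_alt[OF \<psi>]
  \<comment> \<open>As long as \<open>su3_P\<close> is not evaluated, nothing is known about
    \<open>k\<close>, not even its sign; only the positivity of the product can be used.\<close>
  have kpos: "k * eval2 \<omega> v (S v) > 0" if "v \<noteq> 0" for v
    using pos[OF that] JS by (simp add: su3_metric_def linear_cmul[OF l\<omega>(1)] flip: J_def)
  \<comment> \<open>Polarization of \<psi>(v, Sv, u) = 0. With Sv as second vector it shows that S^2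
    v annihilates \<iota>_v \<psi> as well.\<close>
  have T1: "eval3 \<psi> a (S b) u = - eval3 \<psi> b (S a) u" for a b u
    using T0[of "a + b" u]
    by (simp add: linear_add[OF lS] linear_add[OF l\<psi>(2)] linear_add[OF l\<psi>(3)] T0)
  have pw: "\<exists>r. S (S v) = r *\<^sub>R v \<and> (v \<noteq> 0 \<longrightarrow> r < 0)" for v
  proof (cases "v = 0")
    case True
    then show ?thesis by (simp add: linear_0[OF lS])
  next
    case False
    have nz: "eval2 \<omega> v (S v) \<noteq> 0" using kpos[OF False] by auto
    have "S v \<notin> span {v}"
      using nz by (auto simp: span_singleton linear_cmul[OF l\<omega>(1)] alt(1))
    moreover have "eval3 \<psi> v (S (S v)) u = 0" for u
      using T1[of v "S v" u] by (simp add: alt3(1))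
    ultimately obtain a b where ab: "S (S v) = a *\<^sub>R v + b *\<^sub>R S v"
      using rank_4_kernel[OF rank[OF False] dim, of v "S v" "S (S v)"] T0 alt3(1) False by blast
    have "eval2 \<omega> v (S (S v)) = 0"
      using sym[of v "S v"] by (simp add: alt(1))
    then have "b = 0"
      using nz by (simp add: ab linear_add[OF l\<omega>(1)] linear_cmul[OF l\<omega>(1)] alt(1))
    then have a: "S (S v) = a *\<^sub>R v" using ab by simp
    have "a \<noteq> 0 \<or> S v = 0"
    proof (rule ccontr)
      assume "\<not> (a \<noteq> 0 \<or> S v = 0)"
      then show False using kpos[of "S v"] a by (simp add: linear_0[OF l\<omega>(1)])
    qed
    moreover have "S v \<noteq> 0" using nz linear_0[OF l\<omega>(1)] by auto
    \<comment> \<open>Positivity at Sv is compared with positivity at v; the two values differ by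
      the factor -a, so a is negative.\<close>
    moreover have "k * eval2 \<omega> (S v) (S (S v)) = - a * (k * eval2 \<omega> v (S v))"
      using alt(2)[of "S v" v] by (simp add: a linear_cmul[OF l\<omega>(1)])
    ultimately have "- a * (k * eval2 \<omega> v (S v)) > 0"
      using kpos[of "S v"] by simp
    from zero_less_mult_pos2[OF this kpos[OF False]] have "a < 0" by simp
    then show ?thesis using a by blast
  qed
  have "linear (\<lambda>v. S (S v))"
    using linear_compose[OF lS lS] by (simp add: comp_def)
  then obtain r where r: "\<And>v. S (S v) = r *\<^sub>R v"
    using scalar_of_pointwise_scalar[of "\<lambda>v. S (S v)"] pw by blast
  obtain v0 :: 'a where v0: "v0 \<noteq> 0"
    using exists_nonzero[OF dim] by auto
  have "r < 0"
    using pw[of v0] r v0 by auto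
  have "su3_P (form2_cube \<omega>) \<psi> = r"
    unfolding su3_P_def S_def[symmetric]
  proof (rule the_equality)
    show "\<forall>v. S (S v) = r *\<^sub>R v" using r by blast
    fix P assume "\<forall>v. S (S v) = P *\<^sub>R v"
    then have "P *\<^sub>R v0 = r *\<^sub>R v0" using r by metis
    then show "P = r" using v0 by simp
  qed
  then have k: "k * (k * r) = - 1"
    using \<open>r < 0\<close> by (simp add: k_def field_simps)
  show "linear J"
    unfolding JS[abs_def] by (rule linear_compose_scale_right[OF lS])
  show "J (J v) = - v"
    using k by (simp add: JS linear_cmul[OF lS] r)
  show "eval2 \<omega> w (J v) = eval2 \<omega> v (J w)"
    by (simp add: JS linear_cmul[OF l\<omega>(1)] sym[of w v])
  show "eval3 \<psi> v (J v) u = 0"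
    by (simp add: JS linear_cmul[OF l\<psi>(2)] T0)
qed

section \<open>Orthonormal and unitary frames\<close>

lemma span_eq_UNIV_card:
  fixes B :: "'v::real_vector set"
  assumes "dim (UNIV :: 'v set) = n" "finite B" "\<And>x. x \<in> span B"
  shows "n \<le> card B"
proof -
  obtain C :: "'v set" where C: "independent C" "card C = n"
    using basis_exists[of "UNIV :: 'v set"] assms(1) by metis
  then show ?thesis
    using independent_span_bound[OF assms(2) C(1)] assms(3) by auto
qed

text \<open>One Gram-Schmidt step, starting from a vector outside the span, which exists because m <
  n.\<close>

lemma orthonormal_extend:
  fixes g :: "'v::real_vector \<Rightarrow> 'v \<Rightarrow> real"
  assumes lin: "\<And>x. linear (\<lambda>y. g y x)" and sym: "\<And>x y. g x y = g y x" and pos: "\<And>x. x \<noteq> 0 \<Longrightarrow> g x x > 0"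
    and dim: "dim (UNIV :: 'v set) = n" and m: "m < n"
    and on: "\<And>i j. i < m \<Longrightarrow> j < m \<Longrightarrow> g (e i) (e j) = of_bool (i = j)"
  shows "\<exists>x. g x x = 1 \<and> (\<forall>i<m. g x (e i) = 0)"
proof -
  have "\<exists>x. x \<notin> span (e ` {..<m})"
  proof (rule ccontr)
    assume "\<not> ?thesis"
    then have "n \<le> card (e ` {..<m})"
      by (intro span_eq_UNIV_card[OF dim]) auto
    then show False using m card_image_le[of "{..<m}" e] by simp
  qed
  then obtain x where x: "x \<notin> span (e ` {..<m})" by blast
  define y where "y = x - (\<Sum>i<m. g x (e i) *\<^sub>R e i)"
  have "(\<Sum>i<m. g x (e i) *\<^sub>R e i) \<in> span (e ` {..<m})"
    by (intro span_sum span_scale span_base) auto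
  then have "y \<noteq> 0" using x unfolding y_def by auto
  have orth: "g y (e j) = 0" if "j < m" for j
  proof -
    have "(\<Sum>i<m. g x (e i) * g (e i) (e j)) = (\<Sum>i<m. if i = j then g x (e j) else 0)"
      using that by (intro sum.cong) (auto simp: on)
    then show ?thesis
      using that by (simp add: y_def linear_diff[OF lin] linear_sum[OF lin] linear_cmul[OF lin])
  qed
  define s where "s = 1 / sqrt (g y y)"
  have "s * (s * g y y) = 1"
    using pos[OF \<open>y \<noteq> 0\<close>] by (simp add: s_def field_simps)
  moreover have "g v (r *\<^sub>R w) = r * g v w" for r :: real and v w
  proof -
    have "g v (r *\<^sub>R w) = g (r *\<^sub>R w) v" by (rule sym)
    also have "\<dots> = r * g w v" by (simp add: linear_cmul[OF lin])
    also have "g w v = g v w" by (rule sym)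
    finally show ?thesis .
  qed
  ultimately have "g (s *\<^sub>R y) (s *\<^sub>R y) = 1"
    by (simp add: linear_cmul[OF lin])
  moreover have "g (s *\<^sub>R y) (e j) = 0" if "j < m" for j
    using orth[OF that] by (simp add: linear_cmul[OF lin])
  ultimately show ?thesis by blast
qed

lemma orthonormal_dual_bases:
  fixes g :: "'v::real_vector \<Rightarrow> 'v \<Rightarrow> real"
  assumes lin: "\<And>x. linear (\<lambda>y. g y x)" and sym: "\<And>x y. g x y = g y x" and pos: "\<And>x. x \<noteq> 0 \<Longrightarrow> g x x > 0"
    and dim: "dim (UNIV :: 'v set) = n" "0 < n"
    and on: "\<And>i j. i < n \<Longrightarrow> j < n \<Longrightarrow> g (e i) (e j) = of_bool (i = j)"
  shows "dual_bases n e (\<lambda>i x. g x (e i))" "g = (\<lambda>x y. \<Sum>i<n. g x (e i) * g y (e i))"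
proof -
  have ind: "independent (e ` {..<n})" "inj_on e {..<n}"
    using biorthogonal_independent[of n "\<lambda>i x. g x (e i)" e] lin on by auto
  have sp: "x \<in> span (e ` {..<n})" for x
  proof (rule ccontr)
    assume x: "x \<notin> span (e ` {..<n})"
    then have ins: "independent (insert x (e ` {..<n}))"
      using ind(1) by (rule independent_insertI)
    have "card (insert x (e ` {..<n})) = Suc n"
      using x ind(2) span_base[of x "e ` {..<n}"] by (simp add: card_image card_insert_if) blast
    moreover obtain C :: "'v set" where C: "UNIV \<subseteq> span C" "card C = n" "independent C"
      using basis_exists[of "UNIV :: 'v set"] dim by metis
    moreover have "finite C" using C(2) dim(2) card_ge_0_finite by force
    ultimately show False
      using independent_span_bound[OF _ ins, of C] by auto
  qed
  have ex: "x = (\<Sum>i<n. g x (e i) *\<^sub>R e i)" for x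
  proof -
    obtain r where "x = (\<Sum>v\<in>e ` {..<n}. r v *\<^sub>R v)"
      using sp[of x] span_finite[of "e ` {..<n}"] by auto
    then have r: "x = (\<Sum>i<n. r (e i) *\<^sub>R e i)"
      by (simp add: sum.reindex[OF ind(2)])
    have "g x (e j) = r (e j)" if "j < n" for j
    proof -
      have "(\<Sum>i<n. r (e i) * g (e i) (e j)) = (\<Sum>i<n. if i = j then r (e j) else 0)"
        using that by (intro sum.cong) (auto simp: on)
      then show ?thesis
        using that by (subst r) (simp add: linear_sum[OF lin] linear_cmul[OF lin])
    qed
    then show ?thesis using r by simp
  qed
  show "dual_bases n e (\<lambda>i x. g x (e i))"
    unfolding dual_bases_def
  proof (intro conjI allI impI lin)
    show "g (e j) (e i) = of_bool (i = j)" if "i < n" "j < n" for i j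
      using on[OF that(2,1)] by (simp add: eq_commute)
  qed (rule ex)
  show "g = (\<lambda>x y. \<Sum>i<n. g x (e i) * g y (e i))"
  proof (intro ext)
    fix x y
    have "g x y = g (\<Sum>i<n. g x (e i) *\<^sub>R e i) y"
      by (simp flip: ex)
    also have "\<dots> = (\<Sum>i<n. g x (e i) * g (e i) y)"
      by (simp add: linear_sum[OF lin] linear_cmul[OF lin])
    also have "\<dots> = (\<Sum>i<n. g x (e i) * g y (e i))"
      by (intro sum.cong refl arg_cong2[of _ _ _ _ times] sym)
    finally show "g x y = (\<Sum>i<n. g x (e i) * g y (e i))" .
  qed
qed

text \<open>Exposes the first six frame vectors as nested \<open>case_nat\<close>, the shape on
  which \<open>wedge_eval\<close> works.\<close>

lemma frame_seq6: "e = case_nat (e 0) (case_nat (e 1) (case_nat (e 2) (case_nat (e 3)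
    (case_nat (e 4) (case_nat (e 5) (\<lambda>i. e (i + 6)))))))"
  by (rule ext) (simp add: eval_nat_numeral split: nat.split)

text \<open>By polarization J may be moved between any two slots. When J^2 = -1 this says that
  \<rho> has type (3,0) + (0,3).\<close>

lemma J_invariant_3_form:
  assumes \<rho>: "is_form 3 \<rho>" and J: "linear J" and 0: "\<And>v u. eval3 \<rho> v (J v) u = 0"
  shows "eval3 \<rho> (J a) b u = eval3 \<rho> a (J b) u" "eval3 \<rho> a b (J u) = eval3 \<rho> a (J b) u"
proof -
  note l = form3_linear[OF \<rho>] and alt = form3_alt[OF \<rho>]
  have sum0: "eval3 \<rho> a (J b) u + eval3 \<rho> b (J a) u = 0" for a b u
    using 0[of "a + b" u] by (simp add: linear_add[OF J] linear_add[OF l(2)] linear_add[OF l(3)] 0)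
  show 1: "eval3 \<rho> (J a) b u = eval3 \<rho> a (J b) u" for a b u
    using sum0[of a b u] alt(4)[of "J a" b u] by linarith
  have "eval3 \<rho> a b (J u) = eval3 \<rho> b (J u) a"
    using alt(4)[of a b "J u"] alt(5)[of b a "J u"] by simp
  also have "\<dots> = eval3 \<rho> (J b) u a"
    by (rule 1[symmetric])
  also have "\<dots> = eval3 \<rho> a (J b) u"
    using alt(5)[of "J b" u a] alt(4)[of "J b" a u] by simp
  finally show "eval3 \<rho> a b (J u) = eval3 \<rho> a (J b) u" .
qed

text \<open>The components of the real part of \<open>(a - i b) (e\<^sup>0 + i e\<^sup>1) \<and> (e\<^sup>2 + i e\<^sup>3) \<and> (e\<^sup>4 + i e\<^sup>5)\<close>.\<close>

definition complex_volume_table :: "(nat \<Rightarrow> 'v) \<Rightarrow> 'v form \<Rightarrow> real \<Rightarrow> real \<Rightarrow> bool" where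
  "complex_volume_table e \<rho> a b \<longleftrightarrow>
     eval3 \<rho> (e 0) (e 1) (e 2) = 0 \<and> eval3 \<rho> (e 0) (e 1) (e 3) = 0 \<and>
     eval3 \<rho> (e 0) (e 1) (e 4) = 0 \<and> eval3 \<rho> (e 0) (e 1) (e 5) = 0 \<and>
     eval3 \<rho> (e 0) (e 2) (e 3) = 0 \<and> eval3 \<rho> (e 0) (e 2) (e 4) = a \<and>
     eval3 \<rho> (e 0) (e 2) (e 5) = b \<and> eval3 \<rho> (e 0) (e 3) (e 4) = b \<and>
     eval3 \<rho> (e 0) (e 3) (e 5) = - a \<and> eval3 \<rho> (e 0) (e 4) (e 5) = 0 \<and>
     eval3 \<rho> (e 1) (e 2) (e 3) = 0 \<and> eval3 \<rho> (e 1) (e 2) (e 4) = b \<and>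
     eval3 \<rho> (e 1) (e 2) (e 5) = - a \<and> eval3 \<rho> (e 1) (e 3) (e 4) = - a \<and>
     eval3 \<rho> (e 1) (e 3) (e 5) = - b \<and> eval3 \<rho> (e 1) (e 4) (e 5) = 0 \<and>
     eval3 \<rho> (e 2) (e 3) (e 4) = 0 \<and> eval3 \<rho> (e 2) (e 3) (e 5) = 0 \<and>
     eval3 \<rho> (e 2) (e 4) (e 5) = 0 \<and> eval3 \<rho> (e 3) (e 4) (e 5) = 0"

text \<open>Moving J between slots kills every component containing a pair v, Jv. The eight
  components with one index from each pair reduce to two values up to sign.\<close>

lemma complex_volume_tableI:
  fixes e :: "nat \<Rightarrow> 'v::real_vector"
  assumes \<rho>: "is_form 3 \<rho>" and J: "linear J" and 0: "\<And>v u. eval3 \<rho> v (J v) u = 0"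
    and JJ: "\<And>v. J (J v) = - v" and e: "J (e 0) = e 1" "J (e 2) = e 3" "J (e 4) = e 5"
  shows "complex_volume_table e \<rho> (eval3 \<rho> (e 0) (e 2) (e 4)) (eval3 \<rho> (e 1) (e 2) (e 4))"
proof -
  note l = form3_linear[OF \<rho>] and alt = form3_alt[OF \<rho>]
  note inv = J_invariant_3_form[OF \<rho> J 0]
  have z1: "eval3 \<rho> u v (J v) = 0" for u v
    by (simp add: inv(2) inv(1)[symmetric] alt(2))
  show ?thesis
    unfolding complex_volume_table_def e[symmetric]
    by (simp add: 0 z1 alt(1-3) inv JJ linear_neg[OF l(1)] linear_neg[OF l(2)] linear_neg[OF l(3)])
qed

lemma sum_lessThan_6: "(\<Sum>i<(6::nat). f i) = f 0 + f 1 + f 2 + f 3 + f 4 + (f 5 :: real)"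
  by (simp add: eval_nat_numeral)

lemma less_6_cases: "(i::nat) < 6 \<Longrightarrow> i = 0 \<or> i = 1 \<or> i = 2 \<or> i = 3 \<or> i = 4 \<or> i = 5"
  by linarith

lemma unitary_frame_omega:
  fixes e :: "nat \<Rightarrow> 'v::real_vector"
  assumes \<omega>: "is_form 2 \<omega>" and JJ: "\<And>v. J (J v) = - v"
    and e: "J (e 0) = e 1" "J (e 2) = e 3" "J (e 4) = e 5"
    and on: "\<And>i j. i < 6 \<Longrightarrow> j < 6 \<Longrightarrow> eval2 \<omega> (e i) (J (e j)) = of_bool (i = j)"
    and ij: "i < 6" "j < 6"
  shows "eval2 \<omega> (e i) (e j) = (if even i \<and> j = i + 1 then 1 else if even j \<and> i = j + 1 then - 1 else 0)"
proof -
  have Je: "J (e 1) = - e 0" "J (e 3) = - e 2" "J (e 5) = - e 4"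
    using JJ[of "e 0"] JJ[of "e 2"] JJ[of "e 4"] by (simp_all add: e)
  have odd: "eval2 \<omega> (e i) (e 1) = of_bool (i = 0)" "eval2 \<omega> (e i) (e 3) = of_bool (i = 2)"
    "eval2 \<omega> (e i) (e 5) = of_bool (i = 4)"
    using on[of i 0] on[of i 2] on[of i 4] ij(1) unfolding e by simp_all
  have even: "eval2 \<omega> (e i) (e 0) = - of_bool (i = 1)" "eval2 \<omega> (e i) (e 2) = - of_bool (i = 3)"
    "eval2 \<omega> (e i) (e 4) = - of_bool (i = 5)"
    using on[of i 1] on[of i 3] on[of i 5] ij(1) linear_neg[OF form2_linear(1)[OF \<omega>]] unfolding Je by simp_all
  show ?thesis
    using less_6_cases[OF ij(2)] less_6_cases[OF ij(1)] odd even by (elim disjE) simp_all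
qed

text \<open>As J is isometric and g(v, Jv) = 0, a unit vector orthogonal to a J-invariant span has
  its J-image there as well. So Gram-Schmidt steps are made at sizes 0, 2 and 4 only, each adding a
  pair x, Jx.\<close>

lemma unitary_frame_exists:
  fixes \<omega> :: "'v::real_vector form"
  assumes \<omega>: "is_form 2 \<omega>" and dim: "dim (UNIV :: 'v set) = 6" and J: "linear J" and JJ: "\<And>v. J (J v) = - v"
    and sym: "\<And>v w. eval2 \<omega> w (J v) = eval2 \<omega> v (J w)" and pos: "\<And>v. v \<noteq> 0 \<Longrightarrow> eval2 \<omega> v (J v) > 0"
  obtains e where "J (e 0) = e 1" "J (e 2) = e 3" "J (e 4) = e (5::nat)"
    "\<And>i j. i < 6 \<Longrightarrow> j < 6 \<Longrightarrow> eval2 \<omega> (e i) (J (e j)) = of_bool (i = j)"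
proof -
  define g where "g v w = eval2 \<omega> v (J w)" for v w
  have lin: "linear (\<lambda>y. g y x)" for x
    unfolding g_def by (rule form2_linear(2)[OF \<omega>])
  have gs: "g v w = g w v" for v w
    unfolding g_def by (rule sym)
  have g0: "g v (J v) = 0" "g (J v) v = 0" for v
    using form2_alt(1)[OF \<omega>, of v] gs[of "J v" v] linear_neg[OF form2_linear(1)[OF \<omega>], of v v]
    unfolding g_def by (simp_all add: JJ)
  have gJ: "g (J v) w = - g v (J w)" for v w
    using form2_alt(2)[OF \<omega>, of "J v" "J w"] gs[of w "J v"] linear_neg[OF form2_linear(1)[OF \<omega>], of w v]
      form2_alt(2)[OF \<omega>, of w v] gs[of "J w" v] linear_neg[OF form2_linear(1)[OF \<omega>], of v w]
    unfolding g_def by (simp add: JJ)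
  have gJJ: "g (J v) (J w) = g v w" for v w
  proof -
    have "g v (- w) = g (- w) v" by (rule gs)
    also have "\<dots> = - g w v" by (simp add: linear_neg[OF lin])
    also have "g w v = g v w" by (rule gs)
    finally show ?thesis using gJ[of v "J w"] by (simp add: JJ)
  qed
  have gpos: "v \<noteq> 0 \<Longrightarrow> g v v > 0" for v
    unfolding g_def by (rule pos)
  note ext = orthonormal_extend[of g, OF lin gs gpos dim]
  obtain a0 where a0: "g a0 a0 = 1"
    using ext[of 0] by auto
  define e2 where "e2 = case_nat a0 (\<lambda>_. J a0)"
  have "\<exists>x. g x x = 1 \<and> (\<forall>i<2. g x (e2 i) = 0)"
    by (rule ext) (auto simp: e2_def a0 gJJ g0 less_2_cases_iff)
  then obtain a2 where x2: "g a2 a2 = 1" "\<forall>i<2. g a2 (e2 i) = 0" by blast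
  then have a2: "g a2 a2 = 1" "g a2 a0 = 0" "g a2 (J a0) = 0"
    using x2(2)[rule_format, of 0] x2(2)[rule_format, of 1] by (simp_all add: e2_def)
  have a2': "g (J a2) a0 = 0" "g (J a2) (J a0) = 0"
    using a2 by (simp_all add: gJ[of a2 a0] gJJ)
  have a2s: "g a0 a2 = 0" "g (J a0) a2 = 0" "g a0 (J a2) = 0"
    using a2 a2' gs[of a0 a2] gs[of "J a0" a2] gs[of a0 "J a2"] by simp_all
  define e4 where "e4 = case_nat a0 (case_nat (J a0) (case_nat a2 (\<lambda>_. J a2)))"
  have "\<exists>x. g x x = 1 \<and> (\<forall>i<4. g x (e4 i) = 0)"
  proof (rule ext[of 4])
    fix i j :: nat assume "i < 4" "j < 4"
    then have "(i = 0 \<or> i = 1 \<or> i = 2 \<or> i = 3) \<and> (j = 0 \<or> j = 1 \<or> j = 2 \<or> j = 3)" by linarith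
    then show "g (e4 i) (e4 j) = of_bool (i = j)"
      by (elim conjE disjE) (simp_all add: e4_def eval_nat_numeral a0 a2 a2' a2s gJJ g0)
  qed simp_all
  then obtain a4 where x: "g a4 a4 = 1" "\<forall>i<4. g a4 (e4 i) = 0" by blast
  then have a4: "g a4 a4 = 1" "g a4 a0 = 0" "g a4 (J a0) = 0" "g a4 a2 = 0" "g a4 (J a2) = 0"
    using x(2)[rule_format, of 0] x(2)[rule_format, of 1] x(2)[rule_format, of 2] x(2)[rule_format, of 3]
    by (simp_all add: e4_def eval_nat_numeral)
  have a4': "g (J a4) a0 = 0" "g (J a4) (J a0) = 0" "g (J a4) a2 = 0" "g (J a4) (J a2) = 0"
    using a4 by (simp_all add: gJ[of a4 a0] gJ[of a4 a2] gJJ)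
  have a4s: "g a0 a4 = 0" "g (J a0) a4 = 0" "g a0 (J a4) = 0" "g a2 a4 = 0" "g (J a2) a4 = 0" "g a2 (J a4) = 0"
    using a4 a4' gs[of a0 a4] gs[of "J a0" a4] gs[of a0 "J a4"] gs[of a2 a4] gs[of "J a2" a4] gs[of a2 "J a4"]
    by simp_all
  define e where "e = case_nat a0 (case_nat (J a0) (case_nat a2 (case_nat (J a2) (case_nat a4 (\<lambda>_::nat. J a4)))))"
  have "g (e i) (e j) = of_bool (i = j)" if "i < 6" "j < 6" for i j
    using less_6_cases[OF that(1)] less_6_cases[OF that(2)]
    by (elim disjE) (simp_all add: e_def eval_nat_numeral a0 a2 a2' a4 a4' gJJ g0 a2s a4s)
  moreover have "J (e 0) = e 1" "J (e 2) = e 3" "J (e 4) = e 5"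
    by (simp_all add: e_def eval_nat_numeral)
  ultimately show thesis
    by (intro that[of e]) (simp_all add: g_def)
qed

lemma complex_volume_table_0:
  assumes db: "dual_bases 6 e c" and \<rho>: "is_form 3 \<rho>" and t: "complex_volume_table e \<rho> 0 0"
  shows "\<rho> = (\<lambda>x. 0)"
proof (rule form_eq_0_increasing[OF db \<rho>])
  fix f :: "nat \<Rightarrow> nat"
  assume m: "strict_mono_on {..<3} f" and b: "\<And>i. i < 3 \<Longrightarrow> f i < 6"
  have f: "f 0 < f 1" "f 1 < f 2" "f 2 < 6"
    using strict_mono_onD[OF m, of 0 1] strict_mono_onD[OF m, of 1 2] b[of 2] by auto
  have "\<rho> (\<lambda>i. e (f i)) = \<rho> (case_nat (e (f 0)) (case_nat (e (f 1)) (case_nat (e (f 2)) (\<lambda>i. e (f i)))))"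
    by (rule is_form_cong[OF \<rho>]) (auto simp: eval_nat_numeral less_Suc_eq)
  also have "\<dots> = eval3 \<rho> (e (f 0)) (e (f 1)) (e (f 2))"
    by (rule form3_eval[OF \<rho>])
  also have "\<dots> = 0"
  proof -
    have "f 2 = 2 \<or> f 2 = 3 \<or> f 2 = 4 \<or> f 2 = 5" "f 1 = 1 \<or> f 1 = 2 \<or> f 1 = 3 \<or> f 1 = 4"
      "f 0 = 0 \<or> f 0 = 1 \<or> f 0 = 2 \<or> f 0 = 3"
      using f by linarith+
    then show ?thesis
      using f(1,2) by (elim disjE) (simp_all add: t[unfolded complex_volume_table_def] del: One_nat_def)
  qed
  finally show "\<rho> (\<lambda>i. e (f i)) = 0" .
qed

text \<open>In \<psi>(Ju, Jv, Jw) the last J is moved to the second slot, where J^2 = -1 removes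
  it.\<close>

lemma psi_minus_properties:
  fixes \<psi> :: "'v::real_vector form"
  assumes su3: "su3_structure \<omega> \<psi>"
  defines "J \<equiv> su3_J \<omega> \<psi>"
  shows "is_form 3 (psi_minus \<omega> \<psi>)" "eval3 (psi_minus \<omega> \<psi>) u v w = - eval3 \<psi> (J u) v w"
    "eval3 (psi_minus \<omega> \<psi>) v (J v) w = 0"
proof -
  have \<psi>: "is_form 3 \<psi>" using su3 unfolding su3_structure_def by auto
  note J = su3_J_properties[OF su3, folded J_def]
  note inv = J_invariant_3_form[OF \<psi> J(1) J(4)]
  show f: "is_form 3 (psi_minus \<omega> \<psi>)"
    unfolding psi_minus_def by (intro is_form_pullback \<psi> J(1)[unfolded J_def])
  show *: "eval3 (psi_minus \<omega> \<psi>) u v w = - eval3 \<psi> (J u) v w" for u v w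
  proof -
    have "eval3 (psi_minus \<omega> \<psi>) u v w = \<psi> (\<lambda>i. J (case_nat u (case_nat v (\<lambda>_. w)) i))"
      by (simp add: psi_minus_def pullback_def contract_case_nat J_def)
    also have "(\<lambda>i. J (case_nat u (case_nat v (\<lambda>_. w)) i)) = case_nat (J u) (case_nat (J v) (case_nat (J w) (\<lambda>_. J w)))"
      by (auto simp: fun_eq_iff split: nat.split)
    finally have "eval3 (psi_minus \<omega> \<psi>) u v w = eval3 \<psi> (J u) (J v) (J w)"
      unfolding form3_eval[OF \<psi>] .
    also have "\<dots> = eval3 \<psi> (J u) (J (J v)) w"
      by (rule inv(2))
    finally show ?thesis
      by (simp add: J(2) linear_neg[OF form3_linear(2)[OF \<psi>]])
  qed
  show "eval3 (psi_minus \<omega> \<psi>) v (J v) w = 0"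
    unfolding * by (simp add: form3_alt(1)[OF \<psi>])
qed

lemma complex_volume_wedge:
  fixes \<psi> \<rho> :: "'v::real_vector form"
  assumes \<psi>: "is_form 3 \<psi>" and \<rho>: "is_form 3 \<rho>"
    and t: "complex_volume_table e \<psi> r 0" "complex_volume_table e \<rho> 0 s"
  shows "wedge 3 3 \<psi> \<rho> e = 4 * (r * s)"
proof -
  have f: "is_form (Suc (Suc (Suc 0))) \<psi>" "is_form (Suc (Suc (Suc 0))) \<rho>"
    using \<psi> \<rho> by (simp_all add: eval_nat_numeral)
  have "wedge (Suc (Suc (Suc 0))) (Suc (Suc (Suc 0))) \<psi> \<rho> e = 4 * (r * s)"
    by (subst frame_seq6[of e])
      (simp add: wedge_eval f form3_eval[OF \<psi>] form3_eval[OF \<rho>]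
        t[unfolded complex_volume_table_def contract_case_nat One_nat_def])
  then show ?thesis by (simp add: eval_nat_numeral)
qed

definition standard_omega :: "(nat \<Rightarrow> 'v) \<Rightarrow> 'v form \<Rightarrow> bool" where
  "standard_omega e \<omega> \<longleftrightarrow> (\<forall>i<6. \<forall>j<6. eval2 \<omega> (e i) (e j) =
     (if even i \<and> j = i + 1 then 1 else if even j \<and> i = j + 1 then - 1 else 0))"

lemma standard_omega_wedge:
  fixes \<omega> :: "'v::real_vector form"
  assumes \<omega>: "is_form 2 \<omega>" and t: "standard_omega e \<omega>"
  shows "form2_cube \<omega> e = 6"
proof -
  have f: "is_form (Suc (Suc 0)) \<omega>" "is_form (Suc (Suc (Suc (Suc 0)))) (wedge (Suc (Suc 0)) (Suc (Suc 0)) \<omega> \<omega>)"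
    using \<omega> is_form_wedge[OF \<omega> \<omega>] by (simp_all add: eval_nat_numeral)
  have "wedge (Suc (Suc (Suc (Suc 0)))) (Suc (Suc 0)) (wedge (Suc (Suc 0)) (Suc (Suc 0)) \<omega> \<omega>) \<omega> e = 6"
    by (subst frame_seq6[of e])
      (simp add: wedge_eval f form2_eval[OF \<omega>] t[unfolded standard_omega_def, rule_format])
  then show ?thesis by (simp add: eval_nat_numeral form2_cube_def form2_square_def)
qed

text \<open>An adapted unitary frame: \<open>\<omega> = e\<^sup>0\<^sup>1 + e\<^sup>2\<^sup>3 + e\<^sup>4\<^sup>5\<close> and \<open>\<psi>\<^sub>+ + i \<psi>\<^sub>- = (e\<^sup>0 + i e\<^sup>1) \<and> (e\<^sup>2 + i e\<^sup>3) \<and> (e\<^sup>4 + i e\<^sup>5)\<close>.\<close>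

definition su3_frame :: "'v::real_vector form \<Rightarrow> 'v form \<Rightarrow> (nat \<Rightarrow> 'v) \<Rightarrow> (nat \<Rightarrow> 'v \<Rightarrow> real) \<Rightarrow> bool" where
  "su3_frame \<omega> \<psi> e c \<longleftrightarrow> dual_bases 6 e c \<and>
     su3_metric \<omega> \<psi> = (\<lambda>x y. \<Sum>i<6. c i x * c i y) \<and>
     standard_omega e \<omega> \<and>
     su3_J \<omega> \<psi> (e 0) = e 1 \<and> su3_J \<omega> \<psi> (e 2) = e 3 \<and> su3_J \<omega> \<psi> (e 4) = e 5 \<and>
     complex_volume_table e \<psi> 1 0 \<and> complex_volume_table e (psi_minus \<omega> \<psi>) 0 1"

text \<open>In any unitary frame, \<psi>_+ is the real part of a complex multiple of the standard
  complex volume form. A rotation of the last complex line makes this factor a positive real r, and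
  the normalization of the structure gives r = 1.\<close>

lemma su3_frame_exists:
  fixes \<omega> \<psi> :: "'v::real_vector form"
  assumes su3: "su3_structure \<omega> \<psi>"
  obtains e c where "su3_frame \<omega> \<psi> e c"
proof -
  define J where "J = su3_J \<omega> \<psi>"
  have \<omega>: "is_form 2 \<omega>" and \<psi>: "is_form 3 \<psi>" and dim: "dim (UNIV :: 'v set) = 6"
    and pos: "\<And>v. v \<noteq> 0 \<Longrightarrow> eval2 \<omega> v (J v) > 0"
    and norm: "\<And>x. 3 * wedge 3 3 \<psi> (psi_minus \<omega> \<psi>) x = 2 * form2_cube \<omega> x"
    using su3 unfolding su3_structure_def su3_metric_def J_def by auto
  note J = su3_J_properties[OF su3, folded J_def]
  note pm = psi_minus_properties[OF su3, folded J_def]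
  define g where "g = su3_metric \<omega> \<psi>"
  have g_eq: "g v w = eval2 \<omega> v (J w)" for v w
    by (simp add: g_def su3_metric_def J_def)
  have lin: "linear (\<lambda>y. g y x)" "linear (g x)" for x
    using form2_linear(2)[OF \<omega>] linear_compose[OF J(1) form2_linear(1)[OF \<omega>]]
    by (simp_all add: g_eq[abs_def] comp_def)
  have gs: "g v w = g w v" for v w
    unfolding g_eq by (rule J(3))
  have gpos: "v \<noteq> 0 \<Longrightarrow> g v v > 0" for v
    unfolding g_eq by (rule pos)
  obtain a where a: "J (a 0) = a 1" "J (a 2) = a 3" "J (a 4) = a (5::nat)"
    and aon: "\<And>i j. i < 6 \<Longrightarrow> j < 6 \<Longrightarrow> g (a i) (a j) = of_bool (i = j)"
    using unitary_frame_exists[OF \<omega> dim J(1-3) pos] unfolding g_eq by metis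
  define \<alpha> where "\<alpha> = eval3 \<psi> (a 0) (a 2) (a 4)"
  define \<beta> where "\<beta> = eval3 \<psi> (a 1) (a 2) (a 4)"
  define r where "r = sqrt (\<alpha>\<^sup>2 + \<beta>\<^sup>2)"
  have ta: "complex_volume_table a \<psi> \<alpha> \<beta>"
    unfolding \<alpha>_def \<beta>_def by (rule complex_volume_tableI[OF \<psi> J(1,4,2) a])
  \<comment> \<open>A vanishing factor would give \<psi> = 0 and then, by the normalization,
    \<omega>^3 = 0.\<close>
  have "\<not> (\<alpha> = 0 \<and> \<beta> = 0)"
  proof
    assume "\<alpha> = 0 \<and> \<beta> = 0"
    then have "\<psi> = (\<lambda>x. 0)"
      using complex_volume_table_0[OF orthonormal_dual_bases(1)[of g, OF lin(1) gs gpos dim _ aon] \<psi>] ta by simp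
    then have "wedge 3 3 \<psi> (psi_minus \<omega> \<psi>) = (\<lambda>x. 0)"
      using wedge_zero_left by metis
    then have "form2_cube \<omega> = (\<lambda>x. 0)"
      using norm by (intro ext) simp
    then show False
      using su3_orientation_nonzero[OF su3] by simp
  qed
  then have "\<alpha>\<^sup>2 + \<beta>\<^sup>2 > 0"
    by (simp add: sum_power2_gt_zero_iff)
  then have r: "r > 0" "\<alpha> * \<alpha> + \<beta> * \<beta> = r * r"
    unfolding r_def by (auto simp: power2_eq_square)
  \<comment> \<open>Cosine and sine of the argument of \<alpha> + i \<beta>.\<close>
  define p q where "p = \<alpha> / r" and "q = \<beta> / r"
  have "p * p + q * q = (\<alpha> * \<alpha> + \<beta> * \<beta>) / (r * r)" "p * \<alpha> + q * \<beta> = (\<alpha> * \<alpha> + \<beta> * \<beta>) / r"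
    by (simp_all add: p_def q_def add_divide_distrib)
  then have pq: "p * p + q * q = 1" "p * \<alpha> + q * \<beta> = r" "p * \<beta> = q * \<alpha>"
    using r(1) unfolding r(2) by (simp_all add: p_def q_def)
  define e where "e = a(4 := p *\<^sub>R a 4 + q *\<^sub>R a 5, 5 := p *\<^sub>R a 5 - q *\<^sub>R a 4)"
  have e_simps: "e 0 = a 0" "e 1 = a 1" "e 2 = a 2" "e 3 = a 3" "e 4 = p *\<^sub>R a 4 + q *\<^sub>R a 5"
    "e 5 = p *\<^sub>R a 5 - q *\<^sub>R a 4"
    by (simp_all add: e_def)
  have Je: "J (e 0) = e 1" "J (e 2) = e 3" "J (e 4) = e 5"
    using J(2)[of "a 4"] by (simp_all del: One_nat_def add: e_simps a linear_add[OF J(1)] linear_cmul[OF J(1)] algebra_simps)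
  have eon: "g (e i) (e j) = of_bool (i = j)" if "i < 6" "j < 6" for i j
    using less_6_cases[OF that(1)] less_6_cases[OF that(2)]
    by (elim disjE) (simp_all del: One_nat_def add: e_simps aon linear_add[OF lin(1)] linear_add[OF lin(2)]
        linear_diff[OF lin(1)] linear_diff[OF lin(2)] linear_cmul[OF lin(1)] linear_cmul[OF lin(2)]
        pq(1) add.commute[of "q * q"])
  note db = orthonormal_dual_bases[of g, OF lin(1) gs gpos dim _ eon, simplified]
  note ta' = ta[unfolded complex_volume_table_def]
  have "eval3 \<psi> (e 0) (e 2) (e 4) = r" "eval3 \<psi> (e 1) (e 2) (e 4) = 0"
    using pq by (simp_all del: One_nat_def add: e_simps ta' linear_add[OF form3_linear(1)[OF \<psi>]]
        linear_cmul[OF form3_linear(1)[OF \<psi>]])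
  then have te: "complex_volume_table e \<psi> r 0"
    using complex_volume_tableI[OF \<psi> J(1,4,2) Je] by simp
  then have "eval3 (psi_minus \<omega> \<psi>) (e 0) (e 2) (e 4) = 0" "eval3 (psi_minus \<omega> \<psi>) (e 1) (e 2) (e 4) = r"
    using J(2)[of "e 0"] unfolding pm(2)
    by (simp_all del: One_nat_def add: Je complex_volume_table_def linear_neg[OF form3_linear(3)[OF \<psi>]])
  then have tm: "complex_volume_table e (psi_minus \<omega> \<psi>) 0 r"
    using complex_volume_tableI[OF pm(1) J(1) pm(3) J(2) Je] by simp
  have om: "standard_omega e \<omega>"
    unfolding standard_omega_def
    using unitary_frame_omega[OF \<omega> J(2) Je] eon unfolding g_eq by blast
  \<comment> \<open>In the frame, 3 \<psi>_+ \<and> \<psi>_- = 2 \<omega>^3 reads 3 * 4 r^2 = 2 *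
    6.\<close>
  have "r * r = 1"
    using norm[of e] complex_volume_wedge[OF \<psi> pm(1) te tm] standard_omega_wedge[OF \<omega> om] by simp
  then have "r = 1"
    using r(1) by (simp add: square_eq_1_iff)
  have "su3_frame \<omega> \<psi> e (\<lambda>i x. g x (e i))"
    unfolding su3_frame_def using db om te tm Je \<open>r = 1\<close>
    by (simp add: g_def J_def)
  then show thesis by (rule that)
qed

section \<open>\<open>G\<^sub>2\<close>-structures in an adapted frame\<close>

text \<open>Here \<open>h\<close> need not be linear: the linearity of \<^const>\<open>induced_eta\<close> is deduced from that of \<open>\<phi>\<close>.\<close>

lemma wedge_2_1_function:
  fixes h :: "'v::real_vector \<Rightarrow> real"
  assumes \<alpha>: "is_form 2 \<alpha>"
  shows "wedge 2 1 \<alpha> (\<lambda>x. h (x 0)) (case_nat a (case_nat b (case_nat c y))) =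
    eval2 \<alpha> a b * h c - eval2 \<alpha> a c * h b + eval2 \<alpha> b c * h a"
proof -
  let ?\<eta> = "\<lambda>x. h (x 0)"
  have w: "contract v (wedge k (Suc 0) \<beta> ?\<eta>) =
    (\<lambda>x. (if k = 0 then 0 else wedge (k - 1) (Suc 0) (contract v \<beta>) ?\<eta> x) + (- 1) ^ k * wedge k 0 \<beta> (\<lambda>_. h v) x)"
    if "is_form k \<beta>" for k v and \<beta> :: "'v form"
    using wedge_contract_weak[where k = k and l = "Suc 0" and \<alpha> = \<beta> and \<beta> = ?\<eta> and v = v,
        OF is_form_cong[OF that] is_form_insert_at[OF that]]
    by (simp add: insert_at_def contract_def)
  have f: "is_form (Suc (Suc 0)) \<alpha>" "is_form (Suc 0) (contract v \<alpha>)" "is_form 0 (contract w (contract v \<alpha>))"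
    "is_form 0 (\<lambda>_::nat \<Rightarrow> 'v. r)" for v w r
    using \<alpha> is_form_contract[of 1 \<alpha> v] is_form_contract[of 0 "contract v \<alpha>" w]
    by (simp_all add: numeral_2_eq_2 is_form_0_iff)
  have "wedge 2 1 \<alpha> ?\<eta> (case_nat a (case_nat b (case_nat c y))) =
      contract c (contract b (contract a (wedge (Suc (Suc 0)) (Suc 0) \<alpha> ?\<eta>))) y"
    by (simp add: contract_case_nat numeral_2_eq_2)
  also have "\<dots> = eval2 \<alpha> a b * h c - eval2 \<alpha> a c * h b + eval2 \<alpha> b c * h a"
    by (simp add: w f contract_linear_simps wedge_0_right wedge_0_0)
       (simp add: contract_def form2_eval[OF \<alpha>])
  finally show ?thesis .
qed

lemma case_nat_const: "case_nat c (\<lambda>_. c) = (\<lambda>_. c)"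
  by (auto simp: fun_eq_iff split: nat.split)

lemmas wedge_2_1_function' = wedge_2_1_function[where y = "\<lambda>_. c" and c = c for c, unfolded case_nat_const]

lemma less_7_cases: "(i::nat) < 7 \<Longrightarrow> i < 6 \<or> i = 6"
  by linarith

lemma sum_lessThan_7_last: "(\<Sum>i<(7::nat). f i) = (\<Sum>i<6. f i) + (f 6 :: 'a::comm_monoid_add)"
  using sum.lessThan_Suc[of f 6] by simp

lemma frame_seq7: "E = case_nat (E 0) (case_nat (E 1) (case_nat (E 2) (case_nat (E 3)
    (case_nat (E 4) (case_nat (E 5) (case_nat (E 6) (\<lambda>i. E (i + 7))))))))"
  by (rule ext) (simp add: eval_nat_numeral split: nat.split)

text \<open>The components of \<open>\<phi> = \<omega> \<and> e\<^sup>6 + \<psi>\<^sub>+\<close>.\<close>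

definition g2_table :: "(nat \<Rightarrow> nat \<Rightarrow> nat \<Rightarrow> real) \<Rightarrow> bool" where
  "g2_table P \<longleftrightarrow>
     P 0 1 2 = 0 \<and> P 0 1 3 = 0 \<and> P 0 1 4 = 0 \<and> P 0 1 5 = 0 \<and> P 0 1 6 = 1 \<and>
     P 0 2 3 = 0 \<and> P 0 2 4 = 1 \<and> P 0 2 5 = 0 \<and> P 0 2 6 = 0 \<and> P 0 3 4 = 0 \<and>
     P 0 3 5 = - 1 \<and> P 0 3 6 = 0 \<and> P 0 4 5 = 0 \<and> P 0 4 6 = 0 \<and> P 0 5 6 = 0 \<and>
     P 1 2 3 = 0 \<and> P 1 2 4 = 0 \<and> P 1 2 5 = - 1 \<and> P 1 2 6 = 0 \<and> P 1 3 4 = - 1 \<and>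
     P 1 3 5 = 0 \<and> P 1 3 6 = 0 \<and> P 1 4 5 = 0 \<and> P 1 4 6 = 0 \<and> P 1 5 6 = 0 \<and>
     P 2 3 4 = 0 \<and> P 2 3 5 = 0 \<and> P 2 3 6 = 1 \<and> P 2 4 5 = 0 \<and> P 2 4 6 = 0 \<and>
     P 2 5 6 = 0 \<and> P 3 4 5 = 0 \<and> P 3 4 6 = 0 \<and> P 3 5 6 = 0 \<and> P 4 5 6 = 1"

text \<open>The left-hand side is the frame component of \<iota>_i \<phi> \<and> \<iota>_j \<phi>
  \<and> \<phi>: the seven quadruples are complementary to the seven nonzero components of \<phi>.
  The 6 cancels the 1/6 in \<open>g2_b\<close>. The antisymmetry hypotheses carry order conditions
  so that, as rewrite rules, they sort the indices and terminate.\<close>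

lemma g2_table_sum:
  fixes P :: "nat \<Rightarrow> nat \<Rightarrow> nat \<Rightarrow> real"
  assumes t: "g2_table P" and P: "\<And>i k. P i i k = 0" "\<And>i k. P i k k = 0" "\<And>i k. P k i k = 0"
    "\<And>i j k. j < i \<Longrightarrow> P i j k = - P j i k" "\<And>i j k. k < j \<Longrightarrow> P i j k = - P i k j"
    and ij: "i < 7" "j < 7"
  defines "Q a b c d \<equiv> P i a b * P j c d - P i a c * P j b d + P i a d * P j b c
    + P i b c * P j a d - P i b d * P j a c + P i c d * P j a b"
  shows "Q 0 1 2 3 + Q 0 1 4 5 + Q 0 2 5 6 + Q 0 3 4 6 + Q 1 2 4 6 - Q 1 3 5 6 + Q 2 3 4 5 =
    (if i = j then 6 else 0)"
proof -
  have "i = 0 \<or> i = 1 \<or> i = 2 \<or> i = 3 \<or> i = 4 \<or> i = 5 \<or> i = 6"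
    "j = 0 \<or> j = 1 \<or> j = 2 \<or> j = 3 \<or> j = 4 \<or> j = 5 \<or> j = 6"
    using ij by linarith+
  then show ?thesis
    unfolding Q_def by (elim disjE) (simp_all add: t[unfolded g2_table_def] P del: One_nat_def)
qed

lemma wedge_4_3_table:
  fixes E :: "nat \<Rightarrow> 'v::real_vector"
  assumes X: "is_form 4 X" and \<phi>: "is_form 3 \<phi>" and t: "g2_table (\<lambda>i j k. eval3 \<phi> (E i) (E j) (E k))"
    and x: "\<And>a b c d y. X (case_nat (E a) (case_nat (E b) (case_nat (E c) (case_nat (E d) y)))) = x a b c d"
  shows "wedge 4 3 X \<phi> E = x 0 1 2 3 + x 0 1 4 5 + x 0 2 5 6 + x 0 3 4 6 + x 1 2 4 6 - x 1 3 5 6 + x 2 3 4 5"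
proof -
  have f: "is_form (Suc (Suc (Suc (Suc 0)))) X" "is_form (Suc (Suc (Suc 0))) \<phi>"
    using X \<phi> by (simp_all add: eval_nat_numeral)
  have "wedge (Suc (Suc (Suc (Suc 0)))) (Suc (Suc (Suc 0))) X \<phi> E =
      x 0 1 2 3 + x 0 1 4 5 + x 0 2 5 6 + x 0 3 4 6 + x 1 2 4 6 - x 1 3 5 6 + x 2 3 4 5"
    by (subst frame_seq7[of E])
      (simp add: wedge_eval f form3_eval[OF \<phi>] t[unfolded g2_table_def contract_case_nat One_nat_def] x)
  then show ?thesis by (simp add: eval_nat_numeral)
qed

lemma wedge_2_2_eval:
  assumes \<alpha>: "is_form 2 \<alpha>" and \<beta>: "is_form 2 \<beta>"
  shows "wedge 2 2 \<alpha> \<beta> (case_nat a (case_nat b (case_nat c (case_nat d y)))) =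
    eval2 \<alpha> a b * eval2 \<beta> c d - eval2 \<alpha> a c * eval2 \<beta> b d + eval2 \<alpha> a d * eval2 \<beta> b c
    + eval2 \<alpha> b c * eval2 \<beta> a d - eval2 \<alpha> b d * eval2 \<beta> a c + eval2 \<alpha> c d * eval2 \<beta> a b"
proof -
  have f: "is_form (Suc (Suc 0)) \<alpha>" "is_form (Suc (Suc 0)) \<beta>"
    using \<alpha> \<beta> by (simp_all add: eval_nat_numeral)
  have "wedge (Suc (Suc 0)) (Suc (Suc 0)) \<alpha> \<beta> (case_nat a (case_nat b (case_nat c (case_nat d y)))) =
    eval2 \<alpha> a b * eval2 \<beta> c d - eval2 \<alpha> a c * eval2 \<beta> b d + eval2 \<alpha> a d * eval2 \<beta> b c
    + eval2 \<alpha> b c * eval2 \<beta> a d - eval2 \<alpha> b d * eval2 \<beta> a c + eval2 \<alpha> c d * eval2 \<beta> a b"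
    by (simp add: wedge_eval f form2_eval[OF \<alpha>] form2_eval[OF \<beta>])
  then show ?thesis by (simp add: eval_nat_numeral)
qed

definition g2_frame :: "'v::real_vector form \<Rightarrow> (nat \<Rightarrow> 'v) \<Rightarrow> (nat \<Rightarrow> 'v \<Rightarrow> real) \<Rightarrow> bool" where
  "g2_frame \<phi> E C \<longleftrightarrow> is_form 3 \<phi> \<and> dual_bases 7 E C \<and> g2_table (\<lambda>i j k. eval3 \<phi> (E i) (E j) (E k))"

lemma g2_b_frame:
  fixes \<phi> :: "'v::real_vector form"
  assumes fr: "g2_frame \<phi> E C" and ij: "i < 7" "j < 7"
  shows "g2_b \<phi> (E i) (E j) E = of_bool (i = j)"
proof -
  have \<phi>: "is_form 3 \<phi>" and t: "g2_table (\<lambda>i j k. eval3 \<phi> (E i) (E j) (E k))"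
    using fr by (auto simp: g2_frame_def)
  note \<kappa> = is_form_contract_3[OF \<phi>] and alt = form3_alt[OF \<phi>]
  have X: "is_form 4 (wedge 2 2 (contract (E i) \<phi>) (contract (E j) \<phi>))"
    using is_form_wedge[OF \<kappa> \<kappa>] by simp
  have "wedge 4 3 (wedge 2 2 (contract (E i) \<phi>) (contract (E j) \<phi>)) \<phi> E = (if i = j then 6 else 0)"
    unfolding wedge_4_3_table[OF X \<phi> t wedge_2_2_eval[OF \<kappa> \<kappa>]]
    by (rule g2_table_sum[OF t _ _ _ _ _ ij]) (rule alt)+
  then show ?thesis by (simp add: g2_b_def)
qed

text \<open>A top form is fixed by its value on the frame, and there bilinearity reduces
  \<open>g2_b\<close> to the orthonormality of \<open>E\<close>.\<close>

lemma g2_b_eq: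
  fixes \<phi> :: "'v::real_vector form"
  assumes fr: "g2_frame \<phi> E C"
  shows "g2_b \<phi> v w = (\<lambda>x. (\<Sum>i<7. C i v * C i w) * det_form 7 C x)"
proof -
  have \<phi>: "is_form 3 \<phi>" "is_form (Suc 2) \<phi>" and db: "dual_bases 7 E C"
    using fr by (auto simp: g2_frame_def)
  note \<kappa> = is_form_contract_3[OF \<phi>(1)]
  have form: "is_form 7 (g2_b \<phi> v w)" for v w
  proof -
    have "is_form 4 (wedge 2 2 (contract v \<phi>) (contract w \<phi>))"
      using is_form_wedge[OF \<kappa> \<kappa>] by simp
    from is_form_cmult[OF is_form_wedge[OF this \<phi>(1)], of "1/6"] show ?thesis
      by (simp add: g2_b_def[abs_def])
  qed
  have lin: "linear (\<lambda>v. g2_b \<phi> v w x)" "linear (\<lambda>w. g2_b \<phi> v w x)" for v w x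
    by (auto intro!: linearI simp: g2_b_def contract_add_vec[OF \<phi>(2)] contract_scale_vec[OF \<phi>(2)]
        wedge_linear_simps add_divide_distrib)
  have "g2_b \<phi> v w E = g2_b \<phi> (\<Sum>i<7. C i v *\<^sub>R E i) (\<Sum>j<7. C j w *\<^sub>R E j) E"
    by (simp flip: dual_bases_expand[OF db])
  also have "\<dots> = (\<Sum>j<7. C j w * (\<Sum>i<7. C i v * g2_b \<phi> (E i) (E j) E))"
    by (simp only: linear_sum[OF lin(1)] linear_cmul[OF lin(1)] linear_sum[OF lin(2)] linear_cmul[OF lin(2)] real_scaleR_def)
  also have "\<dots> = (\<Sum>j<7. C j w * (\<Sum>i<7. if i = j then C i v else 0))"
    by (intro sum.cong refl arg_cong2[of _ _ _ _ times]) (simp add: g2_b_frame[OF fr])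
  also have "\<dots> = (\<Sum>i<7. C i v * C i w)"
    by (intro sum.cong refl) (simp add: mult.commute)
  finally show ?thesis
    using top_form_det_form[OF db form, of v w] by simp
qed

text \<open>With d = det M for the coordinate matrix M of the arguments, the matrix of
  \<open>g2_b\<close> is d M M^T. Its determinant is d^7 * d^2 = d^9, and the odd root recovers d
  with its sign.\<close>

lemma g2_vol_frame:
  fixes \<phi> :: "'v::real_vector form"
  assumes fr: "g2_frame \<phi> E C"
  shows "g2_vol \<phi> = det_form 7 C"
proof
  fix x
  define d where "d = det_form 7 C x"
  define M where "M = mat 7 7 (\<lambda>(i, j). C j (x i))"
  have M: "M \<in> carrier_mat 7 7" "transpose_mat M \<in> carrier_mat 7 7"
    by (simp_all add: M_def)
  have "mat 7 7 (\<lambda>(i, j). g2_b \<phi> (x i) (x j) x) = d \<cdot>\<^sub>m (M * transpose_mat M)"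
    by (rule eq_matI) (auto simp: M_def scalar_prod_def g2_b_eq[OF fr] d_def mult.commute lessThan_atLeast0)
  then have "det (mat 7 7 (\<lambda>(i, j). g2_b \<phi> (x i) (x j) x)) = d ^ 7 * (det M * det M)"
    using M by (simp add: det_mult[OF M] det_transpose[OF M(1)])
  also have "det M = d"
    by (simp add: d_def det_form_def M_def)
  also have "d ^ 7 * (d * d) = d ^ 9"
    by (simp add: eval_nat_numeral)
  finally have "g2_vol \<phi> x = root 9 (d ^ 9)"
    by (simp add: g2_vol_def)
  then show "g2_vol \<phi> x = det_form 7 C x"
    by (simp add: odd_real_root_power_cancel d_def)
qed

lemma g2_metric_frame:
  fixes \<phi> :: "'v::real_vector form"
  assumes fr: "g2_frame \<phi> E C"
  shows "g2_metric \<phi> = (\<lambda>v w. \<Sum>i<7. C i v * C i w)"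
proof (intro ext)
  fix v w
  have "det_form 7 C E = 1"
    using fr by (auto simp: g2_frame_def dest: det_form_dual_bases(2))
  then show "g2_metric \<phi> v w = (\<Sum>i<7. C i v * C i w)"
    unfolding g2_metric_def g2_b_eq[OF fr] g2_vol_frame[OF fr]
    by (intro the_equality) (auto dest: spec[of _ E])
qed

section \<open>The central extension\<close>

lemma eval2_lift: "eval2 (lift_form \<beta>) a b = eval2 \<beta> (fst a) (fst b)"
proof -
  have "(\<lambda>i. fst (case_nat a (\<lambda>_. b) i)) = case_nat (fst a) (\<lambda>_. fst b)"
    by (auto simp: fun_eq_iff split: nat.split)
  then show ?thesis by (simp add: pullback_def)
qed

lemma contract_lift: "contract a (lift_form \<beta>) = lift_form (contract (fst a) \<beta>)"
proof -
  have "(\<lambda>i. fst (case_nat a x i)) = case_nat (fst a) (\<lambda>i. fst (x i))" for x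
    by (auto simp: fun_eq_iff split: nat.split)
  then show ?thesis by (simp add: pullback_def contract_def)
qed

lemma eval3_lift: "eval3 (lift_form \<beta>) a b d = eval3 \<beta> (fst a) (fst b) (fst d)"
  by (simp add: contract_lift eval2_lift)

text \<open>Horizontal lifts: each \<open>e i\<close> is corrected by a multiple of z so as to lie
  in the kernel of \<open>\<theta>\<close>; the last vector is z normalized by
  \<open>\<theta>\<close>.\<close>

definition ext_frame :: "(nat \<Rightarrow> 'h::real_vector) \<Rightarrow> ('h \<times> real \<Rightarrow> real) \<Rightarrow> nat \<Rightarrow> 'h \<times> real" where
  "ext_frame e \<theta> i = (if i < 6 then (e i, - \<theta> (e i, 0) / \<theta> zvec) else (0, 1 / \<theta> zvec))"

definition ext_coframe :: "(nat \<Rightarrow> 'h \<Rightarrow> real) \<Rightarrow> ('h::real_vector \<times> real \<Rightarrow> real) \<Rightarrow> nat \<Rightarrow> 'h \<times> real \<Rightarrow> real" where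
  "ext_coframe c \<theta> i x = (if i < 6 then c i (fst x) else \<theta> x)"

lemma linear_prod_real:
  fixes \<theta> :: "'h::real_vector \<times> real \<Rightarrow> real"
  assumes "linear \<theta>"
  shows "\<theta> (v, r) = \<theta> (v, 0) + r * \<theta> zvec"
proof -
  have "\<theta> (v, r) = \<theta> ((v, 0) + r *\<^sub>R zvec)"
    by (simp add: zvec_def)
  then show ?thesis
    by (simp add: linear_add[OF assms] linear_cmul[OF assms])
qed

lemma ext_frame_theta:
  assumes \<theta>: "linear \<theta>" "\<theta> zvec \<noteq> 0"
  shows "\<theta> (ext_frame e \<theta> i) = (if i < 6 then 0 else 1)"
  using \<theta>(2) linear_prod_real[OF \<theta>(1), of "e i" "- \<theta> (e i, 0) / \<theta> zvec"]
    linear_prod_real[OF \<theta>(1), of 0 "1 / \<theta> zvec"] linear_0[OF \<theta>(1)]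
  by (simp add: ext_frame_def flip: zero_prod_def)

lemma dual_bases_ext:
  assumes db: "dual_bases 6 e c" and \<theta>: "linear \<theta>" "\<theta> zvec \<noteq> 0"
  shows "dual_bases 7 (ext_frame e \<theta>) (ext_coframe c \<theta>)"
  unfolding dual_bases_def
proof (intro conjI allI impI)
  show "linear (ext_coframe c \<theta> i)" if "i < 7" for i
    using \<theta>(1) linear_compose[OF linear_fst dual_bases_linear[OF db], of i]
    by (cases "i < 6") (simp_all add: ext_coframe_def[abs_def] comp_def)
  show "ext_coframe c \<theta> i (ext_frame e \<theta> j) = of_bool (i = j)" if "i < 7" "j < 7" for i j
  proof (cases "i < 6")
    case True
    have "c i 0 = 0" using linear_0[OF dual_bases_linear[OF db True]] .
    then show ?thesis
      using True that less_7_cases[OF that(2)] dual_bases_eval[OF db True, of j]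
      by (auto simp: ext_coframe_def ext_frame_def)
  next
    case False
    then show ?thesis
      using that by (auto simp: ext_coframe_def ext_frame_theta[OF \<theta>])
  qed
  show "x = (\<Sum>i<7. ext_coframe c \<theta> i x *\<^sub>R ext_frame e \<theta> i)" for x
  proof -
    obtain v r where x: "x = (v, r)" by fastforce
    have 1: "(\<Sum>i<6. c i v *\<^sub>R e i) = v"
      by (rule dual_bases_expand[OF db, symmetric])
    have "linear (\<lambda>v. \<theta> (v, 0))"
      using linear_compose[of "\<lambda>v. (v, 0::real)", OF _ \<theta>(1)] by (simp add: comp_def linear_iff)
    from linear_sum[OF this, of "\<lambda>i. c i v *\<^sub>R e i" "{..<6}"] linear_cmul[OF this]
    have 2: "(\<Sum>i<6. c i v * \<theta> (e i, 0)) = \<theta> (v, 0)"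
      by (simp add: 1)
    have "(\<Sum>i<7. ext_coframe c \<theta> i x *\<^sub>R ext_frame e \<theta> i) =
        (\<Sum>i<6. c i v *\<^sub>R (e i, - \<theta> (e i, 0) / \<theta> zvec)) + \<theta> x *\<^sub>R (0, 1 / \<theta> zvec)"
      by (simp add: sum_lessThan_7_last ext_coframe_def ext_frame_def x)
    also have "(\<Sum>i<6. c i v *\<^sub>R (e i, - \<theta> (e i, 0) / \<theta> zvec)) = (v, - \<theta> (v, 0) / \<theta> zvec)"
      by (simp add: sum_prod 1 sum_negf flip: 2 sum_divide_distrib)
    also have "(v, - \<theta> (v, 0) / \<theta> zvec) + \<theta> x *\<^sub>R (0, 1 / \<theta> zvec) = x"
      using \<theta>(2) linear_prod_real[OF \<theta>(1), of v r] by (simp add: x field_simps)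
    finally show ?thesis by simp
  qed
qed

lemma g2_frame_ext:
  assumes fr: "su3_frame \<omega> \<psi> e c" and \<omega>: "is_form 2 \<omega>" and \<psi>: "is_form 3 \<psi>"
    and \<theta>: "linear \<theta>" "\<theta> zvec \<noteq> 0"
    and \<phi>: "\<phi> = (\<lambda>x. wedge 2 1 (lift_form \<omega>) (\<lambda>x. \<theta> (x 0)) x + lift_form \<psi> x)"
  shows "g2_frame \<phi> (ext_frame e \<theta>) (ext_coframe c \<theta>)"
proof -
  have db: "dual_bases 6 e c" and om: "standard_omega e \<omega>" and tab: "complex_volume_table e \<psi> 1 0"
    using fr by (auto simp: su3_frame_def)
  have l: "is_form 2 (lift_form \<omega>)" "is_form 3 (lift_form \<psi>)"
    by (intro is_form_pullback linear_fst \<omega> \<psi>)+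
  have "is_form (2 + 1) (wedge 2 1 (lift_form \<omega>) (\<lambda>x. \<theta> (x 0)))"
    by (intro is_form_wedge l is_form_coord \<theta>)
  then have form: "is_form 3 \<phi>"
    unfolding \<phi> by (intro is_form_add l) simp
  have ev: "eval3 \<phi> a b d = eval2 \<omega> (fst a) (fst b) * \<theta> d - eval2 \<omega> (fst a) (fst d) * \<theta> b
      + eval2 \<omega> (fst b) (fst d) * \<theta> a + eval3 \<psi> (fst a) (fst b) (fst d)" for a b d
    unfolding \<phi> contract_add
    by (simp add: contract_case_nat wedge_2_1_function'[OF l(1), unfolded One_nat_def] eval2_lift eval3_lift[unfolded contract_case_nat])
  have fst: "fst (ext_frame e \<theta> i) = (if i < 6 then e i else 0)" for i
    by (simp add: ext_frame_def)
  have "g2_table (\<lambda>i j k. eval3 \<phi> (ext_frame e \<theta> i) (ext_frame e \<theta> j) (ext_frame e \<theta> k))"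
    unfolding g2_table_def ev fst ext_frame_theta[OF \<theta>]
    by (simp del: One_nat_def add: om[unfolded standard_omega_def, rule_format] tab[unfolded complex_volume_table_def]
        linear_0[OF form2_linear(1)[OF \<omega>]] linear_0[OF form2_linear(2)[OF \<omega>]] linear_0[OF form3_linear(1)[OF \<psi>]])
  then show ?thesis
    unfolding g2_frame_def using form dual_bases_ext[OF db \<theta>] by blast
qed

text \<open>The functional is \<theta> = u \<eta>. At the outset it is only a function built from
  descriptions, so its linearity and its value on z have to be extracted from the decomposition of
  \<phi>.\<close>

lemma induced_su3_structure_form:
  fixes \<phi> :: "('h::real_vector \<times> real) form"
  assumes g2: "g2_structure \<phi>" and ind: "induced_su3_structure \<phi> \<omega> \<psi>" and fr: "su3_frame \<omega> \<psi> e c"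
  obtains \<theta> where "linear \<theta>" "\<theta> zvec > 0"
    "\<phi> = (\<lambda>x. wedge 2 1 (lift_form \<omega>) (\<lambda>x. \<theta> (x 0)) x + lift_form \<psi> x)"
proof -
  define u where "u = induced_u \<phi>"
  define h where "h v = g2_metric \<phi> zvec v / u\<^sup>2" for v
  define \<theta> where "\<theta> v = u * h v" for v
  have su3: "su3_structure \<omega> \<psi>"
    and eq: "\<phi> = (\<lambda>x. u * wedge 2 1 (lift_form \<omega>) (\<lambda>x. h (x 0)) x + lift_form \<psi> x)"
    using ind unfolding induced_su3_structure_def u_def h_def induced_eta_def[abs_def] by auto
  have \<omega>: "is_form 2 \<omega>" and \<psi>: "is_form 3 \<psi>"
    using su3 by (auto simp: su3_structure_def)
  have \<phi>: "is_form 3 \<phi>" and dim: "dim (UNIV :: ('h \<times> real) set) = 7"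
    and rank: "\<And>w. w \<noteq> 0 \<Longrightarrow> form2_rank (contract w \<phi>) = 6"
    using g2 by (auto simp: g2_structure_def)
  have om: "standard_omega e \<omega>"
    using fr by (auto simp: su3_frame_def)
  have om01: "eval2 \<omega> (e 0) (e 1) = 1"
    using om[unfolded standard_omega_def, rule_format, of 0 1] by simp
  have l: "is_form 2 (lift_form \<omega>)"
    by (intro is_form_pullback linear_fst \<omega>)
  have ev: "eval3 \<phi> a b d = eval2 \<omega> (fst a) (fst b) * \<theta> d - eval2 \<omega> (fst a) (fst d) * \<theta> b
      + eval2 \<omega> (fst b) (fst d) * \<theta> a + eval3 \<psi> (fst a) (fst b) (fst d)" for a b d
    unfolding eq contract_add \<theta>_def
    by (simp add: contract_case_nat wedge_2_1_function'[OF l, unfolded One_nat_def] eval2_lift eval3_lift[unfolded contract_case_nat]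
        right_diff_distrib distrib_left mult.left_commute)
  \<comment> \<open>Since \<omega>(e_0, e_1) = 1, evaluating \<phi> on the lifts of e_0, e_1 and on
    v solves for \<theta>(v) in terms that are linear in v.\<close>
  have "\<theta> = (\<lambda>v. eval3 \<phi> (e 0, 0) (e 1, 0) v + eval2 \<omega> (e 0) (fst v) * \<theta> (e 1, 0)
      - eval2 \<omega> (e 1) (fst v) * \<theta> (e 0, 0) - eval3 \<psi> (e 0) (e 1) (fst v))"
    by (simp add: ev om01[unfolded One_nat_def])
  moreover have "linear (\<lambda>v. eval3 \<phi> (e 0, 0) (e 1, 0) v + eval2 \<omega> (e 0) (fst v) * \<theta> (e 1, 0)
      - eval2 \<omega> (e 1) (fst v) * \<theta> (e 0, 0) - eval3 \<psi> (e 0) (e 1) (fst v))"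
    by (rule linearI) (simp_all add: linear_add[OF form3_linear(1)[OF \<phi>]] linear_cmul[OF form3_linear(1)[OF \<phi>]]
        linear_add[OF form3_linear(1)[OF \<psi>]] linear_cmul[OF form3_linear(1)[OF \<psi>]]
        linear_add[OF form2_linear(1)[OF \<omega>]] linear_cmul[OF form2_linear(1)[OF \<omega>]] algebra_simps)
  ultimately have lin: "linear \<theta>" by simp
  \<comment> \<open>Otherwise \<iota>_z \<phi> would vanish, whereas its rank is six.\<close>
  have nz: "\<theta> zvec \<noteq> 0"
  proof
    assume 0: "\<theta> zvec = 0"
    have "eval3 \<phi> zvec b d = 0" for b d
      unfolding ev using 0 linear_0[OF form2_linear(2)[OF \<omega>]] linear_0[OF form3_linear(3)[OF \<psi>]]
      by (simp add: zvec_def)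
    then have "form2_rank (contract zvec \<phi>) = 0"
      unfolding form2_rank_def by simp
    then show False
      using rank[of zvec] by (simp add: zvec_def zero_prod_def)
  qed
  have eq\<theta>: "\<phi> = (\<lambda>x. wedge 2 1 (lift_form \<omega>) (\<lambda>x. \<theta> (x 0)) x + lift_form \<psi> x)"
    unfolding \<theta>_def wedge_cmult_right by (rule eq)
  \<comment> \<open>Linearity and \<open>nz\<close> suffice for the adapted frame, so the metric can
    now be computed; it yields u = |\<theta>(z)|, then \<eta>(z) = 1, and so \<theta>(z) =
    u.\<close>
  have "g2_metric \<phi> zvec zvec = (\<Sum>i<7. ext_coframe c \<theta> i zvec * ext_coframe c \<theta> i zvec)"
    by (simp add: g2_metric_frame[OF g2_frame_ext[OF fr \<omega> \<psi> lin nz eq\<theta>]])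
  also have "\<dots> = (\<theta> zvec)\<^sup>2"
  proof -
    have "c i 0 = 0" if "i < 6" for i
      using fr linear_0[OF dual_bases_linear[OF _ that]] unfolding su3_frame_def by blast
    then show ?thesis
      by (simp add: sum_lessThan_7_last ext_coframe_def power2_eq_square) (simp add: zvec_def)
  qed
  finally have g: "g2_metric \<phi> zvec zvec = (\<theta> zvec)\<^sup>2" .
  then have u: "u = \<bar>\<theta> zvec\<bar>"
    by (simp add: u_def induced_u_def)
  then have "h zvec = 1"
    using nz by (simp add: h_def g)
  then have "\<theta> zvec = u" by (simp add: \<theta>_def)
  then have "\<theta> zvec > 0" using u nz by simp
  with lin eq\<theta> show thesis by (intro that)
qed

lemma sum_lessThan_7: "(\<Sum>i<(7::nat). f i) = f 0 + f 1 + f 2 + f 3 + f 4 + f 5 + (f 6 :: real)"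
  by (simp add: eval_nat_numeral)

text \<open>The components of \<open>*\<phi> = \<omega>\<^sup>2/2 + \<psi>\<^sub>- \<and> e\<^sup>6\<close>.\<close>

definition g2_star_table :: "(nat \<Rightarrow> nat \<Rightarrow> nat \<Rightarrow> nat \<Rightarrow> real) \<Rightarrow> bool" where
  "g2_star_table K \<longleftrightarrow>
     K 0 1 2 3 = 1 \<and> K 0 1 2 4 = 0 \<and> K 0 1 2 5 = 0 \<and> K 0 1 2 6 = 0 \<and> K 0 1 3 4 = 0 \<and>
     K 0 1 3 5 = 0 \<and> K 0 1 3 6 = 0 \<and> K 0 1 4 5 = 1 \<and> K 0 1 4 6 = 0 \<and> K 0 1 5 6 = 0 \<and>
     K 0 2 3 4 = 0 \<and> K 0 2 3 5 = 0 \<and> K 0 2 3 6 = 0 \<and> K 0 2 4 5 = 0 \<and> K 0 2 4 6 = 0 \<and>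
     K 0 2 5 6 = 1 \<and> K 0 3 4 5 = 0 \<and> K 0 3 4 6 = 1 \<and> K 0 3 5 6 = 0 \<and> K 0 4 5 6 = 0 \<and>
     K 1 2 3 4 = 0 \<and> K 1 2 3 5 = 0 \<and> K 1 2 3 6 = 0 \<and> K 1 2 4 5 = 0 \<and> K 1 2 4 6 = 1 \<and>
     K 1 2 5 6 = 0 \<and> K 1 3 4 5 = 0 \<and> K 1 3 4 6 = 0 \<and> K 1 3 5 6 = - 1 \<and> K 1 4 5 6 = 0 \<and>
     K 2 3 4 5 = 1 \<and> K 2 3 4 6 = 0 \<and> K 2 3 5 6 = 0 \<and> K 2 4 5 6 = 0 \<and> K 3 4 5 6 = 0"

lemma wedge_3_4_table:
  fixes E :: "nat \<Rightarrow> 'v::real_vector"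
  assumes \<alpha>: "is_form 3 \<alpha>" and \<chi>: "is_form 4 \<chi>" and t: "g2_star_table K"
    and K: "\<And>a b c d y. \<chi> (case_nat (E a) (case_nat (E b) (case_nat (E c) (case_nat (E d) y)))) = K a b c d"
  defines "x \<equiv> \<lambda>i j k. eval3 \<alpha> (E i) (E j) (E k)"
  shows "wedge 3 4 \<alpha> \<chi> E = x 0 1 6 + x 2 3 6 + x 4 5 6 + x 0 2 4 - x 0 3 5 - x 1 2 5 - x 1 3 4"
proof -
  have f: "is_form (Suc (Suc (Suc 0))) \<alpha>" "is_form (Suc (Suc (Suc (Suc 0)))) \<chi>"
    using \<alpha> \<chi> by (simp_all add: eval_nat_numeral)
  have "wedge (Suc (Suc (Suc 0))) (Suc (Suc (Suc (Suc 0)))) \<alpha> \<chi> E =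
      x 0 1 6 + x 2 3 6 + x 4 5 6 + x 0 2 4 - x 0 3 5 - x 1 2 5 - x 1 3 4"
    by (subst frame_seq7[of E])
      (simp add: wedge_eval f form3_eval[OF \<alpha>] K t[unfolded g2_star_table_def One_nat_def] x_def)
  then show ?thesis by (simp add: eval_nat_numeral)
qed

text \<open>Only the seven nonzero components of \<phi> survive, each in 3! orderings.\<close>

lemma g2_table_full_sum:
  fixes P Q :: "nat \<Rightarrow> nat \<Rightarrow> nat \<Rightarrow> real"
  assumes t: "g2_table P" and P: "\<And>i k. P i i k = 0" "\<And>i k. P i k k = 0" "\<And>i k. P k i k = 0"
    "\<And>i j k. j < i \<Longrightarrow> P i j k = - P j i k" "\<And>i j k. k < j \<Longrightarrow> P i j k = - P i k j"
    and Q: "\<And>i j k. j < i \<Longrightarrow> Q i j k = - Q j i k" "\<And>i j k. k < j \<Longrightarrow> Q i j k = - Q i k j"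
  shows "(\<Sum>i<7. \<Sum>j<7. \<Sum>k<7. Q i j k * P i j k) =
    6 * (Q 0 1 6 + Q 2 3 6 + Q 4 5 6 + Q 0 2 4 - Q 0 3 5 - Q 1 2 5 - Q 1 3 4)"
  unfolding sum_lessThan_7 by (simp add: t[unfolded g2_table_def] P Q del: One_nat_def)

text \<open>The identity <\<iota>_i \<phi>, \<iota>_l \<phi>> = 3 \<delta>_il; the sum over ordered
  pairs doubles it.\<close>

lemma g2_table_contract:
  fixes P :: "nat \<Rightarrow> nat \<Rightarrow> nat \<Rightarrow> real"
  assumes t: "g2_table P" and P: "\<And>i k. P i i k = 0" "\<And>i k. P i k k = 0" "\<And>i k. P k i k = 0"
    "\<And>i j k. j < i \<Longrightarrow> P i j k = - P j i k" "\<And>i j k. k < j \<Longrightarrow> P i j k = - P i k j"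
    and il: "i < 7" "l < 7"
  shows "(\<Sum>j<7. \<Sum>k<7. P i j k * P l j k) = (if i = l then 6 else 0)"
proof -
  have "i = 0 \<or> i = 1 \<or> i = 2 \<or> i = 3 \<or> i = 4 \<or> i = 5 \<or> i = 6"
    "l = 0 \<or> l = 1 \<or> l = 2 \<or> l = 3 \<or> l = 4 \<or> l = 5 \<or> l = 6"
    using il by linarith+
  then show ?thesis
    unfolding sum_lessThan_7 by (elim disjE) (simp_all add: t[unfolded g2_table_def] P del: One_nat_def)
qed

text \<open>In components, \<gamma> \<and> \<iota>_i \<phi> \<and> \<phi> = 2 <\<gamma>, \<iota>_i
  \<phi>> vol, where \<open>G\<close> holds the components of \<gamma>; the right-hand sum over
  ordered pairs is twice the inner product. This is the eigenvalue 2 of the forms \<iota>_i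
  \<phi>.\<close>

lemma g2_table_wedge_square:
  fixes P :: "nat \<Rightarrow> nat \<Rightarrow> nat \<Rightarrow> real"
  assumes t: "g2_table P" and P: "\<And>i k. P i i k = 0" "\<And>i k. P i k k = 0" "\<And>i k. P k i k = 0"
    "\<And>i j k. j < i \<Longrightarrow> P i j k = - P j i k" "\<And>i j k. k < j \<Longrightarrow> P i j k = - P i k j"
    and G: "\<And>a. G a a = 0" "\<And>a b. b < a \<Longrightarrow> G a b = - G b a"
    and i: "i < 7"
  defines "Q a b c d \<equiv> G a b * P i c d - G a c * P i b d + G a d * P i b c
    + G b c * P i a d - G b d * P i a c + G c d * P i a b"
  shows "Q 0 1 2 3 + Q 0 1 4 5 + Q 0 2 5 6 + Q 0 3 4 6 + Q 1 2 4 6 - Q 1 3 5 6 + Q 2 3 4 5 =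
    (\<Sum>a<7. \<Sum>b<7. G a b * P i a b)"
proof -
  have "i = 0 \<or> i = 1 \<or> i = 2 \<or> i = 3 \<or> i = 4 \<or> i = 5 \<or> i = 6"
    using i by linarith
  then show ?thesis
    unfolding sum_lessThan_7 Q_def by (elim disjE) (simp_all add: t[unfolded g2_table_def] P G del: One_nat_def)
qed

section \<open>Torsion of closed \<open>G\<^sub>2\<close>-structures\<close>

lemma form_inner_1:
  fixes b :: "nat \<Rightarrow> 'v::real_vector"
  assumes db: "dual_bases n b c" and g: "g = (\<lambda>x y. \<Sum>i<n. c i x * c i y)"
    and "is_form 1 \<alpha>" "is_form 1 \<beta>"
  shows "form_inner g 1 \<alpha> \<beta> = (\<Sum>i<n. \<alpha> (\<lambda>_. b i) * \<beta> (\<lambda>_. b i))"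
  unfolding form_inner_dual_bases[OF assms]
  by (simp add: frame_sum_Suc frame_sum_0 contract_case_nat form1_eval[OF assms(3)] form1_eval[OF assms(4)])

lemma form_inner_2:
  fixes b :: "nat \<Rightarrow> 'v::real_vector"
  assumes db: "dual_bases n b c" and g: "g = (\<lambda>x y. \<Sum>i<n. c i x * c i y)"
    and "is_form 2 \<alpha>" "is_form 2 \<beta>"
  shows "form_inner g 2 \<alpha> \<beta> = (\<Sum>i<n. \<Sum>j<n. eval2 \<alpha> (b i) (b j) * eval2 \<beta> (b i) (b j)) / 2"
  unfolding form_inner_dual_bases[OF assms]
  by (simp add: numeral_2_eq_2 frame_sum_Suc frame_sum_0 contract_case_nat form2_eval[OF assms(3)] form2_eval[OF assms(4)])

lemma form_inner_3:
  fixes b :: "nat \<Rightarrow> 'v::real_vector"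
  assumes db: "dual_bases n b c" and g: "g = (\<lambda>x y. \<Sum>i<n. c i x * c i y)"
    and "is_form 3 \<alpha>" "is_form 3 \<beta>"
  shows "form_inner g 3 \<alpha> \<beta> =
    (\<Sum>i<n. \<Sum>j<n. \<Sum>k<n. eval3 \<alpha> (b i) (b j) (b k) * eval3 \<beta> (b i) (b j) (b k)) / 6"
  unfolding form_inner_dual_bases[OF assms]
  by (simp add: eval_nat_numeral frame_sum_Suc frame_sum_0)
    (simp add: contract_case_nat form3_eval[OF assms(3)] form3_eval[OF assms(4)])

lemma form_inner_nonneg: "form_inner g k \<alpha> \<alpha> \<ge> 0"
  unfolding form_inner_def Let_def by (intro divide_nonneg_pos sum_nonneg) auto

lemma form_norm_squared: "(form_norm g k \<alpha>)\<^sup>2 = form_inner g k \<alpha> \<alpha>"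
  unfolding form_norm_def by (simp add: form_inner_nonneg)

lemma form_inner_commute: "form_inner g k \<alpha> \<beta> = form_inner g k \<beta> \<alpha>"
  unfolding form_inner_def by (simp add: mult.commute)

lemma form2_inner_self_eq_0:
  fixes b :: "nat \<Rightarrow> 'v::real_vector"
  assumes db: "dual_bases n b c" and g: "g = (\<lambda>x y. \<Sum>i<n. c i x * c i y)"
    and \<alpha>: "is_form 2 \<alpha>" and 0: "form_inner g 2 \<alpha> \<alpha> = 0"
  shows "\<alpha> = (\<lambda>x. 0)"
proof (rule form_eq_0_on_basis[OF db \<alpha>])
  have "(\<Sum>i<n. \<Sum>j<n. (eval2 \<alpha> (b i) (b j))\<^sup>2) = 0"
    using 0 unfolding form_inner_2[OF db g \<alpha> \<alpha>] by (simp add: power2_eq_square)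
  then have z: "eval2 \<alpha> (b i) (b j) = 0" if "i < n" "j < n" for i j
    using that by (simp add: sum_nonneg_eq_0_iff sum_nonneg)
  fix f :: "nat \<Rightarrow> nat" assume f: "\<And>i. i < 2 \<Longrightarrow> f i < n"
  have "\<alpha> (\<lambda>i. b (f i)) = eval2 \<alpha> (b (f 0)) (b (f 1))"
    by (rule is_form_cong[OF \<alpha>]) (auto simp: less_2_cases_iff)
  then show "\<alpha> (\<lambda>i. b (f i)) = 0"
    using z[of "f 0" "f 1"] f by simp
qed

lemma g2_frameD:
  fixes \<phi> :: "'v::real_vector form"
  assumes "g2_frame \<phi> E C"
  shows "is_form 3 \<phi>" "dual_bases 7 E C" "g2_table (\<lambda>i j k. eval3 \<phi> (E i) (E j) (E k))"
    "g2_metric \<phi> = (\<lambda>v w. \<Sum>i<7. C i v * C i w)" "is_form 7 (g2_vol \<phi>)" "g2_vol \<phi> E = 1"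
  using assms det_form_dual_bases[of 7 E C] by (auto simp: g2_frame_def g2_metric_frame g2_vol_frame)

text \<open>A Hodge dual is recognized by its products with all 3-forms; these are top forms, so
  their values on the frame decide.\<close>

lemma g2_hodge_phi:
  fixes \<phi> :: "'v::real_vector form"
  assumes fr: "g2_frame \<phi> E C" and \<chi>: "is_form 4 \<chi>" and t: "g2_star_table K"
    and K: "\<And>a b c d y. \<chi> (case_nat (E a) (case_nat (E b) (case_nat (E c) (case_nat (E d) y)))) = K a b c d"
  shows "g2_hodge \<phi> 3 \<phi> = \<chi>"
proof -
  note fD = g2_frameD[OF fr]
  show ?thesis
  proof (rule hodge_eqI[OF fD(2,5)])
    show "is_form (7 - 3) \<chi>" using \<chi> by simp
    fix \<alpha> :: "'v form" assume \<alpha>: "is_form 3 \<alpha>"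
    have "wedge 3 4 \<alpha> \<chi> = (\<lambda>x. form_inner (g2_metric \<phi>) 3 \<alpha> \<phi> * g2_vol \<phi> x)"
    proof (rule top_form_eqI[OF fD(2)])
      show "is_form 7 (wedge 3 4 \<alpha> \<chi>)"
        using is_form_wedge[OF \<alpha> \<chi>] by simp
      show "is_form 7 (\<lambda>x. form_inner (g2_metric \<phi>) 3 \<alpha> \<phi> * g2_vol \<phi> x)"
        by (rule is_form_cmult[OF fD(5)])
      have "(\<Sum>i<7. \<Sum>j<7. \<Sum>k<7. eval3 \<alpha> (E i) (E j) (E k) * eval3 \<phi> (E i) (E j) (E k)) = 6 * wedge 3 4 \<alpha> \<chi> E"
        unfolding wedge_3_4_table[OF \<alpha> \<chi> t K]
        by (rule g2_table_full_sum[OF fD(3)]) (rule form3_alt[OF \<alpha>] form3_alt[OF fD(1)])+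
      then show "wedge 3 4 \<alpha> \<chi> E = form_inner (g2_metric \<phi>) 3 \<alpha> \<phi> * g2_vol \<phi> E"
        unfolding form_inner_3[OF fD(2,4) \<alpha> fD(1)] fD(6) by simp
    qed
    then show "wedge 3 (7 - 3) \<alpha> \<chi> = (\<lambda>x. form_inner (g2_metric \<phi>) 3 \<alpha> \<phi> * g2_vol \<phi> x)"
      by simp
  qed simp
qed

lemma g2_hodge_works:
  fixes \<phi> :: "'v::real_vector form"
  assumes fr: "g2_frame \<phi> E C"
  shows "is_form 4 (g2_hodge \<phi> 3 \<beta>)"
    "is_form 3 \<alpha> \<Longrightarrow> wedge 3 4 \<alpha> (g2_hodge \<phi> 3 \<beta>) = (\<lambda>x. form_inner (g2_metric \<phi>) 3 \<alpha> \<beta> * g2_vol \<phi> x)"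
    "is_form 5 (g2_hodge \<phi> 2 \<beta>)"
    "is_form 2 \<alpha> \<Longrightarrow> wedge 2 5 \<alpha> (g2_hodge \<phi> 2 \<beta>) = (\<lambda>x. form_inner (g2_metric \<phi>) 2 \<alpha> \<beta> * g2_vol \<phi> x)"
proof -
  note fD = g2_frameD[OF fr]
  show "is_form 4 (g2_hodge \<phi> 3 \<beta>)" "is_form 5 (g2_hodge \<phi> 2 \<beta>)"
    using hodge_works(1)[OF fD(2,5), where k = 3] hodge_works(1)[OF fD(2,5), where k = 2] by simp_all
  show "wedge 3 4 \<alpha> (g2_hodge \<phi> 3 \<beta>) = (\<lambda>x. form_inner (g2_metric \<phi>) 3 \<alpha> \<beta> * g2_vol \<phi> x)" if "is_form 3 \<alpha>"
    using hodge_works(2)[OF fD(2,5) _ that] by simp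
  show "wedge 2 5 \<alpha> (g2_hodge \<phi> 2 \<beta>) = (\<lambda>x. form_inner (g2_metric \<phi>) 2 \<alpha> \<beta> * g2_vol \<phi> x)" if "is_form 2 \<alpha>"
    using hodge_works(2)[OF fD(2,5) _ that] by simp
qed

text \<open>The forms \<open>\<iota>\<^sub>w \<phi>\<close> and \<open>\<tau>\<close> are eigenvectors of the symmetric map \<open>\<beta> \<mapsto> *(\<beta> \<and> \<phi>)\<close> for the eigenvalues \<open>2\<close> and \<open>-1\<close>.\<close>

lemma torsion_orthogonal_contract:
  fixes \<phi> :: "'v::real_vector form"
  assumes fr: "g2_frame \<phi> E C" and \<tau>: "is_form 2 \<tau>"
    and ev: "wedge 2 3 \<tau> \<phi> = (\<lambda>x. - g2_hodge \<phi> 2 \<tau> x)" and i: "i < 7"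
  shows "form_inner (g2_metric \<phi>) 2 \<tau> (contract (E i) \<phi>) = 0"
proof -
  note fD = g2_frameD[OF fr]
  note \<kappa> = is_form_contract_3[OF fD(1)]
  have X: "is_form 4 (wedge 2 2 \<tau> (contract (E i) \<phi>))"
    using is_form_wedge[OF \<tau> \<kappa>] by simp
  have "wedge 4 3 (wedge 2 2 \<tau> (contract (E i) \<phi>)) \<phi> E =
      (\<Sum>a<7. \<Sum>b<7. eval2 \<tau> (E a) (E b) * eval3 \<phi> (E i) (E a) (E b))"
    unfolding wedge_4_3_table[OF X fD(1,3) wedge_2_2_eval[OF \<tau> \<kappa>]]
    by (rule g2_table_wedge_square[OF fD(3) _ _ _ _ _ _ _ i]) (rule form3_alt[OF fD(1)] form2_alt[OF \<tau>])+
  also have "\<dots> = 2 * form_inner (g2_metric \<phi>) 2 \<tau> (contract (E i) \<phi>)"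
    unfolding form_inner_2[OF fD(2,4) \<tau> \<kappa>] by simp
  finally have 1: "wedge 4 3 (wedge 2 2 \<tau> (contract (E i) \<phi>)) \<phi> E =
      2 * form_inner (g2_metric \<phi>) 2 \<tau> (contract (E i) \<phi>)" .
  \<comment> \<open>The same 7-form computed from \<tau> \<and> \<phi> gives minus the inner
    product. Together with the factor 2 above, three times the inner product vanishes.\<close>
  have "wedge 4 3 (wedge 2 2 \<tau> (contract (E i) \<phi>)) \<phi> = wedge 4 3 (wedge 2 2 (contract (E i) \<phi>) \<tau>) \<phi>"
    using wedge_commute[OF \<tau> \<kappa>, of "E i"] by simp
  also have "\<dots> = wedge 2 5 (contract (E i) \<phi>) (wedge 2 3 \<tau> \<phi>)"
    using wedge_assoc[OF \<kappa> \<tau> fD(1), of "E i"] by simp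
  also have "\<dots> = (\<lambda>x. - (form_inner (g2_metric \<phi>) 2 (contract (E i) \<phi>) \<tau> * g2_vol \<phi> x))"
    unfolding ev wedge_minus_right g2_hodge_works(4)[OF fr \<kappa>] by simp
  finally show ?thesis
    using 1 fD(6) form_inner_commute[of "g2_metric \<phi>" 2 \<tau>] by simp
qed

text \<open>Wedging with \<alpha> is adjoint to contraction with its dual vector. The three terms of
  \<alpha> \<and> \<tau> contribute equally by the antisymmetry of \<phi>, and 3/6 = 1/2 is the
  normalization for 2-forms.\<close>

lemma form_inner_wedge_1_2:
  fixes \<phi> :: "'v::real_vector form"
  assumes fr: "g2_frame \<phi> E C" and \<tau>: "is_form 2 \<tau>" and \<alpha>: "is_form 1 \<alpha>"
  shows "form_inner (g2_metric \<phi>) 3 (wedge 1 2 \<alpha> \<tau>) \<phi> =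
    (\<Sum>i<7. \<alpha> (\<lambda>_. E i) * form_inner (g2_metric \<phi>) 2 \<tau> (contract (E i) \<phi>))"
proof -
  note fD = g2_frameD[OF fr]
  note \<kappa> = is_form_contract_3[OF fD(1)] and alt = form3_alt[OF fD(1)]
  define a where "a i = \<alpha> (\<lambda>_. E i)" for i
  define t where "t i j = eval2 \<tau> (E i) (E j)" for i j
  define p where "p i j k = eval3 \<phi> (E i) (E j) (E k)" for i j k
  have w: "is_form 3 (wedge 1 2 \<alpha> \<tau>)"
    using is_form_wedge[OF \<alpha> \<tau>] by (simp del: One_nat_def)
  have e: "eval3 (wedge 1 2 \<alpha> \<tau>) (E i) (E j) (E k) = a i * t j k - a j * t i k + a k * t i j" for i j k
    using wedge_1_2_eval[OF \<alpha> \<tau>, of "E i" "E j" "E k" "\<lambda>_. E k"]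
    by (simp add: contract_case_nat case_nat_const a_def t_def)
  have p1: "p i j k = - p j i k" "p i j k = p j k i" "p i j k = p k i j" for i j k
    unfolding p_def using alt(4)[of "E i" "E j" "E k"] alt(5)[of "E j" "E i" "E k"] alt(5)[of "E i" "E j" "E k"]
      alt(4)[of "E i" "E k" "E j"] by simp_all
  have S1: "(\<Sum>i<7. \<Sum>j<7. \<Sum>k<7. a i * t j k * p i j k) = (\<Sum>i<7. a i * (\<Sum>j<7. \<Sum>k<7. t j k * p i j k))"
    by (simp add: sum_distrib_left mult.assoc)
  have S2: "(\<Sum>i<7. \<Sum>j<7. \<Sum>k<7. a j * t i k * p i j k) = - (\<Sum>i<7. a i * (\<Sum>j<7. \<Sum>k<7. t j k * p i j k))"
  proof -
    have "(\<Sum>i<7. \<Sum>j<7. \<Sum>k<7. a j * t i k * p i j k) = (\<Sum>j<7. \<Sum>i<7. \<Sum>k<7. a j * t i k * p i j k)"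
      by (rule sum.swap)
    also have "\<dots> = (\<Sum>j<7. \<Sum>i<7. \<Sum>k<7. - (a j * t i k * p j i k))"
      by (intro sum.cong refl) (subst p1(1), simp)
    finally show ?thesis unfolding S1[symmetric] by (simp add: sum_negf)
  qed
  have S3: "(\<Sum>i<7. \<Sum>j<7. \<Sum>k<7. a k * t i j * p i j k) = (\<Sum>i<7. a i * (\<Sum>j<7. \<Sum>k<7. t j k * p i j k))"
  proof -
    have "(\<Sum>i<7. \<Sum>j<7. \<Sum>k<7. a k * t i j * p i j k) = (\<Sum>i<7. \<Sum>k<7. \<Sum>j<7. a k * t i j * p i j k)"
      by (rule sum.cong[OF refl], rule sum.swap)
    also have "\<dots> = (\<Sum>k<7. \<Sum>i<7. \<Sum>j<7. a k * t i j * p i j k)"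
      by (rule sum.swap)
    also have "\<dots> = (\<Sum>k<7. \<Sum>i<7. \<Sum>j<7. a k * t i j * p k i j)"
      by (intro sum.cong refl) (subst p1(3), simp)
    finally show ?thesis unfolding S1[symmetric] .
  qed
  have "form_inner (g2_metric \<phi>) 3 (wedge 1 2 \<alpha> \<tau>) \<phi> =
      (\<Sum>i<7. \<Sum>j<7. \<Sum>k<7. (a i * t j k - a j * t i k + a k * t i j) * p i j k) / 6"
    unfolding form_inner_3[OF fD(2,4) w fD(1)] e p_def ..
  also have "\<dots> = ((\<Sum>i<7. \<Sum>j<7. \<Sum>k<7. a i * t j k * p i j k) - (\<Sum>i<7. \<Sum>j<7. \<Sum>k<7. a j * t i k * p i j k)
      + (\<Sum>i<7. \<Sum>j<7. \<Sum>k<7. a k * t i j * p i j k)) / 6"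
    by (simp only: distrib_right left_diff_distrib sum.distrib sum_subtractf)
  also have "\<dots> = (\<Sum>i<7. a i * ((\<Sum>j<7. \<Sum>k<7. t j k * p i j k) / 2))"
    unfolding S1 S2 S3 by (simp add: sum_divide_distrib[symmetric])
  finally show ?thesis
    unfolding form_inner_2[OF fD(2,4) \<tau> \<kappa>] a_def t_def p_def .
qed

text \<open>Tested against a 1-form \<alpha>, the 6-form gives <\<alpha> \<and> \<tau>, \<phi>> vol,
  a combination of the vanishing products <\<tau>, \<iota>_i \<phi>>.\<close>

lemma torsion_wedge_star_phi:
  fixes \<phi> :: "'v::real_vector form"
  assumes fr: "g2_frame \<phi> E C" and \<tau>: "is_form 2 \<tau>"
    and ev: "wedge 2 3 \<tau> \<phi> = (\<lambda>x. - g2_hodge \<phi> 2 \<tau> x)"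
  shows "wedge 2 4 \<tau> (g2_hodge \<phi> 3 \<phi>) = (\<lambda>x. 0)"
proof -
  note fD = g2_frameD[OF fr] and h = g2_hodge_works[OF fr]
  have 0: "wedge 1 (7 - 1) \<alpha> (wedge 2 4 \<tau> (g2_hodge \<phi> 3 \<phi>)) = (\<lambda>x. 0)" if \<alpha>: "is_form 1 \<alpha>" for \<alpha>
  proof -
    have w: "is_form 3 (wedge 1 2 \<alpha> \<tau>)"
      using is_form_wedge[OF \<alpha> \<tau>] by (simp del: One_nat_def)
    have "wedge 1 6 \<alpha> (wedge 2 4 \<tau> (g2_hodge \<phi> 3 \<phi>)) = wedge 3 4 (wedge 1 2 \<alpha> \<tau>) (g2_hodge \<phi> 3 \<phi>)"
      using wedge_assoc[OF \<alpha> \<tau> h(1), of \<phi>] by (simp del: One_nat_def)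
    also have "\<dots> = (\<lambda>x. 0)"
      unfolding h(2)[OF w] form_inner_wedge_1_2[OF fr \<tau> \<alpha>]
      by (simp add: torsion_orthogonal_contract[OF fr \<tau> ev])
    finally show ?thesis by simp
  qed
  show ?thesis
    by (rule wedge_nondegenerate[OF fD(2) _ _ 0]) (use is_form_wedge[OF \<tau> h(1)] in simp_all)
qed

lemma closed_g2_inner_d_torsion:
  fixes \<phi> :: "'v::real_vector form"
  assumes fr: "g2_frame \<phi> E C" and br: "alternating_bilinear br" and tf: "g2_torsion_form br \<phi> \<tau>"
  shows "form_inner (g2_metric \<phi>) 3 (ce_d br 2 \<tau>) \<phi> = form_inner (g2_metric \<phi>) 2 \<tau> \<tau>"
proof -
  note fD = g2_frameD[OF fr] and h = g2_hodge_works[OF fr]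
  have \<tau>: "is_form 2 \<tau>" and ev: "wedge 2 3 \<tau> \<phi> = (\<lambda>x. - g2_hodge \<phi> 2 \<tau> x)"
    and d: "ce_d br 4 (g2_hodge \<phi> 3 \<phi>) = wedge 2 3 \<tau> \<phi>"
    using tf by (auto simp: g2_torsion_form_def)
  have d\<tau>: "is_form 3 (ce_d br 2 \<tau>)"
    using is_form_ce_d[OF br \<tau>] by simp
  \<comment> \<open>As \<tau> has even degree both terms carry a plus sign; the second one is \<tau>
    \<and> \<tau> \<and> \<phi> = - |\<tau>|^2 vol.\<close>
  have "ce_d br 6 (wedge 2 4 \<tau> (g2_hodge \<phi> 3 \<phi>)) =
      (\<lambda>x. wedge 3 4 (ce_d br 2 \<tau>) (g2_hodge \<phi> 3 \<phi>) x + wedge 2 5 \<tau> (ce_d br 4 (g2_hodge \<phi> 3 \<phi>)) x)"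
    using ce_d_wedge[OF br \<tau> h(1), of \<phi>] by simp
  then have "wedge 3 4 (ce_d br 2 \<tau>) (g2_hodge \<phi> 3 \<phi>) E + wedge 2 5 \<tau> (ce_d br 4 (g2_hodge \<phi> 3 \<phi>)) E = 0"
    unfolding torsion_wedge_star_phi[OF fr \<tau> ev] ce_d_zero by (metis (no_types))
  then show ?thesis
    unfolding d ev wedge_minus_right h(2)[OF d\<tau>] h(4)[OF \<tau>] fD(6) by simp
qed

text \<open>The description in \<open>g2_laplacian\<close> is resolved by uniqueness: \<tau> \<and>
  \<phi> is prescribed, hence so is the Hodge dual of \<tau>, and the inner product is
  definite.\<close>

lemma g2_laplacian_eq:
  fixes \<phi> :: "'v::real_vector form"
  assumes fr: "g2_frame \<phi> E C" and tf: "g2_torsion_form br \<phi> \<tau>"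
  shows "g2_laplacian br \<phi> = ce_d br 2 \<tau>"
proof -
  note fD = g2_frameD[OF fr] and h = g2_hodge_works[OF fr]
  have "\<sigma> = \<tau>" if \<sigma>: "g2_torsion_form br \<phi> \<sigma>" for \<sigma>
  proof -
    have f: "is_form 2 \<sigma>" "is_form 2 \<tau>" "is_form 2 (\<lambda>x. \<sigma> x - \<tau> x)"
      using tf \<sigma> by (auto simp: g2_torsion_form_def intro: is_form_diff)
    have "wedge 2 3 \<sigma> \<phi> = wedge 2 3 \<tau> \<phi>"
      using tf \<sigma> by (simp add: g2_torsion_form_def)
    then have "g2_hodge \<phi> 2 \<sigma> = g2_hodge \<phi> 2 \<tau>"
      using tf \<sigma> by (simp add: g2_torsion_form_def fun_eq_iff)
    then have "form_inner (g2_metric \<phi>) 2 (\<lambda>x. \<sigma> x - \<tau> x) \<sigma> = form_inner (g2_metric \<phi>) 2 (\<lambda>x. \<sigma> x - \<tau> x) \<tau>"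
      using fun_cong[OF h(4)[OF f(3), of \<sigma>], of E] fun_cong[OF h(4)[OF f(3), of \<tau>], of E] fD(6) by simp
    then have "form_inner (g2_metric \<phi>) 2 (\<lambda>x. \<sigma> x - \<tau> x) (\<lambda>x. \<sigma> x - \<tau> x) = 0"
      unfolding form_inner_2[OF fD(2,4) f(3) f(1)] form_inner_2[OF fD(2,4) f(3) f(2)] form_inner_2[OF fD(2,4) f(3) f(3)]
      by (simp add: right_diff_distrib sum_subtractf)
    then have "(\<lambda>x. \<sigma> x - \<tau> x) = (\<lambda>x. 0)"
      by (rule form2_inner_self_eq_0[OF fD(2,4) f(3)])
    then show ?thesis by (simp add: fun_eq_iff)
  qed
  then have "(THE \<sigma>. g2_torsion_form br \<phi> \<sigma>) = \<tau>"
    using tf by (intro the_equality)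
  then show ?thesis by (simp add: g2_laplacian_def)
qed

lemma eval3_der_action:
  assumes "is_form 3 \<phi>"
  shows "eval3 (der_action D 3 \<phi>) a b d = eval3 \<phi> (D a) b d + eval3 \<phi> a (D b) d + eval3 \<phi> a b (D d)"
proof -
  have "eval3 (der_action D 3 \<phi>) a b d =
      contract d (contract b (contract a (der_action D (Suc (Suc (Suc 0))) \<phi>))) (\<lambda>_. d)"
    by (simp add: contract_def case_nat_const numeral_3_eq_3)
  also have "\<dots> = contract d (contract b (contract (D a) \<phi>)) (\<lambda>_. d) + contract d (contract (D b) (contract a \<phi>)) (\<lambda>_. d)
      + contract (D d) (contract b (contract a \<phi>)) (\<lambda>_. d)"
    by (simp add: contract_der_action contract_add der_action_0)
  finally show ?thesis
    by (simp add: contract_case_nat form3_eval[OF assms])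
qed

text \<open>D acts on each of the three slots, and antisymmetry makes the three sums equal. Each is
  6 tr D by the contraction identity, and the inner product divides by 3!.\<close>

lemma form_inner_der_action_phi:
  fixes \<phi> :: "'v::real_vector form"
  assumes fr: "g2_frame \<phi> E C" and D: "linear D"
  shows "form_inner (g2_metric \<phi>) 3 (der_action D 3 \<phi>) \<phi> = 3 * (\<Sum>i<7. C i (D (E i)))"
proof -
  note fD = g2_frameD[OF fr] and lin = form3_linear[OF g2_frameD(1)[OF fr]]
  note alt = form3_alt[OF fD(1)]
  define p where "p i j k = eval3 \<phi> (E i) (E j) (E k)" for i j k
  define q where "q i j k = eval3 \<phi> (D (E i)) (E j) (E k)" for i j k
  have dD: "is_form 3 (der_action D 3 \<phi>)"
    by (rule is_form_der_action[OF D fD(1)])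
  have e: "eval3 (der_action D 3 \<phi>) (E i) (E j) (E k) = q i j k - q j i k + q k i j" for i j k
  proof -
    have "eval3 (der_action D 3 \<phi>) a b d = eval3 \<phi> (D a) b d + eval3 \<phi> a (D b) d + eval3 \<phi> a b (D d)" for a b d
      by (rule eval3_der_action[OF fD(1)])
    then show ?thesis
      using alt(4)[of "E i" "D (E j)" "E k"] alt(5)[of "E i" "E j" "D (E k)"] alt(4)[of "E i" "D (E k)" "E j"]
      by (simp add: q_def)
  qed
  have p1: "p i j k = - p j i k" "p i j k = p k i j" for i j k
    unfolding p_def using alt(4)[of "E i" "E j" "E k"] alt(5)[of "E i" "E j" "E k"]
      alt(4)[of "E i" "E k" "E j"] by simp_all
  define S where "S = (\<Sum>i<7. \<Sum>j<7. \<Sum>k<7. q i j k * p i j k)"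
  have S2: "(\<Sum>i<7. \<Sum>j<7. \<Sum>k<7. q j i k * p i j k) = - S"
  proof -
    have "(\<Sum>i<7. \<Sum>j<7. \<Sum>k<7. q j i k * p i j k) = (\<Sum>j<7. \<Sum>i<7. \<Sum>k<7. q j i k * p i j k)"
      by (rule sum.swap)
    also have "\<dots> = (\<Sum>j<7. \<Sum>i<7. \<Sum>k<7. - (q j i k * p j i k))"
      by (intro sum.cong refl) (subst p1(1), simp)
    finally show ?thesis by (simp add: sum_negf S_def)
  qed
  have S3: "(\<Sum>i<7. \<Sum>j<7. \<Sum>k<7. q k i j * p i j k) = S"
  proof -
    have "(\<Sum>i<7. \<Sum>j<7. \<Sum>k<7. q k i j * p i j k) = (\<Sum>i<7. \<Sum>k<7. \<Sum>j<7. q k i j * p i j k)"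
      by (rule sum.cong[OF refl], rule sum.swap)
    also have "\<dots> = (\<Sum>k<7. \<Sum>i<7. \<Sum>j<7. q k i j * p i j k)"
      by (rule sum.swap)
    also have "\<dots> = (\<Sum>k<7. \<Sum>i<7. \<Sum>j<7. q k i j * p k i j)"
      by (intro sum.cong refl) (subst p1(2), simp)
    finally show ?thesis by (simp add: S_def)
  qed
  have q: "q i j k = (\<Sum>l<7. C l (D (E i)) * p l j k)" for i j k
    unfolding q_def p_def
    by (subst dual_bases_expand[OF fD(2), of "D (E i)"]) (simp only: linear_sum[OF lin(3)] linear_cmul[OF lin(3)] real_scaleR_def)
  have "S = (\<Sum>i<7. \<Sum>l<7. C l (D (E i)) * (\<Sum>j<7. \<Sum>k<7. p i j k * p l j k))"
  proof -
    have "(\<Sum>j<7. \<Sum>k<7. q i j k * p i j k) = (\<Sum>l<7. C l (D (E i)) * (\<Sum>j<7. \<Sum>k<7. p i j k * p l j k))" for i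
    proof -
      have "(\<Sum>j<7. \<Sum>k<7. q i j k * p i j k) = (\<Sum>j<7. \<Sum>k<7. \<Sum>l<7. C l (D (E i)) * (p i j k * p l j k))"
        unfolding q sum_distrib_right by (intro sum.cong refl) (simp only: mult_ac)
      also have "\<dots> = (\<Sum>j<7. \<Sum>l<7. \<Sum>k<7. C l (D (E i)) * (p i j k * p l j k))"
        by (rule sum.cong[OF refl], rule sum.swap)
      also have "\<dots> = (\<Sum>l<7. \<Sum>j<7. \<Sum>k<7. C l (D (E i)) * (p i j k * p l j k))"
        by (rule sum.swap)
      finally show ?thesis by (simp only: sum_distrib_left)
    qed
    then show ?thesis by (simp add: S_def)
  qed
  also have "\<dots> = (\<Sum>i<7. \<Sum>l<7. if l = i then 6 * C i (D (E i)) else 0)"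
  proof (intro sum.cong refl)
    fix i l :: nat assume il: "i \<in> {..<7}" "l \<in> {..<7}"
    have "(\<Sum>j<7. \<Sum>k<7. p i j k * p l j k) = (if i = l then 6 else 0)"
      unfolding p_def by (rule g2_table_contract[OF fD(3)]) (use il in \<open>simp_all only: lessThan_iff\<close>, (rule alt)+)
    then show "C l (D (E i)) * (\<Sum>j<7. \<Sum>k<7. p i j k * p l j k) = (if l = i then 6 * C i (D (E i)) else 0)"
      by auto
  qed
  also have "\<dots> = 6 * (\<Sum>i<7. C i (D (E i)))"
    by (simp add: sum_distrib_left)
  finally have S: "S = 6 * (\<Sum>i<7. C i (D (E i)))" .
  have "form_inner (g2_metric \<phi>) 3 (der_action D 3 \<phi>) \<phi> =
      (\<Sum>i<7. \<Sum>j<7. \<Sum>k<7. (q i j k - q j i k + q k i j) * p i j k) / 6"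
    unfolding form_inner_3[OF fD(2,4) dD fD(1)] e p_def ..
  also have "\<dots> = (S - (\<Sum>i<7. \<Sum>j<7. \<Sum>k<7. q j i k * p i j k) + (\<Sum>i<7. \<Sum>j<7. \<Sum>k<7. q k i j * p i j k)) / 6"
    by (simp only: S_def distrib_right left_diff_distrib sum.distrib sum_subtractf)
  finally show ?thesis
    unfolding S2 S3 using S by simp
qed

lemma form_inner_phi_phi:
  fixes \<phi> :: "'v::real_vector form"
  assumes fr: "g2_frame \<phi> E C"
  shows "form_inner (g2_metric \<phi>) 3 \<phi> \<phi> = 7"
proof -
  note fD = g2_frameD[OF fr]
  have "(\<Sum>j<7. \<Sum>k<7. eval3 \<phi> (E i) (E j) (E k) * eval3 \<phi> (E i) (E j) (E k)) = 6" if "i < 7" for i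
    using g2_table_contract[OF fD(3) form3_alt(1,2,3)[OF fD(1)] form3_alt(4,5)[OF fD(1)] that that] by simp
  then show ?thesis
    unfolding form_inner_3[OF fD(2,4) fD(1) fD(1)] by simp
qed

lemma soliton_torsion_norm:
  fixes \<phi> :: "'v::real_vector form"
  assumes fr: "g2_frame \<phi> E C" and br: "alternating_bilinear br" and tf: "g2_torsion_form br \<phi> \<tau>"
    and sol: "semi_algebraic_soliton br \<phi> l D"
  shows "form_inner (g2_metric \<phi>) 2 \<tau> \<tau> = 7 * l + 3 * (\<Sum>i<7. C i (D (E i)))"
proof -
  note fD = g2_frameD[OF fr]
  have D: "linear D" and eq: "ce_d br 2 \<tau> = (\<lambda>x. l * \<phi> x + der_action D 3 \<phi> x)"
    using sol g2_laplacian_eq[OF fr tf] by (auto simp: semi_algebraic_soliton_def lie_derivation_def)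
  have "form_inner (g2_metric \<phi>) 3 (\<lambda>x. l * \<phi> x + der_action D 3 \<phi> x) \<phi> =
      l * form_inner (g2_metric \<phi>) 3 \<phi> \<phi> + form_inner (g2_metric \<phi>) 3 (der_action D 3 \<phi>) \<phi>"
    unfolding form_inner_def Let_def
    by (simp add: distrib_right sum.distrib add_divide_distrib sum_distrib_left mult.assoc)
  then show ?thesis
    using closed_g2_inner_d_torsion[OF fr br tf] form_inner_phi_phi[OF fr] form_inner_der_action_phi[OF fr D]
    unfolding eq by simp
qed

section \<open>Structure equations and the trace identity\<close>

lemma alternating_bilinear_lie_algebra: "lie_algebra br \<Longrightarrow> alternating_bilinear br"
  by (auto simp: lie_algebra_def alternating_bilinear_def)

lemma central_ext_Pair: "central_ext br \<omega>\<^sub>0 x y = (br (fst x) (fst y), - eval2 \<omega>\<^sub>0 (fst x) (fst y))"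
  by (simp add: central_ext_def split_beta)

lemma fst_central_ext: "fst (central_ext br \<omega>\<^sub>0 x y) = br (fst x) (fst y)"
  by (simp add: central_ext_Pair)

lemma alternating_bilinear_central_ext:
  assumes br: "alternating_bilinear br" and \<omega>\<^sub>0: "is_form 2 \<omega>\<^sub>0"
  shows "alternating_bilinear (central_ext br \<omega>\<^sub>0)"
proof -
  have b: "linear (br x)" "linear (\<lambda>x. br x y)" "br x x = 0" for x y
    using br by (auto simp: alternating_bilinear_def)
  note l = form2_linear[OF \<omega>\<^sub>0]
  show ?thesis
    unfolding alternating_bilinear_def
    by (intro conjI allI linearI)
      (simp_all add: central_ext_Pair b(3) form2_alt(1)[OF \<omega>\<^sub>0] linear_add[OF b(1)] linear_add[OF b(2)] linear_cmul[OF b(1)]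
        linear_cmul[OF b(2)] linear_add[OF l(1)] linear_add[OF l(2)] linear_cmul[OF l(1)] linear_cmul[OF l(2)] zero_prod_def)
qed

lemma ce_d_lift: "ce_d (central_ext br \<omega>\<^sub>0) k (lift_form \<alpha>) = lift_form (ce_d br k \<alpha>)"
proof -
  have "(\<lambda>m. fst (case_nat a y m)) = case_nat (fst a) (\<lambda>m. fst (y m))" for a :: "'a \<times> real" and y
    by (auto simp: fun_eq_iff split: nat.split)
  then show ?thesis
    by (simp add: ce_d_def pullback_def fst_central_ext)
qed

lemma ce_d_1_eval:
  assumes "is_form 1 \<alpha>"
  shows "ce_d br 1 \<alpha> x = - \<alpha> (\<lambda>_. br (x 0) (x 1))"
proof -
  have "{..1::nat} = {0, 1}" by auto
  then show ?thesis
    by (simp add: ce_d_def form1_eval[OF assms])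
qed

lemma eval2_der_action:
  assumes "is_form 2 \<alpha>"
  shows "eval2 (der_action D 2 \<alpha>) a b = eval2 \<alpha> (D a) b + eval2 \<alpha> a (D b)"
proof -
  have "eval2 (der_action D 2 \<alpha>) a b = contract b (contract a (der_action D (Suc (Suc 0)) \<alpha>)) (\<lambda>_. b)"
    by (simp add: contract_def case_nat_const numeral_2_eq_2)
  also have "\<dots> = contract b (contract (D a) \<alpha>) (\<lambda>_. b) + contract (D b) (contract a \<alpha>) (\<lambda>_. b)"
    by (simp add: contract_der_action contract_add der_action_0)
  finally show ?thesis
    by (simp add: contract_case_nat form2_eval[OF assms])
qed

lemma ce_d_2_eval:
  assumes \<alpha>: "is_form 2 \<alpha>"
  shows "eval3 (ce_d br 2 \<alpha>) x y z = - eval2 \<alpha> (br x y) z + eval2 \<alpha> (br x z) y - eval2 \<alpha> (br y z) x"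
proof -
  have "eval3 (ce_d br 2 \<alpha>) x y z = - eval2 (der_action (br x) 2 \<alpha>) y z - ce_d br 1 (contract x \<alpha>) (case_nat y (\<lambda>_. z))"
    unfolding cartan_formula[OF \<alpha>] by simp
  also have "\<dots> = - eval2 \<alpha> (br x y) z - eval2 \<alpha> y (br x z) + eval2 \<alpha> x (br y z)"
    unfolding eval2_der_action[OF \<alpha>] ce_d_1_eval[OF is_form_contract_2[OF \<alpha>]] contract_case_nat by simp
  finally show ?thesis
    using form2_alt(2)[OF \<alpha>, of y "br x z"] form2_alt(2)[OF \<alpha>, of x "br y z"] by simp
qed

lemma lift_form_inject: "lift_form \<alpha> = lift_form \<beta> \<Longrightarrow> \<alpha> = \<beta>"
proof
  fix x :: "nat \<Rightarrow> 'a"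
  assume "lift_form \<alpha> = lift_form \<beta>"
  then have "lift_form \<alpha> (\<lambda>i. (x i, 0)) = lift_form \<beta> (\<lambda>i. (x i, 0))" by simp
  then show "\<alpha> x = \<beta> x" by (simp add: pullback_def)
qed

lemma contract_0_form:
  assumes "is_form (Suc k) \<alpha>"
  shows "contract 0 \<alpha> = (\<lambda>x. 0)"
  using contract_scale_vec[OF assms, of 0] by simp

lemma contract_zvec_lift: "is_form (Suc k) \<alpha> \<Longrightarrow> contract zvec (lift_form \<alpha>) = (\<lambda>x. 0)"
  unfolding contract_lift by (simp add: zvec_def contract_0_form) (simp add: pullback_def)

text \<open>This is d\<theta> seen as a form on the quotient, with \<theta> in the role of a
  connection form; it descends because z is central.\<close>

definition curvature :: "('h::real_vector \<Rightarrow> 'h \<Rightarrow> 'h) \<Rightarrow> 'h form \<Rightarrow> ('h \<times> real \<Rightarrow> real) \<Rightarrow> 'h form" where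
  "curvature br \<omega>\<^sub>0 \<theta> = (\<lambda>x. - \<theta> (central_ext br \<omega>\<^sub>0 (x 0, 0) (x 1, 0)))"

lemma curvature_properties:
  fixes \<theta> :: "'h::real_vector \<times> real \<Rightarrow> real"
  assumes br: "alternating_bilinear br" and \<omega>\<^sub>0: "is_form 2 \<omega>\<^sub>0" and \<theta>: "linear \<theta>"
  shows "ce_d (central_ext br \<omega>\<^sub>0) 1 (\<lambda>x. \<theta> (x 0)) = lift_form (curvature br \<omega>\<^sub>0 \<theta>)"
    "is_form 2 (curvature br \<omega>\<^sub>0 \<theta>)"
proof -
  have \<Theta>: "is_form 1 (\<lambda>x. \<theta> (x 0))" by (rule is_form_coord[OF \<theta>])
  show eq: "ce_d (central_ext br \<omega>\<^sub>0) 1 (\<lambda>x. \<theta> (x 0)) = lift_form (curvature br \<omega>\<^sub>0 \<theta>)"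
    by (rule ext) (subst ce_d_1_eval[OF \<Theta>], simp add: curvature_def pullback_def central_ext_Pair)
  have "is_form 2 (lift_form (curvature br \<omega>\<^sub>0 \<theta>))"
    using is_form_ce_d[OF alternating_bilinear_central_ext[OF br \<omega>\<^sub>0] \<Theta>] unfolding eq by (simp add: numeral_2_eq_2)
  \<comment> \<open>A form on the quotient is recovered from its lift by pulling back along the
    linear section v -> (v, 0).\<close>
  then have "is_form 2 (pullback (\<lambda>a. (a, 0)) (lift_form (curvature br \<omega>\<^sub>0 \<theta>)))"
    by (rule is_form_pullback[rotated]) (simp add: linear_iff)
  then show "is_form 2 (curvature br \<omega>\<^sub>0 \<theta>)"
    by (simp add: pullback_def)
qed

text \<open>Here 0 = d\<phi> = d\<omega> \<and> \<theta> + \<omega> \<and> d\<theta> + d\<psi>.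
  Lifted forms are annihilated by z, so contraction with z isolates d\<omega>; what remains is the
  second equation.\<close>

lemma structure_equations:
  fixes \<theta> :: "'h::real_vector \<times> real \<Rightarrow> real"
  assumes br: "alternating_bilinear br" and \<omega>\<^sub>0: "is_form 2 \<omega>\<^sub>0" and \<theta>: "linear \<theta>" "\<theta> zvec \<noteq> 0"
    and \<omega>: "is_form 2 \<omega>" and \<psi>: "is_form 3 \<psi>"
    and \<phi>: "\<phi> = (\<lambda>x. wedge 2 1 (lift_form \<omega>) (\<lambda>x. \<theta> (x 0)) x + lift_form \<psi> x)"
    and closed: "ce_d (central_ext br \<omega>\<^sub>0) 3 \<phi> = (\<lambda>_. 0)"
  shows "ce_d br 2 \<omega> = (\<lambda>_. 0)" "ce_d br 3 \<psi> = (\<lambda>x. - wedge 2 2 \<omega> (curvature br \<omega>\<^sub>0 \<theta>) x)"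
proof -
  note g = alternating_bilinear_central_ext[OF br \<omega>\<^sub>0]
  note F = curvature_properties[OF br \<omega>\<^sub>0 \<theta>(1)]
  let ?F = "curvature br \<omega>\<^sub>0 \<theta>"
  define \<Theta> where "\<Theta> = (\<lambda>x::nat \<Rightarrow> 'h \<times> real. \<theta> (x 0))"
  have \<Theta>: "is_form 1 \<Theta>" unfolding \<Theta>_def by (rule is_form_coord[OF \<theta>(1)])
  have d\<omega>: "is_form 3 (ce_d br 2 \<omega>)" and d\<psi>: "is_form 4 (ce_d br 3 \<psi>)"
    using is_form_ce_d[OF br \<omega>] is_form_ce_d[OF br \<psi>] by simp_all
  have l: "is_form 2 (lift_form \<omega>)" "is_form 3 (lift_form (ce_d br 2 \<omega>))"
    by (intro is_form_pullback linear_fst \<omega> d\<omega>)+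
  have w: "is_form 4 (wedge 2 2 \<omega> ?F)"
    using is_form_wedge[OF \<omega> F(2)] by simp
  have "ce_d (central_ext br \<omega>\<^sub>0) 3 (wedge 2 1 (lift_form \<omega>) \<Theta>) =
      (\<lambda>x. wedge 3 1 (lift_form (ce_d br 2 \<omega>)) \<Theta> x + wedge 2 2 (lift_form \<omega>) (lift_form ?F) x)"
    using ce_d_wedge[OF g l(1) \<Theta>] F(1) by (simp add: ce_d_lift \<Theta>_def numeral_2_eq_2 numeral_3_eq_3)
  then have eq: "(\<lambda>x. wedge 3 1 (lift_form (ce_d br 2 \<omega>)) \<Theta> x + lift_form (wedge 2 2 \<omega> ?F) x
      + lift_form (ce_d br 3 \<psi>) x) = (\<lambda>_. 0)"
    using closed unfolding \<phi> ce_d_add \<Theta>_def[symmetric] by (simp add: ce_d_lift wedge_pullback)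
  have cz: "contract zvec \<Theta> = (\<lambda>x. \<theta> zvec)"
    by (simp add: contract_def \<Theta>_def)
  have "contract zvec (wedge 3 1 (lift_form (ce_d br 2 \<omega>)) \<Theta>) = (\<lambda>x. - (\<theta> zvec * lift_form (ce_d br 2 \<omega>) x))"
    using wedge_contract[OF l(2) \<Theta>, of zvec] d\<omega> contract_zvec_lift[of 2 "ce_d br 2 \<omega>"]
    by (simp add: cz wedge_zero_left wedge_0_right[OF l(2)] is_form_0_iff mult.commute)
  then have "(\<lambda>x. - (\<theta> zvec * lift_form (ce_d br 2 \<omega>) x)) = (\<lambda>_. 0)"
    using arg_cong[OF eq, of "contract zvec"] contract_zvec_lift[of 3 "wedge 2 2 \<omega> ?F"]
      contract_zvec_lift[of 3 "ce_d br 3 \<psi>"] w d\<psi> by (simp add: contract_add contract_zero)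
  then have "lift_form (ce_d br 2 \<omega>) = lift_form (\<lambda>_. 0)"
    using \<theta>(2) by (auto simp: fun_eq_iff pullback_def)
  then show 1: "ce_d br 2 \<omega> = (\<lambda>_. 0)" by (rule lift_form_inject)
  have "lift_form (ce_d br 3 \<psi>) = lift_form (\<lambda>x. - wedge 2 2 \<omega> ?F x)"
    using eq unfolding 1 by (simp add: fun_eq_iff pullback_def wedge_def add_eq_0_iff)
  then show "ce_d br 3 \<psi> = (\<lambda>x. - wedge 2 2 \<omega> ?F x)"
    by (rule lift_form_inject)
qed

lemma standard_omega_coords:
  assumes fr: "su3_frame \<omega> \<psi> e c" and \<omega>: "is_form 2 \<omega>"
  shows "eval2 \<omega> v (e 1) = c 0 v" "eval2 \<omega> v (e 0) = - c 1 v" "eval2 \<omega> v (e 3) = c 2 v"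
    "eval2 \<omega> v (e 2) = - c 3 v" "eval2 \<omega> v (e 5) = c 4 v" "eval2 \<omega> v (e 4) = - c 5 v"
proof -
  have db: "dual_bases 6 e c" and om: "standard_omega e \<omega>"
    using fr by (auto simp: su3_frame_def)
  note l = form2_linear(2)[OF \<omega>]
  have x: "eval2 \<omega> v (e j) = (\<Sum>i<6. c i v * eval2 \<omega> (e i) (e j))" for j
    by (subst dual_bases_expand[OF db, of v]) (simp only: linear_sum[OF l] linear_cmul[OF l] real_scaleR_def)
  show "eval2 \<omega> v (e 1) = c 0 v" "eval2 \<omega> v (e 0) = - c 1 v" "eval2 \<omega> v (e 3) = c 2 v"
    "eval2 \<omega> v (e 2) = - c 3 v" "eval2 \<omega> v (e 5) = c 4 v" "eval2 \<omega> v (e 4) = - c 5 v"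
    unfolding x sum_lessThan_6 by (simp_all add: om[unfolded standard_omega_def, rule_format])
qed

text \<open>Since \<open>d\<omega> = 0\<close>, the vector \<open>v = \<Sum>\<^sub>i [p\<^sub>i, q\<^sub>i]\<close> satisfies \<open>\<omega>(v, x) = - tr ad\<^sub>x\<close>.\<close>

lemma unimodular_symplectic:
  fixes br :: "'h::real_vector \<Rightarrow> 'h \<Rightarrow> 'h"
  assumes fr: "su3_frame \<omega> \<psi> e c" and \<omega>: "is_form 2 \<omega>" and br: "alternating_bilinear br"
    and uni: "unimodular br" and d: "ce_d br 2 \<omega> = (\<lambda>_. 0)"
  shows "br (e 0) (e 1) + br (e 2) (e 3) + br (e 4) (e 5) = 0"
proof -
  have db: "dual_bases 6 e c" using fr by (auto simp: su3_frame_def)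
  note coords = standard_omega_coords[OF fr \<omega>]
  have bl: "linear (br x)" "linear (\<lambda>x. br x y)" "br x x = 0" for x y
    using br by (auto simp: alternating_bilinear_def)
  have anti: "br y x = - br x y" for x y :: 'h
  proof -
    have "br x y + br y x = 0"
    proof -
      have "br (x + y) (x + y) = (br x x + br y x) + (br x y + br y y)"
        by (simp only: linear_add[OF bl(1)] linear_add[OF bl(2)])
      then show ?thesis by (simp only: bl(3) add_0_left add_0_right add.commute)
    qed
    then show ?thesis by (simp only: eq_neg_iff_add_eq_0 add.commute)
  qed
  have tr: "(\<Sum>i<6. c i (br x (e i))) = 0" for x
    using uni lin_trace_dual_bases[OF db bl(1)] by (simp add: unimodular_def)
  note l = form2_linear[OF \<omega>]
  \<comment> \<open>This is d\<omega>(p, q, x) = 0 with the two brackets containing x turned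
    around.\<close>
  have 0: "eval2 \<omega> (br p q) x = - eval2 \<omega> (br x p) q + eval2 \<omega> (br x q) p" for p q x
    using ce_d_2_eval[OF \<omega>, where br = br and x = p and y = q and z = x] anti[of x p] anti[of x q]
    unfolding d by (simp add: contract_zero linear_neg[OF l(2)])
  \<comment> \<open>For p = e_0 and q = e_1 the right-hand side of \<open>0\<close> is -
    c_0([x, e_0]) - c_1([x, e_1]); the three pairs together give minus the trace of ad_x.\<close>
  have z: "eval2 \<omega> (br (e 0) (e 1) + br (e 2) (e 3) + br (e 4) (e 5)) x = 0" for x
    using tr[of x] unfolding linear_add[OF l(2)] 0[of _ _ x] coords sum_lessThan_6 by simp
  define v where "v = br (e 0) (e 1) + br (e 2) (e 3) + br (e 4) (e 5)"
  have "c i v = 0" if "i < 6" for i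
    using less_6_cases[OF that] coords[of v] z unfolding v_def[symmetric] by (elim disjE) simp_all
  then show ?thesis
    using dual_bases_expand[OF db, of v] by (simp add: v_def)
qed

lemma soliton_trace_identity:
  fixes br :: "'h::real_vector \<Rightarrow> 'h \<Rightarrow> 'h" and \<theta> :: "'h \<times> real \<Rightarrow> real"
  assumes fr: "su3_frame \<omega> \<psi> e c" and \<omega>: "is_form 2 \<omega>" and \<psi>: "is_form 3 \<psi>"
    and br: "alternating_bilinear br" and uni: "unimodular br" and \<omega>\<^sub>0: "is_form 2 \<omega>\<^sub>0"
    and \<theta>: "linear \<theta>" "\<theta> zvec \<noteq> 0"
    and \<phi>: "\<phi> = (\<lambda>x. wedge 2 1 (lift_form \<omega>) (\<lambda>x. \<theta> (x 0)) x + lift_form \<psi> x)"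
    and tf: "g2_torsion_form (central_ext br \<omega>\<^sub>0) \<phi> \<tau>"
    and sol: "semi_algebraic_soliton (central_ext br \<omega>\<^sub>0) \<phi> l D" and Dz: "D zvec = r *\<^sub>R zvec"
  shows "(\<Sum>i<7. ext_coframe c \<theta> i (D (ext_frame e \<theta> i))) = - 3 * l - 2 * r"
proof -
  let ?g = "central_ext br \<omega>\<^sub>0" and ?E = "ext_frame e \<theta>"
  have frE: "g2_frame \<phi> ?E (ext_coframe c \<theta>)"
    by (rule g2_frame_ext[OF fr \<omega> \<psi> \<theta> \<phi>])
  have f\<phi>: "is_form 3 \<phi>" by (rule g2_frameD(1)[OF frE])
  have \<tau>: "is_form 2 \<tau>" using tf by (auto simp: g2_torsion_form_def)
  have closed: "ce_d ?g 3 \<phi> = (\<lambda>_. 0)" and D: "linear D"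
    and eq: "ce_d ?g 2 \<tau> = (\<lambda>x. l * \<phi> x + der_action D 3 \<phi> x)"
    using sol g2_laplacian_eq[OF frE tf]
    by (auto simp: semi_algebraic_soliton_def closed_g2_structure_def lie_derivation_def)
  have d\<omega>: "ce_d br 2 \<omega> = (\<lambda>_. 0)"
    by (rule structure_equations(1)[OF br \<omega>\<^sub>0 \<theta> \<omega> \<psi> \<phi> closed])
  have b0: "br 0 y = 0" "br y 0 = 0" for y
    using br linear_0 by (auto simp: alternating_bilinear_def)
  note l0 = linear_0[OF form2_linear(2)] and l3 = linear_0[OF form3_linear(3)[OF \<psi>]]
  have gz: "?g zvec y = 0" for y
    by (simp add: central_ext_Pair zvec_def b0 linear_0[OF form2_linear(2)[OF \<omega>\<^sub>0]] zero_prod_def)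
  \<comment> \<open>That is, \<iota>_z \<phi> = \<theta>(z) \<omega>.\<close>
  have \<phi>z: "eval3 \<phi> zvec a b = \<theta> zvec * eval2 \<omega> (fst a) (fst b)" for a b
    unfolding \<phi> contract_add
    by (simp add: contract_case_nat wedge_2_1_function'[OF is_form_pullback[OF linear_fst \<omega>], unfolded One_nat_def] eval2_lift
        eval3_lift[unfolded contract_case_nat])
      (use l3 in \<open>simp add: zvec_def linear_0[OF form2_linear(2)[OF \<omega>]] contract_case_nat\<close>)
  \<comment> \<open>As z is central, only the term of d\<tau> with the bracket [a, b]
    remains.\<close>
  have L: "eval3 (ce_d ?g 2 \<tau>) zvec a b = eval2 \<tau> zvec (?g a b)" for a b
    unfolding ce_d_2_eval[OF \<tau>] gz
    using form2_alt(2)[OF \<tau>, of "?g a b" zvec] linear_0[OF form2_linear(2)[OF \<tau>]] by simp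
  have R: "eval3 (ce_d ?g 2 \<tau>) zvec a b = \<theta> zvec * ((l + r) * eval2 \<omega> (fst a) (fst b)
      + eval2 \<omega> (fst (D a)) (fst b) + eval2 \<omega> (fst a) (fst (D b)))" for a b
  proof -
    have "eval3 (ce_d ?g 2 \<tau>) zvec a b = l * eval3 \<phi> zvec a b + eval3 (der_action D 3 \<phi>) zvec a b"
      unfolding eq contract_add contract_cmult ..
    also have "\<dots> = l * eval3 \<phi> zvec a b + r * eval3 \<phi> zvec a b + eval3 \<phi> zvec (D a) b + eval3 \<phi> zvec a (D b)"
      unfolding eval3_der_action[OF f\<phi>] Dz linear_cmul[OF form3_linear(3)[OF f\<phi>]] by simp
    finally show ?thesis
      unfolding \<phi>z by (simp add: algebra_simps)
  qed
  have fst: "fst (?E i) = e i" if "i < 6" for i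
    using that by (simp add: ext_frame_def)
  \<comment> \<open>The quotient component of this sum vanishes by unimodularity, so \<tau>(z, .)
    evaluates it to a multiple of \<tau>(z, z) = 0.\<close>
  have "?g (?E 0) (?E 1) + ?g (?E 2) (?E 3) + ?g (?E 4) (?E 5) = s *\<^sub>R zvec"
    if "s = - eval2 \<omega>\<^sub>0 (e 0) (e 1) - eval2 \<omega>\<^sub>0 (e 2) (e 3) - eval2 \<omega>\<^sub>0 (e 4) (e 5)" for s
    using unimodular_symplectic[OF fr \<omega> br uni d\<omega>] that by (simp add: central_ext_Pair fst zvec_def)
  then have "eval2 \<tau> zvec (?g (?E 0) (?E 1) + ?g (?E 2) (?E 3) + ?g (?E 4) (?E 5)) = 0"
    by (simp add: linear_cmul[OF form2_linear(1)[OF \<tau>]] form2_alt(1)[OF \<tau>])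
  then have "eval3 (ce_d ?g 2 \<tau>) zvec (?E 0) (?E 1) + eval3 (ce_d ?g 2 \<tau>) zvec (?E 2) (?E 3)
      + eval3 (ce_d ?g 2 \<tau>) zvec (?E 4) (?E 5) = 0"
    unfolding L linear_add[OF form2_linear(1)[OF \<tau>]] .
  moreover have om: "eval2 \<omega> (e 0) (e 1) = 1" "eval2 \<omega> (e 2) (e 3) = 1" "eval2 \<omega> (e 4) (e 5) = 1"
    using fr by (simp_all add: su3_frame_def standard_omega_def)
  note co = standard_omega_coords[OF fr \<omega>]
  have co2: "eval2 \<omega> (e 0) v = c 1 v" "eval2 \<omega> (e 2) v = c 3 v" "eval2 \<omega> (e 4) v = c 5 v" for v
    using form2_alt(2)[OF \<omega>, of "e 0" v] form2_alt(2)[OF \<omega>, of "e 2" v] form2_alt(2)[OF \<omega>, of "e 4" v] co[of v]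
    by simp_all
  \<comment> \<open>For a symplectic pair, \<omega>(D e_0, e_1) + \<omega>(e_0, D e_1) is the part
    of the trace on that pair. The l-term and the action of D on z contribute l + r for each of the
    three pairs.\<close>
  have T: "3 * (l + r) + (\<Sum>i<6. c i (fst (D (?E i)))) = 0"
  proof -
    have "\<theta> zvec * (3 * (l + r) + (\<Sum>i<6. c i (fst (D (?E i))))) = 0"
      using calculation om unfolding R sum_lessThan_6 
      by (simp add: fst co co2 algebra_simps del: One_nat_def)
    then show ?thesis using \<theta>(2) by simp
  qed
  \<comment> \<open>The z-direction adds r to the trace, so the total is - 3 (l + r) + r.\<close>
  have "D (?E 6) = (r / \<theta> zvec) *\<^sub>R zvec"
  proof -
    have "?E 6 = (1 / \<theta> zvec) *\<^sub>R zvec" by (simp add: ext_frame_def zvec_def)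
    then show ?thesis by (simp add: linear_cmul[OF D] Dz)
  qed
  then have "\<theta> (D (?E 6)) = r"
    using \<theta>(2) by (simp add: linear_cmul[OF \<theta>(1)])
  then show ?thesis
    using T by (simp add: sum_lessThan_7_last ext_coframe_def)
qed

section \<open>The norm of the torsion form\<close>

lemma wedge_1_3_eval:
  assumes \<alpha>: "is_form 1 \<alpha>" and \<beta>: "is_form 3 \<beta>"
  shows "wedge 1 3 \<alpha> \<beta> (case_nat a (case_nat b (case_nat c (case_nat d y)))) =
    \<alpha> (\<lambda>_. a) * eval3 \<beta> b c d - \<alpha> (\<lambda>_. b) * eval3 \<beta> a c d +
    \<alpha> (\<lambda>_. c) * eval3 \<beta> a b d - \<alpha> (\<lambda>_. d) * eval3 \<beta> a b c"
proof -
  have f: "is_form (Suc 0) \<alpha>" "is_form (Suc (Suc (Suc 0))) \<beta>"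
    using \<alpha> \<beta> by (simp_all add: eval_nat_numeral)
  have "wedge (Suc 0) (Suc (Suc (Suc 0))) \<alpha> \<beta> (case_nat a (case_nat b (case_nat c (case_nat d y)))) =
    \<alpha> (\<lambda>_. a) * eval3 \<beta> b c d - \<alpha> (\<lambda>_. b) * eval3 \<beta> a c d +
    \<alpha> (\<lambda>_. c) * eval3 \<beta> a b d - \<alpha> (\<lambda>_. d) * eval3 \<beta> a b c"
    by (simp add: wedge_eval f form1_eval[OF \<alpha>] form3_eval[OF \<beta>])
  then show ?thesis by (simp add: eval_nat_numeral)
qed

lemma wedge_3_1_eval:
  assumes \<alpha>: "is_form 3 \<alpha>" and \<beta>: "is_form 1 \<beta>"
  shows "wedge 3 1 \<alpha> \<beta> (case_nat a (case_nat b (case_nat c (case_nat d y)))) =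
    eval3 \<alpha> a b c * \<beta> (\<lambda>_. d) - eval3 \<alpha> a b d * \<beta> (\<lambda>_. c) +
    eval3 \<alpha> a c d * \<beta> (\<lambda>_. b) - eval3 \<alpha> b c d * \<beta> (\<lambda>_. a)"
proof -
  have f: "is_form (Suc (Suc (Suc 0))) \<alpha>" "is_form (Suc 0) \<beta>"
    using \<alpha> \<beta> by (simp_all add: eval_nat_numeral)
  have "wedge (Suc (Suc (Suc 0))) (Suc 0) \<alpha> \<beta> (case_nat a (case_nat b (case_nat c (case_nat d y)))) =
    eval3 \<alpha> a b c * \<beta> (\<lambda>_. d) - eval3 \<alpha> a b d * \<beta> (\<lambda>_. c) +
    eval3 \<alpha> a c d * \<beta> (\<lambda>_. b) - eval3 \<alpha> b c d * \<beta> (\<lambda>_. a)"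
    by (simp add: wedge_eval f form3_eval[OF \<alpha>] form1_eval[OF \<beta>])
  then show ?thesis by (simp add: eval_nat_numeral)
qed

lemma wedge_3_2_eval:
  assumes \<alpha>: "is_form 3 \<alpha>" and \<beta>: "is_form 2 \<beta>"
  shows "wedge 3 2 \<alpha> \<beta> (case_nat a (case_nat b (case_nat c (case_nat d (case_nat f y))))) =
    eval3 \<alpha> a b c * eval2 \<beta> d f - eval3 \<alpha> a b d * eval2 \<beta> c f + eval3 \<alpha>
    a b f * eval2 \<beta> c d + eval3 \<alpha> a c d * eval2 \<beta> b f - eval3 \<alpha> a c f * eval2
    \<beta> b d + eval3 \<alpha> a d f * eval2 \<beta> b c - eval3 \<alpha> b c d * eval2 \<beta> a f +
    eval3 \<alpha> b c f * eval2 \<beta> a d - eval3 \<alpha> b d f * eval2 \<beta> a c + eval3 \<alpha>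
    c d f * eval2 \<beta> a b"
proof -
  have f: "is_form (Suc (Suc (Suc 0))) \<alpha>" "is_form (Suc (Suc 0)) \<beta>"
    using \<alpha> \<beta> by (simp_all add: eval_nat_numeral)
  have "wedge (Suc (Suc (Suc 0))) (Suc (Suc 0)) \<alpha> \<beta> (case_nat a (case_nat b (case_nat c (case_nat d (case_nat f y))))) =
    eval3 \<alpha> a b c * eval2 \<beta> d f - eval3 \<alpha> a b d * eval2 \<beta> c f + eval3 \<alpha>
    a b f * eval2 \<beta> c d + eval3 \<alpha> a c d * eval2 \<beta> b f - eval3 \<alpha> a c f * eval2
    \<beta> b d + eval3 \<alpha> a d f * eval2 \<beta> b c - eval3 \<alpha> b c d * eval2 \<beta> a f +
    eval3 \<alpha> b c f * eval2 \<beta> a d - eval3 \<alpha> b d f * eval2 \<beta> a c + eval3 \<alpha>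
    c d f * eval2 \<beta> a b"
    by (simp add: wedge_eval f form3_eval[OF \<alpha>] form2_eval[OF \<beta>])
  then show ?thesis by (simp add: eval_nat_numeral)
qed

lemma wedge_4_1_eval:
  assumes \<alpha>: "is_form 4 \<alpha>" and \<beta>: "is_form 1 \<beta>"
    and G: "\<And>a b c d y. \<alpha> (case_nat a (case_nat b (case_nat c (case_nat d y)))) = G a b c d"
  shows "wedge 4 1 \<alpha> \<beta> (case_nat a (case_nat b (case_nat c (case_nat d (case_nat f y))))) =
    G a b c d * \<beta> (\<lambda>_. f) - G a b c f * \<beta> (\<lambda>_. d) + G a b d f * \<beta>
    (\<lambda>_. c) - G a c d f * \<beta> (\<lambda>_. b) + G b c d f * \<beta> (\<lambda>_. a)"
proof -
  have f: "is_form (Suc (Suc (Suc (Suc 0)))) \<alpha>" "is_form (Suc 0) \<beta>"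
    using \<alpha> \<beta> by (simp_all add: eval_nat_numeral)
  have "wedge (Suc (Suc (Suc (Suc 0)))) (Suc 0) \<alpha> \<beta> (case_nat a (case_nat b (case_nat c (case_nat d (case_nat f y))))) =
    G a b c d * \<beta> (\<lambda>_. f) - G a b c f * \<beta> (\<lambda>_. d) + G a b d f * \<beta>
    (\<lambda>_. c) - G a c d f * \<beta> (\<lambda>_. b) + G b c d f * \<beta> (\<lambda>_. a)"
    by (simp add: wedge_eval f G form1_eval[OF \<beta>])
  then show ?thesis by (simp add: eval_nat_numeral)
qed

lemma wedge_2_5_table:
  fixes E :: "nat \<Rightarrow> 'v::real_vector"
  assumes \<alpha>: "is_form 2 \<alpha>" and \<xi>: "is_form 5 \<xi>"
    and X: "\<And>a b c d f y. \<xi> (case_nat (E a) (case_nat (E b) (case_nat (E c) (case_nat (E d) (case_nat (E f) y))))) = X a b c d f"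
  defines "x \<equiv> \<lambda>i j. eval2 \<alpha> (E i) (E j)"
  shows "wedge 2 5 \<alpha> \<xi> E =
    x 0 1 * X 2 3 4 5 6 - x 0 2 * X 1 3 4 5 6 + x 0 3 * X 1 2 4 5 6 - x 0 4 * X 1 2 3 5 6 + x 0 5 * X 1
    2 3 4 6 - x 0 6 * X 1 2 3 4 5 + x 1 2 * X 0 3 4 5 6 - x 1 3 * X 0 2 4 5 6 + x 1 4 * X 0 2 3 5 6 - x
    1 5 * X 0 2 3 4 6 + x 1 6 * X 0 2 3 4 5 + x 2 3 * X 0 1 4 5 6 - x 2 4 * X 0 1 3 5 6 + x 2 5 * X 0 1
    3 4 6 - x 2 6 * X 0 1 3 4 5 + x 3 4 * X 0 1 2 5 6 - x 3 5 * X 0 1 2 4 6 + x 3 6 * X 0 1 2 4 5 + x 4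
    5 * X 0 1 2 3 6 - x 4 6 * X 0 1 2 3 5 + x 5 6 * X 0 1 2 3 4"
proof -
  have f: "is_form (Suc (Suc 0)) \<alpha>" "is_form (Suc (Suc (Suc (Suc (Suc 0))))) \<xi>"
    using \<alpha> \<xi> by (simp_all add: eval_nat_numeral)
  have "wedge (Suc (Suc 0)) (Suc (Suc (Suc (Suc (Suc 0))))) \<alpha> \<xi> E =
    x 0 1 * X 2 3 4 5 6 - x 0 2 * X 1 3 4 5 6 + x 0 3 * X 1 2 4 5 6 - x 0 4 * X 1 2 3 5 6 + x 0 5 * X 1
    2 3 4 6 - x 0 6 * X 1 2 3 4 5 + x 1 2 * X 0 3 4 5 6 - x 1 3 * X 0 2 4 5 6 + x 1 4 * X 0 2 3 5 6 - x
    1 5 * X 0 2 3 4 6 + x 1 6 * X 0 2 3 4 5 + x 2 3 * X 0 1 4 5 6 - x 2 4 * X 0 1 3 5 6 + x 2 5 * X 0 1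
    3 4 6 - x 2 6 * X 0 1 3 4 5 + x 3 4 * X 0 1 2 5 6 - x 3 5 * X 0 1 2 4 6 + x 3 6 * X 0 1 2 4 5 + x 4
    5 * X 0 1 2 3 6 - x 4 6 * X 0 1 2 3 5 + x 5 6 * X 0 1 2 3 4"
    by (subst frame_seq7[of E]) (simp add: wedge_eval f form2_eval[OF \<alpha>] X x_def)
  then show ?thesis by (simp add: eval_nat_numeral)
qed

text \<open>By \<open>pair\<close>, \<xi> is minus the Hodge dual of \<tau>. So the 21 components of
  \<xi> are, up to sign, the complementary components of \<tau>, and the signs disappear in the
  squares.\<close>

lemma norm_from_wedge_2_5:
  fixes E :: "nat \<Rightarrow> 'v::real_vector"
  assumes db: "dual_bases 7 E C" and g: "g = (\<lambda>x y. \<Sum>i<7. C i x * C i y)"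
    and \<tau>: "is_form 2 \<tau>" and \<xi>: "is_form 5 \<xi>"
    and X: "\<And>a b c d f y. \<xi> (case_nat (E a) (case_nat (E b) (case_nat (E c) (case_nat (E d) (case_nat (E f) y))))) = X a b c d f"
    and pair: "\<And>\<alpha>. is_form 2 \<alpha> \<Longrightarrow> wedge 2 5 \<alpha> \<xi> E = - form_inner g 2 \<alpha> \<tau>"
  shows "form_inner g 2 \<tau> \<tau> =
    (X 0 1 2 3 4)\<^sup>2 + (X 0 1 2 3 5)\<^sup>2 + (X 0 1 2 3 6)\<^sup>2 + (X 0 1 2 4 5)\<^sup>2 + (X 0
    1 2 4 6)\<^sup>2 + (X 0 1 2 5 6)\<^sup>2 + (X 0 1 3 4 5)\<^sup>2 + (X 0 1 3 4 6)\<^sup>2 + (X 0 1 3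
    5 6)\<^sup>2 + (X 0 1 4 5 6)\<^sup>2 + (X 0 2 3 4 5)\<^sup>2 + (X 0 2 3 4 6)\<^sup>2 + (X 0 2 3 5
    6)\<^sup>2 + (X 0 2 4 5 6)\<^sup>2 + (X 0 3 4 5 6)\<^sup>2 + (X 1 2 3 4 5)\<^sup>2 + (X 1 2 3 4
    6)\<^sup>2 + (X 1 2 3 5 6)\<^sup>2 + (X 1 2 4 5 6)\<^sup>2 + (X 1 3 4 5 6)\<^sup>2 + (X 2 3 4 5
    6)\<^sup>2"
proof -
  \<comment> \<open>The 2-form C^p \<and> C^q, whose product with \<xi> picks out one
    component.\<close>
  define A where "A p q = (\<lambda>x::nat \<Rightarrow> 'v. C p (x 0) * C q (x 1) - C q (x 0) * C p (x 1))" for p q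
  define t where "t i j = eval2 \<tau> (E i) (E j)" for i j
  have A: "is_form 2 (A p q)" if "p < 7" "q < 7" for p q
  proof -
    have lin: "linear (C p)" "linear (C q)"
      using dual_bases_linear[OF db] that by auto
    have "is_form (Suc (Suc 0)) (A p q)"
    proof (rule is_form_SucI)
      show "is_form (Suc 0) (contract v (A p q))" for v
        using is_form_diff[OF is_form_cmult[OF is_form_coord[OF lin(2)], of "C p v"]
            is_form_cmult[OF is_form_coord[OF lin(1)], of "C q v"]]
        by (simp add: contract_def A_def)
      show "linear (\<lambda>v. A p q (case_nat v x))" for x
        by (rule linearI) (simp_all add: A_def linear_add[OF lin(1)] linear_add[OF lin(2)] linear_cmul[OF lin(1)]
            linear_cmul[OF lin(2)] algebra_simps)
      show "A p q (case_nat v (case_nat v x)) = 0" for v x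
        by (simp add: A_def)
    qed
    then show ?thesis by (simp add: numeral_2_eq_2)
  qed
  have Ae: "eval2 (A p q) (E i) (E j) = of_bool (p = i) * of_bool (q = j) - of_bool (q = i) * of_bool (p = j)"
    if "p < 7" "q < 7" "i < 7" "j < 7" for p q i j
    using that by (simp add: A_def dual_bases_eval[OF db])
  have anti: "t j i = - t i j" for i j
    unfolding t_def by (rule form2_alt(2)[OF \<tau>])
  have t: "t p q = - wedge 2 5 (A p q) \<xi> E" if pq: "p < 7" "q < 7" for p q
  proof -
    have "form_inner g 2 (A p q) \<tau> = (\<Sum>i<7. \<Sum>j<7. eval2 (A p q) (E i) (E j) * t i j) / 2"
      unfolding form_inner_2[OF db g A[OF pq] \<tau>] t_def ..
    also have "(\<Sum>i<7. \<Sum>j<7. eval2 (A p q) (E i) (E j) * t i j) =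
        (\<Sum>i<7. \<Sum>j<7. (if p = i then if q = j then t p q else 0 else 0) - (if q = i then if p = j then t q p else 0 else 0))"
      by (intro sum.cong refl) (auto simp: Ae pq)
    also have "\<dots> = t p q - t q p"
    proof -
      have d: "(\<Sum>i<7. \<Sum>j<7. if a = i then if b = j then r else 0 else 0) = r"
        if "a < 7" "b < 7" for a b :: nat and r :: real
      proof -
        have "(\<Sum>j<7. if a = i then if b = j then r else 0 else 0) = (if a = i then r else 0)" for i
          using that by simp
        then show ?thesis using that by simp
      qed
      show ?thesis
        unfolding sum_subtractf by (simp only: d[OF pq] d[OF pq(2,1)])
    qed
    finally show ?thesis
      using pair[OF A[OF pq]] anti[of q p] by simp
  qed
  note W = wedge_2_5_table[OF A \<xi> X]
  have T: "t 0 1 = - X 2 3 4 5 6"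
    "t 0 2 = X 1 3 4 5 6"
    "t 0 3 = - X 1 2 4 5 6"
    "t 0 4 = X 1 2 3 5 6"
    "t 0 5 = - X 1 2 3 4 6"
    "t 0 6 = X 1 2 3 4 5"
    "t 1 2 = - X 0 3 4 5 6"
    "t 1 3 = X 0 2 4 5 6"
    "t 1 4 = - X 0 2 3 5 6"
    "t 1 5 = X 0 2 3 4 6"
    "t 1 6 = - X 0 2 3 4 5"
    "t 2 3 = - X 0 1 4 5 6"
    "t 2 4 = X 0 1 3 5 6"
    "t 2 5 = - X 0 1 3 4 6"
    "t 2 6 = X 0 1 3 4 5"
    "t 3 4 = - X 0 1 2 5 6"
    "t 3 5 = X 0 1 2 4 6"
    "t 3 6 = - X 0 1 2 4 5"
    "t 4 5 = - X 0 1 2 3 6"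
    "t 4 6 = X 0 1 2 3 5"
    "t 5 6 = - X 0 1 2 3 4"
    by (simp_all del: One_nat_def add: t W Ae)
  have "form_inner g 2 \<tau> \<tau> = (\<Sum>i<7. \<Sum>j<7. t i j * t i j) / 2"
    unfolding form_inner_2[OF db g \<tau> \<tau>] t_def ..
  also have "\<dots> = (t 0 1)\<^sup>2 + (t 0 2)\<^sup>2 + (t 0 3)\<^sup>2 + (t 0 4)\<^sup>2 + (t 0 5)\<^sup>2 + (t 0
    6)\<^sup>2 + (t 1 2)\<^sup>2 + (t 1 3)\<^sup>2 + (t 1 4)\<^sup>2 + (t 1 5)\<^sup>2 + (t 1 6)\<^sup>2
    + (t 2 3)\<^sup>2 + (t 2 4)\<^sup>2 + (t 2 5)\<^sup>2 + (t 2 6)\<^sup>2 + (t 3 4)\<^sup>2 + (t 3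
    5)\<^sup>2 + (t 3 6)\<^sup>2 + (t 4 5)\<^sup>2 + (t 4 6)\<^sup>2 + (t 5 6)\<^sup>2"
  proof -
    have z: "t i i = 0" for i unfolding t_def by (rule form2_alt(1)[OF \<tau>])
    have s: "j < i \<Longrightarrow> t i j = - t j i" for i j by (rule anti)
    show ?thesis
      unfolding sum_lessThan_7 by (simp add: z s power2_eq_square del: One_nat_def)
  qed
  finally show ?thesis
    unfolding T by simp
qed

lemma comp_case_nat: "(\<lambda>i. f (case_nat a x i)) = case_nat (f a) (\<lambda>i. f (x i))"
  by (auto simp: fun_eq_iff split: nat.split)

lemma g2_star_phi:
  fixes \<theta> :: "'h::real_vector \<times> real \<Rightarrow> real"
  assumes fr: "su3_frame \<omega> \<psi> e c" and \<omega>: "is_form 2 \<omega>" and \<psi>: "is_form 3 \<psi>" and \<psi>m: "is_form 3 (psi_minus \<omega> \<psi>)"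
    and \<theta>: "linear \<theta>" "\<theta> zvec \<noteq> 0"
    and \<phi>: "\<phi> = (\<lambda>x. wedge 2 1 (lift_form \<omega>) (\<lambda>x. \<theta> (x 0)) x + lift_form \<psi> x)"
  shows "g2_hodge \<phi> 3 \<phi> =
    (\<lambda>x. 1 / 2 * lift_form (form2_square \<omega>) x + wedge 3 1 (lift_form (psi_minus \<omega> \<psi>)) (\<lambda>x. \<theta> (x 0)) x)"
    (is "_ = ?\<chi>")
proof -
  let ?E = "ext_frame e \<theta>" and ?m = "psi_minus \<omega> \<psi>"
  have om: "standard_omega e \<omega>" and tab: "complex_volume_table e ?m 0 1"
    using fr by (auto simp: su3_frame_def)
  have \<Theta>: "is_form 1 (\<lambda>x. \<theta> (x 0))" by (rule is_form_coord[OF \<theta>(1)])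
  have l: "is_form 4 (lift_form (form2_square \<omega>))" "is_form 3 (lift_form ?m)"
    by (intro is_form_pullback linear_fst is_form_form2_square \<omega> \<psi>m)+
  have "is_form 4 (wedge 3 1 (lift_form ?m) (\<lambda>x. \<theta> (x 0)))"
    using is_form_wedge[OF l(2) \<Theta>] by simp
  then have \<chi>: "is_form 4 ?\<chi>"
    by (intro is_form_add is_form_cmult l)
  have sq: "lift_form (form2_square \<omega>) (case_nat p (case_nat q (case_nat r (case_nat s y)))) =
      2 * (eval2 \<omega> (fst p) (fst q) * eval2 \<omega> (fst r) (fst s) - eval2 \<omega> (fst p) (fst r) * eval2 \<omega> (fst q) (fst s)
      + eval2 \<omega> (fst p) (fst s) * eval2 \<omega> (fst q) (fst r))" for p q r s y
    unfolding pullback_def comp_case_nat form2_square_def wedge_2_2_eval[OF \<omega> \<omega>] by simp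
  have fst: "fst (?E i) = (if i < 6 then e i else 0)" for i
    by (simp add: ext_frame_def)
  show ?thesis
  proof (rule g2_hodge_phi[OF g2_frame_ext[OF fr \<omega> \<psi> \<theta> \<phi>] \<chi>])
    \<comment> \<open>A fixed tail makes the components a function of the four indices alone, as the
      table requires.\<close>
    show "?\<chi> (case_nat (?E p) (case_nat (?E q) (case_nat (?E r) (case_nat (?E s) y)))) =
        ?\<chi> (case_nat (?E p) (case_nat (?E q) (case_nat (?E r) (case_nat (?E s) (\<lambda>_. 0)))))"
      for p q r s y
      by (rule is_form_cong[OF \<chi>]) (auto simp: eval_nat_numeral less_Suc_eq)
    show "g2_star_table (\<lambda>p q r s. ?\<chi> (case_nat (?E p) (case_nat (?E q) (case_nat (?E r) (case_nat (?E s) (\<lambda>_. 0))))))"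
      unfolding g2_star_table_def sq wedge_3_1_eval[OF l(2) \<Theta>] eval3_lift fst ext_frame_theta[OF \<theta>]
      by (simp del: One_nat_def add: om[unfolded standard_omega_def, rule_format] tab[unfolded complex_volume_table_def]
        linear_0[OF form2_linear(1)[OF \<omega>]] linear_0[OF form2_linear(2)[OF \<omega>]] linear_0[OF form3_linear(1)[OF \<psi>m]])
  qed
qed

text \<open>The square of the closed form \<omega> is closed, and the odd degree of \<rho> produces
  the minus sign in front of \<rho> \<and> d\<theta>.\<close>

lemma ce_d_star_phi:
  fixes \<theta> :: "'h::real_vector \<times> real \<Rightarrow> real" and \<rho> :: "'h form"
  assumes br: "alternating_bilinear br" and \<omega>\<^sub>0: "is_form 2 \<omega>\<^sub>0" and \<theta>: "linear \<theta>"
    and \<omega>: "is_form 2 \<omega>" and \<rho>: "is_form 3 \<rho>" and d\<omega>: "ce_d br 2 \<omega> = (\<lambda>_. 0)"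
  shows "ce_d (central_ext br \<omega>\<^sub>0) 4
      (\<lambda>x. 1 / 2 * lift_form (form2_square \<omega>) x + wedge 3 1 (lift_form \<rho>) (\<lambda>x. \<theta> (x 0)) x) =
    (\<lambda>x. wedge 4 1 (lift_form (ce_d br 3 \<rho>)) (\<lambda>x. \<theta> (x 0)) x
      - wedge 3 2 (lift_form \<rho>) (lift_form (curvature br \<omega>\<^sub>0 \<theta>)) x)"
proof -
  note g = alternating_bilinear_central_ext[OF br \<omega>\<^sub>0] and F = curvature_properties[OF br \<omega>\<^sub>0 \<theta>]
  have \<Theta>: "is_form 1 (\<lambda>x. \<theta> (x 0))" by (rule is_form_coord[OF \<theta>])
  have l: "is_form 3 (lift_form \<rho>)"
    by (intro is_form_pullback linear_fst \<rho>)
  have "ce_d br 4 (form2_square \<omega>) = (\<lambda>_. 0)"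
    unfolding form2_square_def using ce_d_wedge[OF br \<omega> \<omega>] by (simp add: d\<omega> wedge_zero_left wedge_zero_right)
  moreover have "ce_d (central_ext br \<omega>\<^sub>0) 4 (wedge 3 1 (lift_form \<rho>) (\<lambda>x. \<theta> (x 0))) =
    (\<lambda>x. wedge 4 1 (lift_form (ce_d br 3 \<rho>)) (\<lambda>x. \<theta> (x 0)) x
      - wedge 3 2 (lift_form \<rho>) (lift_form (curvature br \<omega>\<^sub>0 \<theta>)) x)"
    using ce_d_wedge[OF g l \<Theta>] F(1) by (simp add: ce_d_lift numeral_2_eq_2 eval_nat_numeral)
  ultimately show ?thesis
    unfolding ce_d_add ce_d_cmult ce_d_lift by (simp add: pullback_def)
qed

lemma sum_squares_antisymmetric_6: "(\<Sum>i<(6::nat). \<Sum>j<(6::nat). t i j * t i j) / 2 =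
    (t 0 1)\<^sup>2 + (t 0 2)\<^sup>2 + (t 0 3)\<^sup>2 + (t 0 4)\<^sup>2 + (t 0 5)\<^sup>2 + (t 1 2)\<^sup>2 + (t 1 3)\<^sup>2 + (t 1 4)\<^sup>2
    + (t 1 5)\<^sup>2 + (t 2 3)\<^sup>2 + (t 2 4)\<^sup>2 + (t 2 5)\<^sup>2 + (t 3 4)\<^sup>2 + (t 3 5)\<^sup>2 + (t 4 5 :: real)\<^sup>2"
  if diag: "\<And>i. t i i = 0" and anti: "\<And>i j. t i j = - t j i"
proof -
  have "j < i \<Longrightarrow> t i j = - t j i" for i j by (rule anti)
  then show ?thesis
    unfolding sum_lessThan_6 by (simp add: diag power2_eq_square del: One_nat_def)
qed

text \<open>The first six relations are J-invariance on pairs from different complex lines; the last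
  is primitivity, as \<beta> \<and> \<omega>^2 has frame value 2 (t_01 + t_23 + t_45).\<close>

lemma Lambda2_8_components:
  assumes su3: "su3_structure \<omega> \<psi>" and fr: "su3_frame \<omega> \<psi> e c" and \<beta>: "\<beta> \<in> Lambda2_8 \<omega> \<psi>"
  defines "t \<equiv> \<lambda>i j. eval2 \<beta> (e i) (e j)"
  shows "t 1 3 = t 0 2" "t 1 2 = - t 0 3" "t 1 5 = t 0 4" "t 1 4 = - t 0 5" "t 3 5 = t 2 4" "t 3 4 = - t 2 5"
    "t 0 1 + t 2 3 + t 4 5 = 0"
proof -
  define J where "J = su3_J \<omega> \<psi>"
  have \<omega>: "is_form 2 \<omega>" using su3 by (auto simp: su3_structure_def)
  have f: "is_form 2 \<beta>" and inv: "pullback J \<beta> = \<beta>" and 0: "wedge 2 4 \<beta> (form2_square \<omega>) = (\<lambda>_. 0)"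
    using \<beta> by (auto simp: Lambda2_8_def J_def)
  have Je: "J (e 0) = e 1" "J (e 2) = e 3" "J (e 4) = e 5" and om: "standard_omega e \<omega>"
    using fr by (auto simp: su3_frame_def J_def)
  have JJ: "J (J v) = - v" for v
    unfolding J_def by (rule su3_J_properties(2)[OF su3])
  have Je': "J (e 1) = - e 0" "J (e 3) = - e 2" "J (e 5) = - e 4"
    using JJ[of "e 0"] JJ[of "e 2"] JJ[of "e 4"] by (simp_all add: Je)
  have J: "eval2 \<beta> (J a) (J b) = eval2 \<beta> a b" for a b
  proof -
    have "pullback J \<beta> (case_nat a (\<lambda>_. b)) = eval2 \<beta> (J a) (J b)"
      unfolding pullback_def comp_case_nat ..
    then show ?thesis by (simp add: inv)
  qed
  note l = form2_linear[OF f]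
  show "t 1 3 = t 0 2" "t 1 5 = t 0 4" "t 3 5 = t 2 4" "t 1 2 = - t 0 3" "t 1 4 = - t 0 5" "t 3 4 = - t 2 5"
    using J[of "e 0" "e 2"] J[of "e 0" "e 4"] J[of "e 2" "e 4"] J[of "e 0" "e 3"] J[of "e 0" "e 5"] J[of "e 2" "e 5"]
    unfolding Je Je' t_def linear_neg[OF l(1)] by simp_all
  have f': "is_form (Suc (Suc 0)) \<beta>" "is_form (Suc (Suc (Suc (Suc 0)))) (form2_square \<omega>)"
    using f is_form_form2_square[OF \<omega>] by (simp_all add: eval_nat_numeral)
  have sq: "form2_square \<omega> (case_nat a (case_nat b (case_nat d (case_nat r z)))) =
      2 * (eval2 \<omega> a b * eval2 \<omega> d r - eval2 \<omega> a d * eval2 \<omega> b r + eval2 \<omega> a r * eval2 \<omega> b d)" for a b d r z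
    unfolding form2_square_def wedge_2_2_eval[OF \<omega> \<omega>] by simp
  have "wedge (Suc (Suc 0)) (Suc (Suc (Suc (Suc 0)))) \<beta> (form2_square \<omega>) e = 2 * (t 0 1 + t 2 3 + t 4 5)"
    by (subst frame_seq6[of e])
      (simp add: wedge_eval f' form2_eval[OF f] sq t_def
        om[unfolded standard_omega_def, rule_format])
  moreover have "wedge (Suc (Suc 0)) (Suc (Suc (Suc (Suc 0)))) \<beta> (form2_square \<omega>) e = 0"
    using fun_cong[OF 0, of e] by (simp add: eval_nat_numeral)
  ultimately show "t 0 1 + t 2 3 + t 4 5 = 0" by simp
qed

lemma torsion_norm:
  fixes br :: "'h::real_vector \<Rightarrow> 'h \<Rightarrow> 'h" and \<theta> :: "'h \<times> real \<Rightarrow> real"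
  assumes su3: "su3_structure \<omega> \<psi>" and fr: "su3_frame \<omega> \<psi> e c"
    and br: "alternating_bilinear br" and \<omega>\<^sub>0: "is_form 2 \<omega>\<^sub>0"
    and \<theta>: "linear \<theta>" "\<theta> zvec \<noteq> 0"
    and \<phi>: "\<phi> = (\<lambda>x. wedge 2 1 (lift_form \<omega>) (\<lambda>x. \<theta> (x 0)) x + lift_form \<psi> x)"
    and closed: "ce_d (central_ext br \<omega>\<^sub>0) 3 \<phi> = (\<lambda>_. 0)"
    and tf: "g2_torsion_form (central_ext br \<omega>\<^sub>0) \<phi> \<tau>"
    and stf: "su3_torsion_forms br \<omega> \<psi> w1 w2p w2m"
  shows "form_inner (g2_metric \<phi>) 2 \<tau> \<tau> =
    form_inner (su3_metric \<omega> \<psi>) 2 w2m w2m + 6 * form_inner (su3_metric \<omega> \<psi>) 1 w1 w1"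
proof -
  let ?E = "ext_frame e \<theta>" and ?m = "psi_minus \<omega> \<psi>" and ?g = "central_ext br \<omega>\<^sub>0"
  let ?F = "curvature br \<omega>\<^sub>0 \<theta>"
  define J where "J = su3_J \<omega> \<psi>"
  have \<omega>: "is_form 2 \<omega>" and \<psi>: "is_form 3 \<psi>"
    using su3 by (auto simp: su3_structure_def)
  note \<psi>m = psi_minus_properties(1)[OF su3]
  have db: "dual_bases 6 e c" and met: "su3_metric \<omega> \<psi> = (\<lambda>x y. \<Sum>i<6. c i x * c i y)"
    and om: "standard_omega e \<omega>" and tab: "complex_volume_table e \<psi> 1 0" "complex_volume_table e ?m 0 1"
    and Je: "J (e 0) = e 1" "J (e 2) = e 3" "J (e 4) = e 5"
    using fr by (auto simp: su3_frame_def J_def)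
  note om' = om[unfolded standard_omega_def, rule_format] and tab' = tab[unfolded complex_volume_table_def]
  have w1: "is_form 1 w1" and w2p: "w2p \<in> Lambda2_8 \<omega> \<psi>" "is_form 2 w2p" and w2m: "w2m \<in> Lambda2_8 \<omega> \<psi>" "is_form 2 w2m"
    and d\<psi>: "ce_d br 3 \<psi> = (\<lambda>x. wedge 2 2 w2p \<omega> x + wedge 1 3 w1 \<psi> x)"
    and d\<psi>m: "ce_d br 3 ?m = (\<lambda>x. wedge 2 2 w2m \<omega> x + wedge 1 3 (pullback J w1) \<psi> x)"
    using stf by (auto simp: su3_torsion_forms_def Lambda2_8_def J_def)
  have F: "is_form 2 ?F" by (rule curvature_properties(2)[OF br \<omega>\<^sub>0 \<theta>(1)])
  note frE = g2_frame_ext[OF fr \<omega> \<psi> \<theta> \<phi>] and se = structure_equations[OF br \<omega>\<^sub>0 \<theta> \<omega> \<psi> \<phi> closed]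
  note fD = g2_frameD[OF frE] and h = g2_hodge_works[OF frE]
  have \<Theta>: "is_form 1 (\<lambda>x. \<theta> (x 0))" by (rule is_form_coord[OF \<theta>(1)])
  have J: "linear J" "\<And>v. J (J v) = - v"
    unfolding J_def by (rule su3_J_properties[OF su3])+
  have Je': "J (e 1) = - e 0" "J (e 3) = - e 2" "J (e 5) = - e 4"
    using J(2)[of "e 0"] J(2)[of "e 2"] J(2)[of "e 4"] by (simp_all add: Je)
  have Jw: "is_form 1 (pullback J w1)"
    by (rule is_form_pullback[OF J(1) w1])
  define f where "f i j = eval2 ?F (e i) (e j)" for i j
  define v where "v i j = eval2 w2p (e i) (e j)" for i j
  define y where "y i j = eval2 w2m (e i) (e j)" for i j
  define x where "x i = w1 (\<lambda>_. e i)" for i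
  have lw: "linear (\<lambda>u. w1 (\<lambda>_. u))"
    using is_form_linear_head[of 0 w1] w1 form1_eval[OF w1] by simp
  have Jx: "pullback J w1 (\<lambda>_. e 0) = x 1" "pullback J w1 (\<lambda>_. e 1) = - x 0" "pullback J w1 (\<lambda>_. e 2) = x 3"
    "pullback J w1 (\<lambda>_. e 3) = - x 2" "pullback J w1 (\<lambda>_. e 4) = x 5" "pullback J w1 (\<lambda>_. e 5) = - x 4"
    unfolding pullback_def Je Je' x_def linear_neg[OF lw] by (rule refl)+
  note v_rel = Lambda2_8_components[OF su3 fr w2p(1), folded v_def]
    and y_rel = Lambda2_8_components[OF su3 fr w2m(1), folded y_def]
  have curv: "- wedge 2 2 \<omega> ?F z = wedge 2 2 w2p \<omega> z + wedge 1 3 w1 \<psi> z" for z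
    using fun_cong[OF d\<psi>, of z] fun_cong[OF se(2), of z] by simp
  have q: "- wedge 2 2 \<omega> ?F (case_nat (e a) (case_nat (e b) (case_nat (e d) (case_nat (e s) (\<lambda>_. 0))))) =
      wedge 2 2 w2p \<omega> (case_nat (e a) (case_nat (e b) (case_nat (e d) (case_nat (e s) (\<lambda>_. 0)))))
      + wedge 1 3 w1 \<psi> (case_nat (e a) (case_nat (e b) (case_nat (e d) (case_nat (e s) (\<lambda>_. 0)))))" for a b d s
    by (rule curv)
  note q' = q[unfolded wedge_2_2_eval[OF \<omega> F] wedge_2_2_eval[OF w2p(2) \<omega>] wedge_1_3_eval[OF w1 \<psi>]]
  note ev = om' tab' f_def[symmetric] v_def[symmetric] y_def[symmetric] x_def[symmetric]
  \<comment> \<open>Comparing both expressions for d\<psi>_+ on 4-tuples gives the components of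
    d\<theta> across different complex lines. Those within a line do not occur in \<psi>_- \<and>
    d\<theta>.\<close>
  have fe: "f 2 4 = x 1 - v 2 4" "f 2 5 = x 0 - v 2 5" "f 3 4 = x 0 - v 3 4" "f 3 5 = - x 1 - v 3 5"
    "f 0 4 = - x 3 - v 0 4" "f 0 5 = - x 2 - v 0 5" "f 0 2 = x 5 - v 0 2" "f 0 3 = x 4 - v 0 3"
    "f 1 4 = - x 2 - v 1 4" "f 1 5 = x 3 - v 1 5" "f 1 2 = x 4 - v 1 2" "f 1 3 = - x 5 - v 1 3"
    using q'[of 0 1 2 4] q'[of 0 1 2 5] q'[of 0 1 3 4] q'[of 0 1 3 5] q'[of 0 2 3 4] q'[of 0 2 3 5]
      q'[of 0 2 4 5] q'[of 0 3 4 5] q'[of 1 2 3 4] q'[of 1 2 3 5] q'[of 1 2 4 5] q'[of 1 3 4 5]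
    by (simp_all del: One_nat_def add: ev)
  define \<xi> where "\<xi> = ce_d ?g 4 (g2_hodge \<phi> 3 \<phi>)"
  have \<xi>_eq: "\<xi> = (\<lambda>x. wedge 4 1 (lift_form (ce_d br 3 ?m)) (\<lambda>x. \<theta> (x 0)) x - wedge 3 2 (lift_form ?m) (lift_form ?F) x)"
    unfolding \<xi>_def g2_star_phi[OF fr \<omega> \<psi> \<psi>m \<theta> \<phi>] by (rule ce_d_star_phi[OF br \<omega>\<^sub>0 \<theta>(1) \<omega> \<psi>m se(1)])
  have \<xi>: "is_form 5 \<xi>"
    using is_form_ce_d[OF alternating_bilinear_central_ext[OF br \<omega>\<^sub>0] h(1)] by (simp add: \<xi>_def)
  \<comment> \<open>The differential of the dual of \<phi> equals \<tau> \<and> \<phi>, that is,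
    minus the dual of \<tau>.\<close>
  have pair: "wedge 2 5 \<alpha> \<xi> ?E = - form_inner (g2_metric \<phi>) 2 \<alpha> \<tau>" if \<alpha>: "is_form 2 \<alpha>" for \<alpha>
  proof -
    have "\<xi> = (\<lambda>x. - g2_hodge \<phi> 2 \<tau> x)"
      using tf by (simp add: g2_torsion_form_def \<xi>_def)
    then show ?thesis
      using h(4)[OF \<alpha>, of \<tau>] fD(6) by (simp add: wedge_minus_right)
  qed
  have l: "is_form 4 (lift_form (ce_d br 3 ?m))" "is_form 3 (lift_form ?m)" "is_form 2 (lift_form ?F)"
  proof -
    have 4: "is_form 4 (ce_d br 3 ?m)" using is_form_ce_d[OF br \<psi>m] by simp
    show "is_form 4 (lift_form (ce_d br 3 ?m))" "is_form 3 (lift_form ?m)" "is_form 2 (lift_form ?F)"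
      by (intro is_form_pullback linear_fst \<psi>m F 4)+
  qed
  define G where "G a b d s = wedge 2 2 w2m \<omega> (case_nat a (case_nat b (case_nat d (case_nat s (\<lambda>_. 0)))))
    + wedge 1 3 (pullback J w1) \<psi> (case_nat a (case_nat b (case_nat d (case_nat s (\<lambda>_. 0)))))" for a b d s
  have G: "lift_form (ce_d br 3 ?m) (case_nat a (case_nat b (case_nat d (case_nat s z)))) = G (fst a) (fst b) (fst d) (fst s)"
    for a b d s z
    unfolding pullback_def[of fst] comp_case_nat d\<psi>m G_def wedge_2_2_eval[OF w2m(2) \<omega>] wedge_1_3_eval[OF Jw \<psi>] by (rule refl)
  have fst: "fst (?E i) = (if i < 6 then e i else 0)" for i
    by (simp add: ext_frame_def)
  have val: "\<xi> (case_nat (?E a) (case_nat (?E b) (case_nat (?E d) (case_nat (?E s) (case_nat (?E r) z))))) =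
      \<xi> (case_nat (?E a) (case_nat (?E b) (case_nat (?E d) (case_nat (?E s) (case_nat (?E r) (\<lambda>_. 0))))))" for a b d s r z
    by (rule is_form_cong[OF \<xi>]) (auto simp: eval_nat_numeral less_Suc_eq)
  define X where "X a b d s r = \<xi> (case_nat (?E a) (case_nat (?E b) (case_nat (?E d) (case_nat (?E s) (case_nat (?E r) (\<lambda>_. 0))))))" for a b d s r
  have X: "X a b d s r = G (fst (?E a)) (fst (?E b)) (fst (?E d)) (fst (?E s)) * \<theta> (?E r)
     - G (fst (?E a)) (fst (?E b)) (fst (?E d)) (fst (?E r)) * \<theta> (?E s)
     + G (fst (?E a)) (fst (?E b)) (fst (?E s)) (fst (?E r)) * \<theta> (?E d)
     - G (fst (?E a)) (fst (?E d)) (fst (?E s)) (fst (?E r)) * \<theta> (?E b)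
     + G (fst (?E b)) (fst (?E d)) (fst (?E s)) (fst (?E r)) * \<theta> (?E a)
     - wedge 3 2 (lift_form ?m) (lift_form ?F) (case_nat (?E a) (case_nat (?E b) (case_nat (?E d) (case_nat (?E s) (case_nat (?E r) (\<lambda>_. 0))))))"
    for a b d s r
    unfolding X_def \<xi>_eq wedge_4_1_eval[OF l(1) \<Theta> G] by simp
  have zero: "eval3 ?m a b 0 = 0" "eval2 ?F a 0 = 0" "eval2 ?F 0 a = 0" for a b
    using linear_0[OF form3_linear(1)[OF \<psi>m]] linear_0[OF form2_linear(1)[OF F]] linear_0[OF form2_linear(2)[OF F]] by auto
  \<comment> \<open>The coframe functional \<theta> is 1 on the last vector and 0 on the others, and
    lifts vanish on the last one; so these components are those of d\<psi>_-.\<close>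
  have X6: "X a b d s 6 = G (e a) (e b) (e d) (e s)" if "a < 6" "b < 6" "d < 6" "s < 6" for a b d s
    using that unfolding X ext_frame_theta[OF \<theta>] fst wedge_3_2_eval[OF l(2,3)] eval3_lift eval2_lift by (simp add: zero)
  have X5: "X a b d s r = - wedge 3 2 ?m ?F (case_nat (e a) (case_nat (e b) (case_nat (e d) (case_nat (e s) (case_nat (e r) (\<lambda>_. 0))))))"
    if "a < 6" "b < 6" "d < 6" "s < 6" "r < 6" for a b d s r
    using that unfolding X ext_frame_theta[OF \<theta>] fst wedge_3_2_eval[OF l(2,3)] wedge_3_2_eval[OF \<psi>m F] eval3_lift eval2_lift by simp
  note G' = G_def[unfolded wedge_2_2_eval[OF w2m(2) \<omega>] wedge_1_3_eval[OF Jw \<psi>]]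
  \<comment> \<open>Each value is minus the sum or difference of two components of d\<theta>. Their
    w_2^+ parts cancel by J-invariance and their w_1 parts add up; the factor 2 is the origin of 4
    |w_1|^2.\<close>
  have vals: "X 0 1 2 3 4 = - (2 * x 4)" "X 0 1 2 3 5 = - (2 * x 5)" "X 0 1 2 4 5 = - (2 * x 2)" "X 0 1 3 4 5 = - (2 * x 3)"
    "X 0 2 3 4 5 = - (2 * x 0)" "X 1 2 3 4 5 = - (2 * x 1)"
    by (simp_all del: One_nat_def add: X5 wedge_3_2_eval[OF \<psi>m F] ev fe v_rel)
  have N: "form_inner (g2_metric \<phi>) 2 \<tau> \<tau> =
      (X 0 1 2 3 4)\<^sup>2 + (X 0 1 2 3 5)\<^sup>2 + (X 0 1 2 3 6)\<^sup>2 + (X 0 1 2 4 5)\<^sup>2 + (X 0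
      1 2 4 6)\<^sup>2 + (X 0 1 2 5 6)\<^sup>2 + (X 0 1 3 4 5)\<^sup>2 + (X 0 1 3 4 6)\<^sup>2 + (X 0 1 3
      5 6)\<^sup>2 + (X 0 1 4 5 6)\<^sup>2 + (X 0 2 3 4 5)\<^sup>2 + (X 0 2 3 4 6)\<^sup>2 + (X 0 2 3 5
      6)\<^sup>2 + (X 0 2 4 5 6)\<^sup>2 + (X 0 3 4 5 6)\<^sup>2 + (X 1 2 3 4 5)\<^sup>2 + (X 1 2 3 4
      6)\<^sup>2 + (X 1 2 3 5 6)\<^sup>2 + (X 1 2 4 5 6)\<^sup>2 + (X 1 3 4 5 6)\<^sup>2 + (X 2 3 4 5
      6)\<^sup>2"
    using tf by (intro norm_from_wedge_2_5[OF fD(2,4) _ \<xi> val[folded X_def] pair]) (auto simp: g2_torsion_form_def)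
  \<comment> \<open>Eliminating one diagonal component builds primitivity into the final expansion,
    which compares polynomials in the remaining components.\<close>
  have y45: "y 4 5 = - y 0 1 - y 2 3"
    using y_rel(7) by simp
  have anti: "\<And>i. y i i = 0" "\<And>i j. y i j = - y j i"
    unfolding y_def by (rule form2_alt[OF w2m(2)])+
  have "form_inner (su3_metric \<omega> \<psi>) 2 w2m w2m = (\<Sum>i<6. \<Sum>j<6. y i j * y i j) / 2"
    unfolding form_inner_2[OF db met w2m(2) w2m(2)] y_def ..
  note 2 = trans[OF this sum_squares_antisymmetric_6[of y, OF anti]]
  have 1: "form_inner (su3_metric \<omega> \<psi>) 1 w1 w1 = (\<Sum>i<6. x i * x i)"
    unfolding form_inner_1[OF db met w1 w1] x_def ..
  show ?thesis
    unfolding N 1 2 vals sum_lessThan_6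
    by (simp del: One_nat_def add: X6 G' ev Jx y_rel(1-6) y45 power2_eq_square algebra_simps)
qed

theorem proposition5p2:
  fixes br :: "'h::real_vector \<Rightarrow> 'h \<Rightarrow> 'h"
    and \<omega>\<^sub>0 :: "'h form"
    and \<phi> \<tau> :: "('h \<times> real) form"
    and D :: "'h \<times> real \<Rightarrow> 'h \<times> real"
    and l c :: real
    and \<omega> \<psi> w1 w2p w2m :: "'h form"
  defines "g \<equiv> central_ext br \<omega>\<^sub>0"
  assumes "dim (UNIV :: 'h set) = 6"
    and "lie_algebra br"
    and "unimodular br"
    and "is_form 2 \<omega>\<^sub>0"
    and "ce_d br 2 \<omega>\<^sub>0 = (\<lambda>_. 0)"
    and "unimodular g"
    and "lie_center g \<noteq> {0}"
    and "semi_algebraic_soliton g \<phi> l D"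
    and "D zvec = c *\<^sub>R zvec"
    and "g2_torsion_form g \<phi> \<tau>"
    and "induced_su3_structure \<phi> \<omega> \<psi>"
    and "su3_torsion_forms br \<omega> \<psi> w1 w2p w2m"
  shows "l = - 3 * c - 1 / 2 * ((form_norm (su3_metric \<omega> \<psi>) 2 w2m)\<^sup>2
                                + 6 * (form_norm (su3_metric \<omega> \<psi>) 1 w1)\<^sup>2)
       \<and> l = - 3 * c - 1 / 2 * (form_norm (g2_metric \<phi>) 2 \<tau>)\<^sup>2"
proof -
  note hyps = assms(2-)
  have br: "alternating_bilinear br" and \<omega>\<^sub>0: "is_form 2 \<omega>\<^sub>0" and uni: "unimodular br"
    using hyps alternating_bilinear_lie_algebra by auto
  have sol: "semi_algebraic_soliton (central_ext br \<omega>\<^sub>0) \<phi> l D" and Dz: "D zvec = c *\<^sub>R zvec"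
    and tf: "g2_torsion_form (central_ext br \<omega>\<^sub>0) \<phi> \<tau>"
    and ind: "induced_su3_structure \<phi> \<omega> \<psi>" and stf: "su3_torsion_forms br \<omega> \<psi> w1 w2p w2m"
    using hyps by (auto simp: g_def)
  have su3: "su3_structure \<omega> \<psi>"
    using ind by (simp add: induced_su3_structure_def)
  then have \<omega>: "is_form 2 \<omega>" and \<psi>: "is_form 3 \<psi>"
    by (auto simp: su3_structure_def)
  have g2: "g2_structure \<phi>" and closed: "ce_d (central_ext br \<omega>\<^sub>0) 3 \<phi> = (\<lambda>_. 0)"
    using sol by (auto simp: semi_algebraic_soliton_def closed_g2_structure_def)
  obtain e d where fr: "su3_frame \<omega> \<psi> e d"
    using su3_frame_exists[OF su3] .
  obtain \<theta> where \<theta>: "linear \<theta>" "\<theta> zvec > 0"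
    and \<phi>: "\<phi> = (\<lambda>x. wedge 2 1 (lift_form \<omega>) (\<lambda>x. \<theta> (x 0)) x + lift_form \<psi> x)"
    using induced_su3_structure_form[OF g2 ind fr] .
  have nz: "\<theta> zvec \<noteq> 0" using \<theta>(2) by simp
  \<comment> \<open>Both scalar identities combine to |\<tau>|^2 = - 2 l - 6 c.\<close>
  have "form_inner (g2_metric \<phi>) 2 \<tau> \<tau> = 7 * l + 3 * (- 3 * l - 2 * c)"
    using soliton_torsion_norm[OF g2_frame_ext[OF fr \<omega> \<psi> \<theta>(1) nz \<phi>]
        alternating_bilinear_central_ext[OF br \<omega>\<^sub>0] tf sol]
      soliton_trace_identity[OF fr \<omega> \<psi> br uni \<omega>\<^sub>0 \<theta>(1) nz \<phi> tf sol Dz] by simp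
  then have "l = - 3 * c - 1 / 2 * form_inner (g2_metric \<phi>) 2 \<tau> \<tau>"
    by (simp add: algebra_simps)
  then show ?thesis
    using torsion_norm[OF su3 fr br \<omega>\<^sub>0 \<theta>(1) nz \<phi> closed tf stf] unfolding form_norm_squared by simp
qed

end
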